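(* Let $(H,\Delta,\phi,T,\gamma,\mathcal G)$ be a (respectively strong) $*$-quasi Hopf algebra over $\mathbb C$. Then the category ${}_H\mathcal M$ of left $H$-modules is a (respectively strong) bar category. The associator in the category is $$\Phi((u\otimes v)\otimes w)=\phi^{(1)}\triangleright u\otimes(\phi^{(2)}\triangleright v\otimes\phi^{(3)}\triangleright w),$$ and the operations of the bar category are given by $$h\triangleright\overline v=\overline{T(h)\triangleright v},\qquad \mathrm{bb}(x)=\overline{\overline{\gamma\triangleright x}},\qquad \Upsilon(\overline{x\otimes y})=\overline{\mathcal G^{(2)}\triangleright y}\otimes\overline{\mathcal G^{(1)}\triangleright x},$$ with $\star:\mathbb C\to\overline{\mathbb C}$ complex conjugation. The coboundary natural isomorphism $\Xi$ is given by $$\Xi(x\otimes y)=\gamma^{-1}T(\tilde{\mathcal G}^{(2)})\,\mathcal G^{(1)}\gamma_{(1)}\triangleright x\;\otimes\;\gamma^{-1}T(\tilde{\mathcal G}^{(1)})\,\mathcal G^{(2)}\gamma_{(2)}\triangleright y,$$ where $\tilde{\mathcal G}$ is a second independent copy of $\mathcal G$.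
   Context: Monoidal conventions: $\Phi_{X,Y,Z}:(X\otimes Y)\otimes Z\to X\otimes(Y\otimes Z)$, $l_X:X\to X\otimes 1$, $r_X:X\to 1\otimes X$. A bar category is a monoidal category with: a functor bar, $X\mapsto\overline X$, $\theta\mapsto\overline\theta$; a natural isomorphism $\mathrm{bb}_X:X\to\overline{\overline X}$; an invertible morphism $\star:1\to\overline 1$; and a natural isomorphism $\Upsilon_{X,Y}:\overline{X\otimes Y}\to\overline Y\otimes\overline X$; such that (a) $(\star^{-1}\otimes\mathrm{id})\Upsilon_{X,1}\overline{l_X}=r_{\overline X}$ and $(\mathrm{id}\otimes\star^{-1})\Upsilon_{1,X}\overline{r_X}=l_{\overline X}$; (b) $\Phi_{\overline Z,\overline Y,\overline X}(\Upsilon_{Y,Z}\otimes\mathrm{id})\Upsilon_{X,Y\otimes Z}\overline{\Phi_{X,Y,Z}}=(\mathrm{id}\otimes\Upsilon_{X,Y})\Upsilon_{X\otimes Y,Z}$; (c) $\overline\star\,\star=\mathrm{bb}_1$; (d) $\overline{\mathrm{bb}_X}=\mathrm{bb}_{\overline X}$. The coboundary $\Xi_{X,Y}:X\otimes Y\to X\otimes Y$ is defined by $(\mathrm{bb}_X\otimes\mathrm{bb}_Y)\,\Xi_{X,Y}=\Upsilon_{\overline Y,\overline X}\,\overline{\Upsilon_{X,Y}}\,\mathrm{bb}_{X\otimes Y}$; the bar category is strong if $\Xi=\mathrm{id}$. For a complex vector space $V$, $\overline V$ is the same abelian group, with $v$ written $\overline v$ and $\lambda\overline v=\overline{\overline\lambda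 v}$; $\overline\theta(\overline v)=\overline{\theta(v)}$. A quasi-Hopf algebra $(H,\Delta,\phi)$ is in Drinfeld's sense, with counit $\epsilon$, $\Delta h=h_{(1)}\otimes h_{(2)}$ and $\phi=\phi^{(1)}\otimes\phi^{(2)}\otimes\phi^{(3)}\in H^{\otimes 3}$ invertible with $(\mathrm{id}\otimes\Delta)\Delta h=\phi\,((\Delta\otimes\mathrm{id})\Delta h)\,\phi^{-1}$, so that ${}_H\mathcal M$ is monoidal with tensor product of modules via $\Delta$ and unit $\mathbb C$ via $\epsilon$. A $*$-quasi Hopf algebra $(H,\Delta,\phi,T,\gamma,\mathcal G)$ is a quasi-Hopf algebra over $\mathbb C$ together with a conjugate-linear algebra map $T:H\to H$, an invertible $\gamma\in H$, and an invertible $\mathcal G=\mathcal G^{(1)}\otimes\mathcal G^{(2)}\in H\otimes H$ satisfying, for all $h\in H$, $$T^2(h)=\gamma h\gamma^{-1},\quad \Delta(Th)=\mathcal G^{-1}\big((T\otimes T)\,\tau\Delta h\big)\mathcal G,\quad (\epsilon\otimes\mathrm{id})\mathcal G=(\mathrm{id}\otimes\epsilon)\mathcal G=1,\quad \gamma=T(\gamma),$$ $$\big((T\otimes T\otimes T)\phi_{321}\big)(1\otimes\mathcal G)\big((\mathrm{id}\otimes\Delta)\mathcal G\big)=(\mathcal G\otimes 1)\big((\Delta\otimes\mathrm{id})\mathcal G\big)\phi^{-1},$$ where $\tau$ is the transposition and $\phi_{321}=\phi^{(3)}\otimes\phi^{(2)}\otimes\phi^{(1)}$. It is strong if $(\gamma\otimes\gamma)\Delta\gamma^{-1}=\big((T\otimes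 T)(\mathcal G_{21})\big)\mathcal G$, with $\mathcal G_{21}=\mathcal G^{(2)}\otimes\mathcal G^{(1)}$.
   Formalization: In the non-strong case the bar category claim is made under the added assumption ε(γ)=1, which axiom (c) with ⋆ complex conjugation forces and which can fail (H=ℂ, T conjugation, φ and 𝒢 trivial, γ=2). *)

theory Defs
  imports Complex_Main "HOL-Algebra.Module"
begin

section \<open>Bar categories\<close>

record ('o, 'm) cat =
  Ob :: "'o set"
  Hom :: "'o \<Rightarrow> 'o \<Rightarrow> 'm set"
  Idn :: "'o \<Rightarrow> 'm"
  Comp :: "'m \<Rightarrow> 'm \<Rightarrow> 'm"  (infixl "\<cdot>\<index>" 60)

record ('o, 'm) monoidal_cat = "('o, 'm) cat" +
  TensO :: "'o \<Rightarrow> 'o \<Rightarrow> 'o"  (infixr "\<boxtimes>\<index>" 75)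
  TensM :: "'m \<Rightarrow> 'm \<Rightarrow> 'm"  (infixr "\<boxdot>\<index>" 75)
  Unit :: "'o"
  Assoc :: "'o \<Rightarrow> 'o \<Rightarrow> 'o \<Rightarrow> 'm"
  LUnit :: "'o \<Rightarrow> 'm"
  RUnit :: "'o \<Rightarrow> 'm"

record ('o, 'm) bar_cat = "('o, 'm) monoidal_cat" +
  BarO :: "'o \<Rightarrow> 'o"
  BarM :: "'m \<Rightarrow> 'm"
  BB :: "'o \<Rightarrow> 'm"
  Star :: "'m"
  Ups :: "'o \<Rightarrow> 'o \<Rightarrow> 'm"

definition inverse_arrows :: "('o, 'm, 'z) cat_scheme \<Rightarrow> 'o \<Rightarrow> 'o \<Rightarrow> 'm \<Rightarrow> 'm \<Rightarrow> bool" where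
  "inverse_arrows C X Y f g \<longleftrightarrow>
     f \<in> Hom C X Y \<and> g \<in> Hom C Y X \<and>
     g \<cdot>\<^bsub>C\<^esub> f = Idn C X \<and> f \<cdot>\<^bsub>C\<^esub> g = Idn C Y"

definition iso_arrow :: "('o, 'm, 'z) cat_scheme \<Rightarrow> 'o \<Rightarrow> 'o \<Rightarrow> 'm \<Rightarrow> bool" where
  "iso_arrow C X Y f \<longleftrightarrow> (\<exists>g. inverse_arrows C X Y f g)"

definition inv_arrow :: "('o, 'm, 'z) cat_scheme \<Rightarrow> 'o \<Rightarrow> 'o \<Rightarrow> 'm \<Rightarrow> 'm" where
  "inv_arrow C X Y f = (THE g. inverse_arrows C X Y f g)"

locale category =
  fixes C :: "('o, 'm, 'z) cat_scheme" (structure)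
  assumes Idn_in_Hom: "X \<in> Ob C \<Longrightarrow> Idn C X \<in> Hom C X X"
    and Comp_in_Hom:
      "\<lbrakk>X \<in> Ob C; Y \<in> Ob C; Z \<in> Ob C; f \<in> Hom C X Y; g \<in> Hom C Y Z\<rbrakk> \<Longrightarrow> g \<cdot> f \<in> Hom C X Z"
    and Comp_assoc:
      "\<lbrakk>W \<in> Ob C; X \<in> Ob C; Y \<in> Ob C; Z \<in> Ob C;
        f \<in> Hom C W X; g \<in> Hom C X Y; h \<in> Hom C Y Z\<rbrakk> \<Longrightarrow> (h \<cdot> g) \<cdot> f = h \<cdot> (g \<cdot> f)"
    and Idn_left: "\<lbrakk>X \<in> Ob C; Y \<in> Ob C; f \<in> Hom C X Y\<rbrakk> \<Longrightarrow> Idn C Y \<cdot> f = f"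
    and Idn_right: "\<lbrakk>X \<in> Ob C; Y \<in> Ob C; f \<in> Hom C X Y\<rbrakk> \<Longrightarrow> f \<cdot> Idn C X = f"

text \<open>The unit isomorphisms point away from \<open>X\<close>: \<open>LUnit X : X \<rightarrow> X \<otimes> 1\<close>
  and \<open>RUnit X : X \<rightarrow> 1 \<otimes> X\<close>.\<close>

locale monoidal_category = category C
  for C :: "('o, 'm, 'z) monoidal_cat_scheme" (structure) +
  assumes TensO_Ob: "\<lbrakk>X \<in> Ob C; Y \<in> Ob C\<rbrakk> \<Longrightarrow> X \<boxtimes> Y \<in> Ob C"
    and Unit_Ob: "Unit C \<in> Ob C"
    and TensM_in_Hom:
      "\<lbrakk>X \<in> Ob C; X' \<in> Ob C; Y \<in> Ob C; Y' \<in> Ob C; f \<in> Hom C X X'; g \<in> Hom C Y Y'\<rbrakk>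
        \<Longrightarrow> f \<boxdot> g \<in> Hom C (X \<boxtimes> Y) (X' \<boxtimes> Y')"
    and TensM_Idn: "\<lbrakk>X \<in> Ob C; Y \<in> Ob C\<rbrakk> \<Longrightarrow> Idn C X \<boxdot> Idn C Y = Idn C (X \<boxtimes> Y)"
    and TensM_Comp:
      "\<lbrakk>X \<in> Ob C; X' \<in> Ob C; X'' \<in> Ob C; Y \<in> Ob C; Y' \<in> Ob C; Y'' \<in> Ob C;
        f \<in> Hom C X X'; f' \<in> Hom C X' X''; g \<in> Hom C Y Y'; g' \<in> Hom C Y' Y''\<rbrakk>
        \<Longrightarrow> (f' \<cdot> f) \<boxdot> (g' \<cdot> g) = (f' \<boxdot> g') \<cdot> (f \<boxdot> g)"
    and Assoc_iso:
      "\<lbrakk>X \<in> Ob C; Y \<in> Ob C; Z \<in> Ob C\<rbrakk>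
        \<Longrightarrow> iso_arrow C ((X \<boxtimes> Y) \<boxtimes> Z) (X \<boxtimes> (Y \<boxtimes> Z)) (Assoc C X Y Z)"
    and Assoc_natural:
      "\<lbrakk>X \<in> Ob C; X' \<in> Ob C; Y \<in> Ob C; Y' \<in> Ob C; Z \<in> Ob C; Z' \<in> Ob C;
        f \<in> Hom C X X'; g \<in> Hom C Y Y'; h \<in> Hom C Z Z'\<rbrakk>
        \<Longrightarrow> Assoc C X' Y' Z' \<cdot> ((f \<boxdot> g) \<boxdot> h) = (f \<boxdot> (g \<boxdot> h)) \<cdot> Assoc C X Y Z"
    and LUnit_iso: "X \<in> Ob C \<Longrightarrow> iso_arrow C X (X \<boxtimes> Unit C) (LUnit C X)"
    and LUnit_natural:
      "\<lbrakk>X \<in> Ob C; Y \<in> Ob C; f \<in> Hom C X Y\<rbrakk>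
        \<Longrightarrow> LUnit C Y \<cdot> f = (f \<boxdot> Idn C (Unit C)) \<cdot> LUnit C X"
    and RUnit_iso: "X \<in> Ob C \<Longrightarrow> iso_arrow C X (Unit C \<boxtimes> X) (RUnit C X)"
    and RUnit_natural:
      "\<lbrakk>X \<in> Ob C; Y \<in> Ob C; f \<in> Hom C X Y\<rbrakk>
        \<Longrightarrow> RUnit C Y \<cdot> f = (Idn C (Unit C) \<boxdot> f) \<cdot> RUnit C X"
    and pentagon:
      "\<lbrakk>W \<in> Ob C; X \<in> Ob C; Y \<in> Ob C; Z \<in> Ob C\<rbrakk>
        \<Longrightarrow> Assoc C W X (Y \<boxtimes> Z) \<cdot> Assoc C (W \<boxtimes> X) Y Z =
            (Idn C W \<boxdot> Assoc C X Y Z) \<cdot> Assoc C W (X \<boxtimes> Y) Z \<cdot> (Assoc C W X Y \<boxdot> Idn C Z)"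
    and triangle:
      "\<lbrakk>X \<in> Ob C; Y \<in> Ob C\<rbrakk>
        \<Longrightarrow> Assoc C X (Unit C) Y \<cdot> (LUnit C X \<boxdot> Idn C Y) = Idn C X \<boxdot> RUnit C Y"

locale bar_category = monoidal_category C
  for C :: "('o, 'm, 'z) bar_cat_scheme" (structure) +
  assumes BarO_Ob: "X \<in> Ob C \<Longrightarrow> BarO C X \<in> Ob C"
    and BarM_in_Hom:
      "\<lbrakk>X \<in> Ob C; Y \<in> Ob C; f \<in> Hom C X Y\<rbrakk> \<Longrightarrow> BarM C f \<in> Hom C (BarO C X) (BarO C Y)"
    and BarM_Idn: "X \<in> Ob C \<Longrightarrow> BarM C (Idn C X) = Idn C (BarO C X)"
    and BarM_Comp:
      "\<lbrakk>X \<in> Ob C; Y \<in> Ob C; Z \<in> Ob C; f \<in> Hom C X Y; g \<in> Hom C Y Z\<rbrakk>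
        \<Longrightarrow> BarM C (g \<cdot> f) = BarM C g \<cdot> BarM C f"
    and BB_iso: "X \<in> Ob C \<Longrightarrow> iso_arrow C X (BarO C (BarO C X)) (BB C X)"
    and BB_natural:
      "\<lbrakk>X \<in> Ob C; Y \<in> Ob C; f \<in> Hom C X Y\<rbrakk> \<Longrightarrow> BB C Y \<cdot> f = BarM C (BarM C f) \<cdot> BB C X"
    and Star_iso: "iso_arrow C (Unit C) (BarO C (Unit C)) (Star C)"
    and Ups_iso:
      "\<lbrakk>X \<in> Ob C; Y \<in> Ob C\<rbrakk>
        \<Longrightarrow> iso_arrow C (BarO C (X \<boxtimes> Y)) (BarO C Y \<boxtimes> BarO C X) (Ups C X Y)"
    and Ups_natural:
      "\<lbrakk>X \<in> Ob C; X' \<in> Ob C; Y \<in> Ob C; Y' \<in> Ob C; f \<in> Hom C X X'; g \<in> Hom C Y Y'\<rbrakk>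
        \<Longrightarrow> Ups C X' Y' \<cdot> BarM C (f \<boxdot> g) = (BarM C g \<boxdot> BarM C f) \<cdot> Ups C X Y"
    and Ups_Unit_right:
      "X \<in> Ob C \<Longrightarrow>
        (inv_arrow C (Unit C) (BarO C (Unit C)) (Star C) \<boxdot> Idn C (BarO C X))
          \<cdot> Ups C X (Unit C) \<cdot> BarM C (LUnit C X) = RUnit C (BarO C X)"
    and Ups_Unit_left:
      "X \<in> Ob C \<Longrightarrow>
        (Idn C (BarO C X) \<boxdot> inv_arrow C (Unit C) (BarO C (Unit C)) (Star C))
          \<cdot> Ups C (Unit C) X \<cdot> BarM C (RUnit C X) = LUnit C (BarO C X)"
    and Ups_Assoc:
      "\<lbrakk>X \<in> Ob C; Y \<in> Ob C; Z \<in> Ob C\<rbrakk> \<Longrightarrow>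
        Assoc C (BarO C Z) (BarO C Y) (BarO C X) \<cdot> (Ups C Y Z \<boxdot> Idn C (BarO C X))
          \<cdot> Ups C X (Y \<boxtimes> Z) \<cdot> BarM C (Assoc C X Y Z) =
        (Idn C (BarO C Z) \<boxdot> Ups C X Y) \<cdot> Ups C (X \<boxtimes> Y) Z"
    and Star_Star: "BarM C (Star C) \<cdot> Star C = BB C (Unit C)"
    and BarM_BB: "X \<in> Ob C \<Longrightarrow> BarM C (BB C X) = BB C (BarO C X)"

definition coboundary :: "('o, 'm, 'z) bar_cat_scheme \<Rightarrow> 'o \<Rightarrow> 'o \<Rightarrow> 'm" where
  "coboundary C X Y =
     (THE f. f \<in> Hom C (X \<boxtimes>\<^bsub>C\<^esub> Y) (X \<boxtimes>\<^bsub>C\<^esub> Y) \<and>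
        (BB C X \<boxdot>\<^bsub>C\<^esub> BB C Y) \<cdot>\<^bsub>C\<^esub> f =
        Ups C (BarO C Y) (BarO C X) \<cdot>\<^bsub>C\<^esub> BarM C (Ups C X Y) \<cdot>\<^bsub>C\<^esub> BB C (X \<boxtimes>\<^bsub>C\<^esub> Y))"

locale strong_bar_category = bar_category +
  assumes strong: "\<lbrakk>X \<in> Ob C; Y \<in> Ob C\<rbrakk> \<Longrightarrow> coboundary C X Y = Idn C (X \<boxtimes> Y)"


section \<open>Tensor products over the complex numbers\<close>

definition complex_field :: "complex ring" where
  "complex_field = \<lparr>carrier = UNIV, mult = (*), one = 1, zero = 0, add = (+)\<rparr>"

text \<open>A list \<open>[(v\<^sub>1, w\<^sub>1), \<dots>, (v\<^sub>n, w\<^sub>n)]\<close> stands for the formal sum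
  \<open>v\<^sub>1 \<otimes> w\<^sub>1 + \<dots> + v\<^sub>n \<otimes> w\<^sub>n\<close>. The relation below is the congruence whose
  quotient is the tensor product. Multiplying by the scalar \<open>-1\<close> gives negatives, and the second
  zero law follows from \<open>bal\<close>.\<close>

inductive tensor_eq ::
  "(complex, 'a, 'x) module_scheme \<Rightarrow> (complex, 'b, 'y) module_scheme \<Rightarrow>
    ('a \<times> 'b) list \<Rightarrow> ('a \<times> 'b) list \<Rightarrow> bool"
  for V :: "(complex, 'a, 'x) module_scheme" and W :: "(complex, 'b, 'y) module_scheme"
where
  refl: "set l \<subseteq> carrier V \<times> carrier W \<Longrightarrow> tensor_eq V W l l"
| sym: "tensor_eq V W l m \<Longrightarrow> tensor_eq V W m l"
| trans: "tensor_eq V W l m \<Longrightarrow> tensor_eq V W m n \<Longrightarrow> tensor_eq V W l n"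
| append: "tensor_eq V W l l' \<Longrightarrow> tensor_eq V W m m' \<Longrightarrow> tensor_eq V W (l @ m) (l' @ m')"
| comm: "set l \<subseteq> carrier V \<times> carrier W \<Longrightarrow> set m \<subseteq> carrier V \<times> carrier W
    \<Longrightarrow> tensor_eq V W (l @ m) (m @ l)"
| null: "w \<in> carrier W \<Longrightarrow> tensor_eq V W [(\<zero>\<^bsub>V\<^esub>, w)] []"
| addl: "v \<in> carrier V \<Longrightarrow> v' \<in> carrier V \<Longrightarrow> w \<in> carrier W
    \<Longrightarrow> tensor_eq V W [(v \<oplus>\<^bsub>V\<^esub> v', w)] [(v, w), (v', w)]"
| addr: "v \<in> carrier V \<Longrightarrow> w \<in> carrier W \<Longrightarrow> w' \<in> carrier W
    \<Longrightarrow> tensor_eq V W [(v, w \<oplus>\<^bsub>W\<^esub> w')] [(v, w), (v, w')]"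
| bal: "v \<in> carrier V \<Longrightarrow> w \<in> carrier W
    \<Longrightarrow> tensor_eq V W [(c \<odot>\<^bsub>V\<^esub> v, w)] [(v, c \<odot>\<^bsub>W\<^esub> w)]"

text \<open>Elements of the tensor product are canonical representatives of the congruence classes, so
  that they are again lists of pairs; \<open>tsum V W l\<close> is the element \<open>\<Sum> v \<otimes> w\<close>
  represented by \<open>l\<close>. Sweedler-type expressions become list comprehensions.\<close>

definition tsum ::
  "(complex, 'a, 'x) module_scheme \<Rightarrow> (complex, 'b, 'y) module_scheme \<Rightarrow>
    ('a \<times> 'b) list \<Rightarrow> ('a \<times> 'b) list" where
  "tsum V W l = (SOME l'. tensor_eq V W l l')"

text \<open>The multiplication and the unit below are meaningful only when both factors are algebras.\<close>

definition tens ::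
  "(complex, 'a, 'x) module_scheme \<Rightarrow> (complex, 'b, 'y) module_scheme \<Rightarrow>
    (complex, ('a \<times> 'b) list) module" where
  "tens V W =
    \<lparr>carrier = tsum V W ` {l. set l \<subseteq> carrier V \<times> carrier W},
     mult = (\<lambda>s t. tsum V W [(a \<otimes>\<^bsub>V\<^esub> c, b \<otimes>\<^bsub>W\<^esub> d). (a, b) \<leftarrow> s, (c, d) \<leftarrow> t]),
     one = tsum V W [(\<one>\<^bsub>V\<^esub>, \<one>\<^bsub>W\<^esub>)],
     zero = tsum V W [],
     add = (\<lambda>s t. tsum V W (s @ t)),
     smult = (\<lambda>c t. tsum V W [(c \<odot>\<^bsub>V\<^esub> v, w). (v, w) \<leftarrow> t])\<rparr>"

abbreviation tens2 where "tens2 H \<equiv> tens H H"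
abbreviation tens3 where "tens3 H \<equiv> tens H (tens2 H)"
abbreviation tens4 where "tens4 H \<equiv> tens H (tens3 H)"

text \<open>Threefold and fourfold tensor powers are bracketed to the right. \<open>triples\<close> lists the
  elementary tensors \<open>a \<otimes> (b \<otimes> c)\<close> of an element, \<open>tsum3\<close> sums them.\<close>

definition tsum3 :: "(complex, 'a, 'x) module_scheme \<Rightarrow> ('a \<times> 'a \<times> 'a) list \<Rightarrow>
    ('a \<times> ('a \<times> 'a) list) list" where
  "tsum3 H l = tsum H (tens2 H) [(a, tsum H H [(b, c)]). (a, b, c) \<leftarrow> l]"

definition tsum4 :: "(complex, 'a, 'x) module_scheme \<Rightarrow> ('a \<times> 'a \<times> 'a \<times> 'a) list \<Rightarrow>
    ('a \<times> ('a \<times> ('a \<times> 'a) list) list) list" where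
  "tsum4 H l = tsum H (tens3 H) [(a, tsum3 H [(b, c, d)]). (a, b, c, d) \<leftarrow> l]"

definition triples :: "('a \<times> ('b \<times> 'c) list) list \<Rightarrow> ('a \<times> 'b \<times> 'c) list" where
  "triples t = [(a, b, c). (a, s) \<leftarrow> t, (b, c) \<leftarrow> s]"

definition lsum :: "('a, 'x) ring_scheme \<Rightarrow> 'a list \<Rightarrow> 'a" where
  "lsum R l = foldr (add R) l \<zero>\<^bsub>R\<^esub>"


section \<open>Star quasi-Hopf algebras\<close>

record 'h quasi_hopf = "(complex, 'h) module" +
  comul :: "'h \<Rightarrow> ('h \<times> 'h) list"
  counit :: "'h \<Rightarrow> complex"
  reassoc :: "('h \<times> ('h \<times> 'h) list) list"

record 'h star_quasi_hopf = "'h quasi_hopf" +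
  starT :: "'h \<Rightarrow> 'h"
  gam :: "'h"
  gauge :: "('h \<times> 'h) list"

locale complex_algebra = ring H + module complex_field H
  for H :: "(complex, 'h, 'x) module_scheme" (structure) +
  assumes smult_mult_left:
      "\<lbrakk>x \<in> carrier H; y \<in> carrier H\<rbrakk> \<Longrightarrow> (c \<odot> x) \<otimes> y = c \<odot> (x \<otimes> y)"
    and smult_mult_right:
      "\<lbrakk>x \<in> carrier H; y \<in> carrier H\<rbrakk> \<Longrightarrow> x \<otimes> (c \<odot> y) = c \<odot> (x \<otimes> y)"

text \<open>Drinfeld's antipode: an anti-automorphism \<open>S\<close> with elements \<open>\<alpha>\<close>, \<open>\<beta>\<close>.\<close>

definition quasi_antipode ::
  "('h, 'x) quasi_hopf_scheme \<Rightarrow> ('h \<Rightarrow> 'h) \<Rightarrow> 'h \<Rightarrow> 'h \<Rightarrow> bool" where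
  "quasi_antipode H S \<alpha> \<beta> \<longleftrightarrow>
     bij_betw S (carrier H) (carrier H) \<and> \<alpha> \<in> carrier H \<and> \<beta> \<in> carrier H \<and>
     S \<one>\<^bsub>H\<^esub> = \<one>\<^bsub>H\<^esub> \<and>
     (\<forall>x\<in>carrier H. \<forall>y\<in>carrier H.
        S (x \<oplus>\<^bsub>H\<^esub> y) = S x \<oplus>\<^bsub>H\<^esub> S y \<and> S (x \<otimes>\<^bsub>H\<^esub> y) = S y \<otimes>\<^bsub>H\<^esub> S x) \<and>
     (\<forall>x\<in>carrier H. \<forall>c. S (c \<odot>\<^bsub>H\<^esub> x) = c \<odot>\<^bsub>H\<^esub> S x) \<and>
     (\<forall>h\<in>carrier H.
        lsum H [S a \<otimes>\<^bsub>H\<^esub> \<alpha> \<otimes>\<^bsub>H\<^esub> b. (a, b) \<leftarrow> comul H h] = counit H h \<odot>\<^bsub>H\<^esub> \<alpha> \<and>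
        lsum H [a \<otimes>\<^bsub>H\<^esub> \<beta> \<otimes>\<^bsub>H\<^esub> S b. (a, b) \<leftarrow> comul H h] = counit H h \<odot>\<^bsub>H\<^esub> \<beta>) \<and>
     lsum H [a \<otimes>\<^bsub>H\<^esub> \<beta> \<otimes>\<^bsub>H\<^esub> S b \<otimes>\<^bsub>H\<^esub> \<alpha> \<otimes>\<^bsub>H\<^esub> c. (a, b, c) \<leftarrow> triples (reassoc H)]
       = \<one>\<^bsub>H\<^esub> \<and>
     lsum H [S a \<otimes>\<^bsub>H\<^esub> \<alpha> \<otimes>\<^bsub>H\<^esub> b \<otimes>\<^bsub>H\<^esub> \<beta> \<otimes>\<^bsub>H\<^esub> S c.
         (a, b, c) \<leftarrow> triples (inv\<^bsub>tens3 H\<^esub> (reassoc H))] = \<one>\<^bsub>H\<^esub>"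

locale quasi_hopf_algebra = complex_algebra H
  for H :: "('h, 'x) quasi_hopf_scheme" (structure) +
  assumes comul_hom: "comul H \<in> ring_hom H (tens2 H)"
    and comul_smult: "h \<in> carrier H \<Longrightarrow> comul H (c \<odot> h) = c \<odot>\<^bsub>tens2 H\<^esub> comul H h"
    and counit_hom: "counit H \<in> ring_hom H complex_field"
    and counit_smult: "h \<in> carrier H \<Longrightarrow> counit H (c \<odot> h) = c * counit H h"
    and counit_left: "h \<in> carrier H \<Longrightarrow> lsum H [counit H a \<odot> b. (a, b) \<leftarrow> comul H h] = h"
    and counit_right: "h \<in> carrier H \<Longrightarrow> lsum H [counit H b \<odot> a. (a, b) \<leftarrow> comul H h] = h"
    and reassoc_unit: "reassoc H \<in> Units (tens3 H)"
    and quasi_coassoc: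
      "h \<in> carrier H \<Longrightarrow>
        tsum3 H [(a, b, c). (a, d) \<leftarrow> comul H h, (b, c) \<leftarrow> comul H d] =
        reassoc H \<otimes>\<^bsub>tens3 H\<^esub>
          tsum3 H [(a, b, c). (d, c) \<leftarrow> comul H h, (a, b) \<leftarrow> comul H d] \<otimes>\<^bsub>tens3 H\<^esub>
        inv\<^bsub>tens3 H\<^esub> (reassoc H)"
    and reassoc_pentagon:
      "tsum4 H [(a, b, c, d). (a, b, e) \<leftarrow> triples (reassoc H), (c, d) \<leftarrow> comul H e]
         \<otimes>\<^bsub>tens4 H\<^esub>
       tsum4 H [(a, b, c, d). (e, c, d) \<leftarrow> triples (reassoc H), (a, b) \<leftarrow> comul H e] =
       tsum4 H [(\<one>, b, c, d). (b, c, d) \<leftarrow> triples (reassoc H)]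
         \<otimes>\<^bsub>tens4 H\<^esub>
       tsum4 H [(a, b, c, d). (a, e, d) \<leftarrow> triples (reassoc H), (b, c) \<leftarrow> comul H e]
         \<otimes>\<^bsub>tens4 H\<^esub>
       tsum4 H [(a, b, c, \<one>). (a, b, c) \<leftarrow> triples (reassoc H)]"
    and reassoc_counit:
      "tsum H H [(a, counit H b \<odot> c). (a, b, c) \<leftarrow> triples (reassoc H)] = \<one>\<^bsub>tens2 H\<^esub>"
    and antipode: "\<exists>S \<alpha> \<beta>. quasi_antipode H S \<alpha> \<beta>"

text \<open>Pitfall: these axioms force \<open>counit H (gam H)\<close> to be real and nonzero, but not to be \<open>1\<close>
  (take \<open>H = \<complex>\<close> with trivial structure, \<open>T\<close> complex conjugation and \<open>gam H = 2\<close>). In the strong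
  case, \<open>counit H (gam H) = 1\<close> follows by applying \<open>\<epsilon> \<otimes> \<epsilon>\<close> to the additional axiom.\<close>

locale star_quasi_hopf_algebra = quasi_hopf_algebra H
  for H :: "('h, 'x) star_quasi_hopf_scheme" (structure) +
  assumes starT_hom: "starT H \<in> ring_hom H H"
    and starT_smult: "h \<in> carrier H \<Longrightarrow> starT H (c \<odot> h) = cnj c \<odot> starT H h"
    and gam_unit: "gam H \<in> Units H"
    and gauge_unit: "gauge H \<in> Units (tens2 H)"
    and starT_starT: "h \<in> carrier H \<Longrightarrow> starT H (starT H h) = gam H \<otimes> h \<otimes> inv (gam H)"
    and comul_starT:
      "h \<in> carrier H \<Longrightarrow>
        comul H (starT H h) =
        inv\<^bsub>tens2 H\<^esub> (gauge H) \<otimes>\<^bsub>tens2 H\<^esub>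
          tsum H H [(starT H b, starT H a). (a, b) \<leftarrow> comul H h] \<otimes>\<^bsub>tens2 H\<^esub> gauge H"
    and gauge_counit_left: "lsum H [counit H a \<odot> b. (a, b) \<leftarrow> gauge H] = \<one>"
    and gauge_counit_right: "lsum H [counit H b \<odot> a. (a, b) \<leftarrow> gauge H] = \<one>"
    and starT_gam: "gam H = starT H (gam H)"
    and gauge_reassoc:
      "tsum3 H [(starT H c, starT H b, starT H a). (a, b, c) \<leftarrow> triples (reassoc H)]
         \<otimes>\<^bsub>tens3 H\<^esub>
       tsum3 H [(\<one>, a, b). (a, b) \<leftarrow> gauge H]
         \<otimes>\<^bsub>tens3 H\<^esub>
       tsum3 H [(a, b, c). (a, d) \<leftarrow> gauge H, (b, c) \<leftarrow> comul H d] =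
       tsum3 H [(a, b, \<one>). (a, b) \<leftarrow> gauge H]
         \<otimes>\<^bsub>tens3 H\<^esub>
       tsum3 H [(a, b, c). (d, c) \<leftarrow> gauge H, (a, b) \<leftarrow> comul H d]
         \<otimes>\<^bsub>tens3 H\<^esub>
       inv\<^bsub>tens3 H\<^esub> (reassoc H)"

locale strong_star_quasi_hopf_algebra = star_quasi_hopf_algebra +
  assumes strong:
    "tsum H H [(gam H, gam H)] \<otimes>\<^bsub>tens2 H\<^esub> comul H (inv (gam H)) =
     tsum H H [(starT H b, starT H a). (a, b) \<leftarrow> gauge H] \<otimes>\<^bsub>tens2 H\<^esub> gauge H"


section \<open>The category of left modules\<close>

text \<open>The \<open>mult\<close> and \<open>one\<close> fields inherited from rings play no role in a module.\<close>

record ('h, 'v) hmod = "(complex, 'v) module" +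
  act :: "'h \<Rightarrow> 'v \<Rightarrow> 'v"

locale left_module = module complex_field M
  for H :: "(complex, 'h, 'x) module_scheme" and M :: "('h, 'v) hmod" +
  assumes act_closed: "\<lbrakk>h \<in> carrier H; v \<in> carrier M\<rbrakk> \<Longrightarrow> act M h v \<in> carrier M"
    and act_add_right:
      "\<lbrakk>h \<in> carrier H; v \<in> carrier M; w \<in> carrier M\<rbrakk>
        \<Longrightarrow> act M h (v \<oplus>\<^bsub>M\<^esub> w) = act M h v \<oplus>\<^bsub>M\<^esub> act M h w"
    and act_smult_right:
      "\<lbrakk>h \<in> carrier H; v \<in> carrier M\<rbrakk> \<Longrightarrow> act M h (c \<odot>\<^bsub>M\<^esub> v) = c \<odot>\<^bsub>M\<^esub> act M h v"
    and act_add_left: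
      "\<lbrakk>h \<in> carrier H; k \<in> carrier H; v \<in> carrier M\<rbrakk>
        \<Longrightarrow> act M (h \<oplus>\<^bsub>H\<^esub> k) v = act M h v \<oplus>\<^bsub>M\<^esub> act M k v"
    and act_smult_left:
      "\<lbrakk>h \<in> carrier H; v \<in> carrier M\<rbrakk> \<Longrightarrow> act M (c \<odot>\<^bsub>H\<^esub> h) v = c \<odot>\<^bsub>M\<^esub> act M h v"
    and act_mult:
      "\<lbrakk>h \<in> carrier H; k \<in> carrier H; v \<in> carrier M\<rbrakk>
        \<Longrightarrow> act M (h \<otimes>\<^bsub>H\<^esub> k) v = act M h (act M k v)"
    and act_one: "v \<in> carrier M \<Longrightarrow> act M \<one>\<^bsub>H\<^esub> v = v"

text \<open>A universe for the underlying sets of modules, closed under tensor products and containing the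
  ground field. Since \<open>'a\<close> is arbitrary, every module is isomorphic (via \<open>Atom\<close>) to one
  whose carrier lies in such a universe.\<close>

datatype 'a univ =
    Atom 'a
  | Scal (scal_of: complex)
  | Tens (tens_of: "('a univ \<times> 'a univ) list")

type_synonym ('h, 'a) umod = "('h, 'a univ) hmod"

text \<open>An arrow carries its source and target; the map is \<open>undefined\<close> outside the carrier of the source.\<close>

datatype ('h, 'a) marrow =
  Arrow (src: "('h, 'a) umod") (map_of_arrow: "'a univ \<Rightarrow> 'a univ") (trg: "('h, 'a) umod")

definition module_maps ::
  "(complex, 'h, 'x) module_scheme \<Rightarrow> ('h, 'v) hmod \<Rightarrow> ('h, 'v) hmod \<Rightarrow> ('v \<Rightarrow> 'v) set" where
  "module_maps H X Y =
     {f \<in> carrier X \<rightarrow>\<^sub>E carrier Y.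
        (\<forall>v\<in>carrier X. \<forall>w\<in>carrier X. f (v \<oplus>\<^bsub>X\<^esub> w) = f v \<oplus>\<^bsub>Y\<^esub> f w) \<and>
        (\<forall>c. \<forall>v\<in>carrier X. f (c \<odot>\<^bsub>X\<^esub> v) = c \<odot>\<^bsub>Y\<^esub> f v) \<and>
        (\<forall>h\<in>carrier H. \<forall>v\<in>carrier X. f (act X h v) = act Y h (f v))}"

definition usum ::
  "('h, 'a) umod \<Rightarrow> ('h, 'a) umod \<Rightarrow> ('a univ \<times> 'a univ) list \<Rightarrow> 'a univ" where
  "usum X Y l = Tens (tsum X Y l)"

abbreviation pure :: "('h, 'a) umod \<Rightarrow> ('h, 'a) umod \<Rightarrow> 'a univ \<Rightarrow> 'a univ \<Rightarrow> 'a univ" where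
  "pure X Y v w \<equiv> usum X Y [(v, w)]"

definition unit_mod :: "('h, 'x) quasi_hopf_scheme \<Rightarrow> ('h, 'a) umod" where
  "unit_mod H =
    \<lparr>carrier = range Scal, mult = undefined, one = undefined, zero = Scal 0,
     add = (\<lambda>x y. Scal (scal_of x + scal_of y)), smult = (\<lambda>c x. Scal (c * scal_of x)),
     act = (\<lambda>h x. Scal (counit H h * scal_of x))\<rparr>"

definition tens_mod ::
  "('h, 'x) quasi_hopf_scheme \<Rightarrow> ('h, 'a) umod \<Rightarrow> ('h, 'a) umod \<Rightarrow> ('h, 'a) umod" where
  "tens_mod H X Y =
    \<lparr>carrier = Tens ` carrier (tens X Y), mult = undefined, one = undefined,
     zero = Tens \<zero>\<^bsub>tens X Y\<^esub>,
     add = (\<lambda>s t. Tens (tens_of s \<oplus>\<^bsub>tens X Y\<^esub> tens_of t)),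
     smult = (\<lambda>c t. Tens (c \<odot>\<^bsub>tens X Y\<^esub> tens_of t)),
     act = (\<lambda>h t. usum X Y
              [(act X a v, act Y b w). (a, b) \<leftarrow> comul H h, (v, w) \<leftarrow> tens_of t])\<rparr>"

definition tens_arrow ::
  "('h, 'x) quasi_hopf_scheme \<Rightarrow> ('h, 'a) marrow \<Rightarrow> ('h, 'a) marrow \<Rightarrow> ('h, 'a) marrow" where
  "tens_arrow H f g =
     Arrow (tens_mod H (src f) (src g))
       (\<lambda>t\<in>carrier (tens_mod H (src f) (src g)).
          usum (trg f) (trg g) [(map_of_arrow f v, map_of_arrow g w). (v, w) \<leftarrow> tens_of t])
       (tens_mod H (trg f) (trg g))"

definition assoc_arrow ::
  "('h, 'x) quasi_hopf_scheme \<Rightarrow> ('h, 'a) umod \<Rightarrow> ('h, 'a) umod \<Rightarrow> ('h, 'a) umod \<Rightarrow>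
    ('h, 'a) marrow" where
  "assoc_arrow H X Y Z =
     Arrow (tens_mod H (tens_mod H X Y) Z)
       (\<lambda>t\<in>carrier (tens_mod H (tens_mod H X Y) Z).
          usum X (tens_mod H Y Z)
            [(act X a u, pure Y Z (act Y b v) (act Z c w)).
               (a, b, c) \<leftarrow> triples (reassoc H), (s, w) \<leftarrow> tens_of t, (u, v) \<leftarrow> tens_of s])
       (tens_mod H X (tens_mod H Y Z))"

text \<open>The conjugate module has the same underlying abelian group, so a vector \<open>v\<close> and its
  conjugate are the same element of the universe.\<close>

definition bar_mod :: "('h, 'x) star_quasi_hopf_scheme \<Rightarrow> ('h, 'a) umod \<Rightarrow> ('h, 'a) umod" where
  "bar_mod H X = X\<lparr>smult := (\<lambda>c. smult X (cnj c)), act := (\<lambda>h. act X (starT H h))\<rparr>"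

definition HMod ::
  "('h, 'x) star_quasi_hopf_scheme \<Rightarrow> (('h, 'a) umod, ('h, 'a) marrow) bar_cat" where
  "HMod H =
    \<lparr>Ob = {X. left_module H X},
     Hom = (\<lambda>X Y. {Arrow X f Y | f. f \<in> module_maps H X Y}),
     Idn = (\<lambda>X. Arrow X (\<lambda>v\<in>carrier X. v) X),
     Comp = (\<lambda>g f. Arrow (src f)
               (compose (carrier (src f)) (map_of_arrow g) (map_of_arrow f)) (trg g)),
     TensO = tens_mod H,
     TensM = tens_arrow H,
     Unit = unit_mod H,
     Assoc = assoc_arrow H,
     LUnit = (\<lambda>X. Arrow X (\<lambda>v\<in>carrier X. pure X (unit_mod H) v (Scal 1))
               (tens_mod H X (unit_mod H))),
     RUnit = (\<lambda>X. Arrow X (\<lambda>v\<in>carrier X. pure (unit_mod H) X (Scal 1) v)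
               (tens_mod H (unit_mod H) X)),
     BarO = bar_mod H,
     BarM = (\<lambda>f. Arrow (bar_mod H (src f)) (map_of_arrow f) (bar_mod H (trg f))),
     BB = (\<lambda>X. Arrow X (\<lambda>x\<in>carrier X. act X (gam H) x) (bar_mod H (bar_mod H X))),
     Star = Arrow (unit_mod H) (\<lambda>z\<in>carrier (unit_mod H :: ('h, 'a) umod). Scal (cnj (scal_of z)))
              (bar_mod H (unit_mod H)),
     Ups = (\<lambda>X Y. Arrow (bar_mod H (tens_mod H X Y))
              (\<lambda>t\<in>carrier (bar_mod H (tens_mod H X Y)).
                 usum (bar_mod H Y) (bar_mod H X)
                   [(act Y b y, act X a x). (a, b) \<leftarrow> gauge H, (x, y) \<leftarrow> tens_of t])
              (tens_mod H (bar_mod H Y) (bar_mod H X)))\<rparr>"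

end

theory Submission
  imports Defs
begin

text \<open>An identity in \<open>H\<^sup>\<otimes>\<^sup>n\<close> can be evaluated under every multilinear map on \<open>H\<^sup>n\<close>. For vectors
  \<open>x\<^sub>i\<close> of modules, \<open>(h\<^sub>1, \<dots>, h\<^sub>n) \<mapsto> h\<^sub>1 x\<^sub>1 \<otimes> \<dots> \<otimes> h\<^sub>n x\<^sub>n\<close> is such a map, and so is its variant with
  reversed and conjugated factors. A morphism from an iterated tensor product is determined by its
  values on pure tensors, where each composite of structure morphisms is a sum of such multilinear
  expressions. Hence every axiom of a bar category reduces to one axiom of \<open>H\<close>: the pentagon,
  the triangle and quasi-coassociativity to those of \<open>\<phi>\<close>, the compatibility of \<open>\<Upsilon>\<close> with the
  associator to the cocycle condition on \<open>\<G>\<close>, its equivariance to the formula for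
  \<open>\<Delta> T\<close>, and the equivariance of \<open>bb\<close> to the formula for \<open>T\<^sup>2\<close>.\<close>

section \<open>Sums over lists\<close>

text \<open>Two facts are not read off from an axiom. That \<star> is a morphism means that
  \<epsilon>(T h) is the complex conjugate of \<epsilon>(h), which has to be derived. And conjugate
  \<star> after \<star> is the identity, whereas bb at the unit object is multiplication by
  \<epsilon>(\<gamma>); so condition (c) says exactly \<epsilon>(\<gamma>) = 1. The general axioms
  leave this number open, hence the premise of the first conjunct, and strength supplies it. The
  other obstacle is the encoding. An element of a tensor product is a list chosen by
  \<open>SOME\<close>, and the structure maps are expressions in that unknown list. Each of them is
  identified with a sum of lifts of balanced maps, which makes it additive and computable on any
  representing list. Such a map is only asked to be additive in each argument and to let scalars
  pass between neighbouring arguments, because everything that involves a conjugate module is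
  conjugate-linear. Inverses of structure maps are given as plain functions; a set-theoretic inverse
  of a module map is a module map.\<close>

context abelian_monoid
begin

lemma lsum_Nil [simp]: "lsum G [] = \<zero>"
  and lsum_Cons [simp]: "lsum G (x # xs) = x \<oplus> lsum G xs"
  by (simp_all add: lsum_def)

lemma lsum_closed: "set l \<subseteq> carrier G \<Longrightarrow> lsum G l \<in> carrier G"
  by (induction l) auto

lemma lsum_map_closed: "(\<And>x. x \<in> set l \<Longrightarrow> f x \<in> carrier G) \<Longrightarrow> lsum G (map f l) \<in> carrier G"
  by (rule lsum_closed) auto

lemma lsum_append:
  "set l \<subseteq> carrier G \<Longrightarrow> set m \<subseteq> carrier G \<Longrightarrow> lsum G (l @ m) = lsum G l \<oplus> lsum G m"
  by (induction l) (auto simp: lsum_closed a_assoc)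

lemma lsum_concat:
  "(\<And>x y. x \<in> set l \<Longrightarrow> y \<in> set (g x) \<Longrightarrow> y \<in> carrier G)
    \<Longrightarrow> lsum G (concat (map g l)) = lsum G (map (\<lambda>x. lsum G (g x)) l)"
proof (induction l)
  case (Cons x l)
  have "set (g x) \<subseteq> carrier G" "set (concat (map g l)) \<subseteq> carrier G"
    using Cons.prems by auto
  moreover have "lsum G (concat (map g l)) = lsum G (map (\<lambda>x. lsum G (g x)) l)"
    using Cons.prems by (intro Cons.IH) auto
  ultimately show ?case
    by (simp add: lsum_append)
qed simp

lemma lsum_cong: "(\<And>x. x \<in> set l \<Longrightarrow> f x = g x) \<Longrightarrow> lsum G (map f l) = lsum G (map g l)"
  by (metis map_cong)

lemma lsum_zero [simp]: "lsum G (map (\<lambda>x. \<zero>) l) = \<zero>"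
  by (induction l) auto

lemma lsum_add:
  "(\<And>x. x \<in> set l \<Longrightarrow> f x \<in> carrier G) \<Longrightarrow> (\<And>x. x \<in> set l \<Longrightarrow> g x \<in> carrier G) \<Longrightarrow>
    lsum G (map (\<lambda>x. f x \<oplus> g x) l) = lsum G (map f l) \<oplus> lsum G (map g l)"
proof (induction l)
  case (Cons x l)
  then show ?case
    using lsum_map_closed[of l f] lsum_map_closed[of l g] by (simp add: a_ac)
qed simp

lemma lsum_swap:
  "(\<And>x y. x \<in> set l \<Longrightarrow> y \<in> set m \<Longrightarrow> f x y \<in> carrier G) \<Longrightarrow>
    lsum G (map (\<lambda>x. lsum G (map (f x) m)) l) = lsum G (map (\<lambda>y. lsum G (map (\<lambda>x. f x y) l)) m)"
proof (induction l)
  case (Cons x l)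
  then show ?case
    by (simp add: lsum_add lsum_map_closed)
qed simp

text \<open>The inner range may depend on the outer index, as in a comprehension that splits one leg
  of a coproduct again.\<close>

lemma lsum_concat2:
  "(\<And>x y. x \<in> set l \<Longrightarrow> y \<in> set (m x) \<Longrightarrow> f x y \<in> carrier G) \<Longrightarrow>
    lsum G (concat (map (\<lambda>x. map (f x) (m x)) l)) = lsum G (map (\<lambda>x. lsum G (map (f x) (m x))) l)"
  by (rule lsum_concat) auto

lemma lsum_concat3:
  "(\<And>x y z. x \<in> set l \<Longrightarrow> y \<in> set (m x) \<Longrightarrow> z \<in> set (n x y) \<Longrightarrow> f x y z \<in> carrier G) \<Longrightarrow>
    lsum G (concat (map (\<lambda>x. concat (map (\<lambda>y. map (f x y) (n x y)) (m x))) l)) =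
    lsum G (map (\<lambda>x. lsum G (map (\<lambda>y. lsum G (map (f x y) (n x y))) (m x))) l)"
  by (subst lsum_concat) (auto intro!: lsum_cong lsum_concat2)

text \<open>Three adjacent exchanges reverse the order: the inner pair, the outer pair, the inner
  pair. The coboundary needs this, since its composite produces the three sums in the order opposite
  to that of the closed formula.\<close>

lemma lsum_reverse3:
  assumes "\<And>x y z. x \<in> set l \<Longrightarrow> y \<in> set m \<Longrightarrow> z \<in> set n \<Longrightarrow> f x y z \<in> carrier G"
  shows "lsum G (map (\<lambda>x. lsum G (map (\<lambda>y. lsum G (map (\<lambda>z. f x y z) n)) m)) l) =
    lsum G (map (\<lambda>z. lsum G (map (\<lambda>y. lsum G (map (\<lambda>x. f x y z) l)) m)) n)"
proof -
  have "lsum G (map (\<lambda>x. lsum G (map (\<lambda>y. lsum G (map (\<lambda>z. f x y z) n)) m)) l) =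
      lsum G (map (\<lambda>x. lsum G (map (\<lambda>z. lsum G (map (\<lambda>y. f x y z) m)) n)) l)"
    by (intro lsum_cong lsum_swap assms)
  also have "\<dots> = lsum G (map (\<lambda>z. lsum G (map (\<lambda>x. lsum G (map (\<lambda>y. f x y z) m)) l)) n)"
    by (intro lsum_swap lsum_map_closed assms)
  also have "\<dots> = lsum G (map (\<lambda>z. lsum G (map (\<lambda>y. lsum G (map (\<lambda>x. f x y z) l)) m)) n)"
    by (intro lsum_cong lsum_swap assms)
  finally show ?thesis .
qed

end

lemma set_concat2_subset:
  "(\<And>x y. x \<in> set l \<Longrightarrow> y \<in> set (m x) \<Longrightarrow> f x y \<in> S) \<Longrightarrow>
    set (concat (map (\<lambda>x. map (f x) (m x)) l)) \<subseteq> S"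
  by auto

lemma set_concat3_subset:
  "(\<And>x y z. x \<in> set l \<Longrightarrow> y \<in> set (m x) \<Longrightarrow> z \<in> set (n x y) \<Longrightarrow> f x y z \<in> S) \<Longrightarrow>
    set (concat (map (\<lambda>x. concat (map (\<lambda>y. map (f x y) (n x y)) (m x))) l)) \<subseteq> S"
  by auto

text \<open>Evaluation of a map on a formal sum. Projections replace pair patterns here and below;
  comprehensions over pairs are brought to this shape by \<open>split_def\<close>.\<close>

abbreviation lsum2 :: "('u, 'z) ring_scheme \<Rightarrow> ('a \<Rightarrow> 'b \<Rightarrow> 'u) \<Rightarrow> ('a \<times> 'b) list \<Rightarrow> 'u" where
  "lsum2 U F l \<equiv> lsum U (map (\<lambda>x. F (fst x) (snd x)) l)"

abbreviation lsum3 :: "('u, 'z) ring_scheme \<Rightarrow> ('a \<Rightarrow> 'b \<Rightarrow> 'c \<Rightarrow> 'u) \<Rightarrow> ('a \<times> 'b \<times> 'c) list \<Rightarrow> 'u" where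
  "lsum3 U F l \<equiv> lsum U (map (\<lambda>x. F (fst x) (fst (snd x)) (snd (snd x))) l)"

text \<open>Pure tensors absorb scalars, so they generate a tensor product already as an abelian
  group. Additivity alone therefore suffices to compare maps, and it treats linear and
  conjugate-linear maps alike.\<close>

definition add_map :: "('a, 'x) ring_scheme \<Rightarrow> ('b, 'y) ring_scheme \<Rightarrow> ('a \<Rightarrow> 'b) \<Rightarrow> bool" where
  "add_map M N f \<longleftrightarrow>
     (\<forall>x\<in>carrier M. f x \<in> carrier N) \<and>
     (\<forall>x\<in>carrier M. \<forall>y\<in>carrier M. f (x \<oplus>\<^bsub>M\<^esub> y) = f x \<oplus>\<^bsub>N\<^esub> f y)"

lemma add_map_zero:
  assumes "abelian_monoid M" "abelian_group N" "add_map M N f"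
  shows "f \<zero>\<^bsub>M\<^esub> = \<zero>\<^bsub>N\<^esub>"
proof -
  interpret M: abelian_monoid M by fact
  interpret N: abelian_group N by fact
  have "f \<zero>\<^bsub>M\<^esub> \<in> carrier N"
    using assms(3) M.zero_closed by (auto simp: add_map_def)
  moreover have "f (\<zero>\<^bsub>M\<^esub> \<oplus>\<^bsub>M\<^esub> \<zero>\<^bsub>M\<^esub>) = f \<zero>\<^bsub>M\<^esub> \<oplus>\<^bsub>N\<^esub> f \<zero>\<^bsub>M\<^esub>"
    using assms(3) M.zero_closed unfolding add_map_def by blast
  ultimately show ?thesis
    by simp
qed

lemma add_map_lsum:
  assumes "abelian_monoid M" "abelian_group N" "add_map M N f"
    and "\<And>x. x \<in> set l \<Longrightarrow> g x \<in> carrier M"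
  shows "f (lsum M (map g l)) = lsum N (map (\<lambda>x. f (g x)) l)"
proof -
  interpret M: abelian_monoid M by fact
  interpret N: abelian_group N by fact
  show ?thesis
    using assms(4)
  proof (induction l)
    case Nil
    show ?case by (simp add: add_map_zero[OF assms(1-3)])
  next
    case (Cons x l)
    then have "lsum M (map g l) \<in> carrier M" "g x \<in> carrier M"
      by (auto intro!: M.lsum_map_closed)
    then show ?case
      using Cons assms(3) by (simp add: add_map_def)
  qed
qed

section \<open>Tensor products of vector spaces\<close>

abbreviation vector_space_over :: "(complex, 'a, 'x) module_scheme \<Rightarrow> bool" where
  "vector_space_over V \<equiv> module complex_field V"

lemma complex_field_simps [simp]:
  "carrier complex_field = UNIV" "mult complex_field = (*)" "one complex_field = 1"
  "zero complex_field = 0" "add complex_field = (+)"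
  by (simp_all add: complex_field_def)

lemma lsum_complex_field: "lsum complex_field l = sum_list l"
  by (induction l) (simp_all add: lsum_def)

lemma cring_complex_field: "cring complex_field"
  by (rule cringI)
    (auto simp: algebra_simps intro!: abelian_groupI comm_monoidI exI[of _ "- (x::complex)" for x])

lemma vector_space_abelian_group [simp]:
  "vector_space_over V \<Longrightarrow> abelian_group V" "vector_space_over V \<Longrightarrow> abelian_monoid V"
  by (auto simp: module_def abelian_group_def)

text \<open>Homogeneity is not required: a map that is conjugate-linear in both arguments is balanced.\<close>

definition balanced ::
  "(complex, 'a, 'x) module_scheme \<Rightarrow> (complex, 'b, 'y) module_scheme \<Rightarrow> ('u, 'z) ring_scheme \<Rightarrow>
    ('a \<Rightarrow> 'b \<Rightarrow> 'u) \<Rightarrow> bool" where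
  "balanced V W U f \<longleftrightarrow>
     (\<forall>v\<in>carrier V. add_map W U (f v)) \<and> (\<forall>w\<in>carrier W. add_map V U (\<lambda>v. f v w)) \<and>
     (\<forall>c. \<forall>v\<in>carrier V. \<forall>w\<in>carrier W. f (c \<odot>\<^bsub>V\<^esub> v) w = f v (c \<odot>\<^bsub>W\<^esub> w))"

lemma balancedI:
  assumes "\<And>v w. v \<in> carrier V \<Longrightarrow> w \<in> carrier W \<Longrightarrow> f v w \<in> carrier U"
    and "\<And>v v' w. v \<in> carrier V \<Longrightarrow> v' \<in> carrier V \<Longrightarrow> w \<in> carrier W \<Longrightarrow>
      f (v \<oplus>\<^bsub>V\<^esub> v') w = f v w \<oplus>\<^bsub>U\<^esub> f v' w"
    and "\<And>v w w'. v \<in> carrier V \<Longrightarrow> w \<in> carrier W \<Longrightarrow> w' \<in> carrier W \<Longrightarrow>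
      f v (w \<oplus>\<^bsub>W\<^esub> w') = f v w \<oplus>\<^bsub>U\<^esub> f v w'"
    and "\<And>c v w. v \<in> carrier V \<Longrightarrow> w \<in> carrier W \<Longrightarrow> f (c \<odot>\<^bsub>V\<^esub> v) w = f v (c \<odot>\<^bsub>W\<^esub> w)"
  shows "balanced V W U f"
  using assms by (auto simp: balanced_def add_map_def)

lemma balancedD:
  assumes "balanced V W U f"
  shows "v \<in> carrier V \<Longrightarrow> w \<in> carrier W \<Longrightarrow> f v w \<in> carrier U"
    and "v \<in> carrier V \<Longrightarrow> v' \<in> carrier V \<Longrightarrow> w \<in> carrier W \<Longrightarrow>
      f (v \<oplus>\<^bsub>V\<^esub> v') w = f v w \<oplus>\<^bsub>U\<^esub> f v' w"
    and "v \<in> carrier V \<Longrightarrow> w \<in> carrier W \<Longrightarrow> w' \<in> carrier W \<Longrightarrow>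
      f v (w \<oplus>\<^bsub>W\<^esub> w') = f v w \<oplus>\<^bsub>U\<^esub> f v w'"
    and "v \<in> carrier V \<Longrightarrow> w \<in> carrier W \<Longrightarrow> f (c \<odot>\<^bsub>V\<^esub> v) w = f v (c \<odot>\<^bsub>W\<^esub> w)"
  using assms by (auto simp: balanced_def add_map_def)

section \<open>The congruence on formal sums and its canonical representatives\<close>

lemma tensor_eq_wf:
  assumes "vector_space_over V" "vector_space_over W" "tensor_eq V W l m"
  shows "set l \<subseteq> carrier V \<times> carrier W" "set m \<subseteq> carrier V \<times> carrier W"
proof -
  interpret V: module complex_field V by fact
  interpret W: module complex_field W by fact
  have "set l \<subseteq> carrier V \<times> carrier W \<and> set m \<subseteq> carrier V \<times> carrier W"
    using assms(3) by (induction) auto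
  then show "set l \<subseteq> carrier V \<times> carrier W" "set m \<subseteq> carrier V \<times> carrier W"
    by auto
qed

text \<open>The universal property of the tensor product at the level of lists: a balanced map
  respects every generating rule of the congruence. The rule \<open>null\<close> is where
  \<open>U\<close> must be a group: additivity only shows that the value at zero equals its own
  double, and cancellation makes it vanish.\<close>

lemma tensor_eq_lsum:
  assumes V: "vector_space_over V" and W: "vector_space_over W" and U: "abelian_group U"
    and f: "balanced V W U f" and eq: "tensor_eq V W l m"
  shows "lsum2 U f l = lsum2 U f m"
proof -
  interpret V: module complex_field V by fact
  interpret W: module complex_field W by fact
  interpret U: abelian_group U by fact
  have cl: "set (map (\<lambda>x. f (fst x) (snd x)) l) \<subseteq> carrier U"
    if "set l \<subseteq> carrier V \<times> carrier W" for l
    using that balancedD(1)[OF f] by auto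
  show ?thesis
    using eq
  proof induction
    case (append l l' m m')
    then show ?case
      using tensor_eq_wf[OF V W append(1)] tensor_eq_wf[OF V W append(2)] cl
      by (simp add: U.lsum_append)
  next
    case (comm l m)
    then show ?case
      using cl by (simp add: U.lsum_append U.lsum_closed U.a_comm)
  next
    case (null w)
    then show ?case
      using add_map_zero[of V U "\<lambda>v. f v w"] f U by (auto simp: balanced_def V.abelian_monoid_axioms)
  qed (auto simp: balancedD[OF f])
qed

lemma tsum_eq: "set l \<subseteq> carrier V \<times> carrier W \<Longrightarrow> tensor_eq V W l (tsum V W l)"
  unfolding tsum_def by (rule someI) (rule tensor_eq.refl)

text \<open>Congruent lists are congruent to the same lists, so \<open>SOME\<close> is applied to
  one and the same predicate and makes the same choice.\<close>

lemma tsum_cong: "tensor_eq V W l m \<Longrightarrow> tsum V W l = tsum V W m"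
proof -
  assume "tensor_eq V W l m"
  then have "tensor_eq V W l = tensor_eq V W m"
    by (intro ext iffI) (rule tensor_eq.trans, erule tensor_eq.sym, assumption, rule tensor_eq.trans)
  then show ?thesis
    by (simp add: tsum_def)
qed

lemma tsum_tsum [simp]:
  "set l \<subseteq> carrier V \<times> carrier W \<Longrightarrow> tsum V W (tsum V W l) = tsum V W l"
  by (rule tsum_cong[symmetric]) (rule tsum_eq)

lemma tens_simps [simp]:
  "\<zero>\<^bsub>tens V W\<^esub> = tsum V W []"
  "s \<oplus>\<^bsub>tens V W\<^esub> t = tsum V W (s @ t)"
  "\<one>\<^bsub>tens V W\<^esub> = tsum V W [(\<one>\<^bsub>V\<^esub>, \<one>\<^bsub>W\<^esub>)]"
  by (simp_all add: tens_def)

section \<open>The vector space structure of a tensor product\<close>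

locale two_vector_spaces = V: module complex_field V + W: module complex_field W
  for V :: "(complex, 'a, 'x) module_scheme" and W :: "(complex, 'b, 'y) module_scheme"
begin

abbreviation "wfl l \<equiv> set l \<subseteq> carrier V \<times> carrier W"

lemmas vs = V.module_axioms W.module_axioms
lemmas eq_wf = tensor_eq_wf[OF vs]

lemma tsum_wf: "wfl l \<Longrightarrow> wfl (tsum V W l)"
  using eq_wf tsum_eq by blast

lemma tsum_carrier [simp]: "wfl l \<Longrightarrow> tsum V W l \<in> carrier (tens V W)"
  by (auto simp: tens_def)

lemma carrier_tensE:
  assumes "t \<in> carrier (tens V W)"
  obtains l where "wfl l" "t = tsum V W l"
  using assms by (auto simp: tens_def)

lemma carrier_wf: "t \<in> carrier (tens V W) \<Longrightarrow> wfl t"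
  using carrier_tensE tsum_wf by metis

lemma tsum_id [simp]: "t \<in> carrier (tens V W) \<Longrightarrow> tsum V W t = t"
  by (metis carrier_tensE tsum_tsum)

lemma tens_add: "wfl l \<Longrightarrow> wfl m \<Longrightarrow> tsum V W l \<oplus>\<^bsub>tens V W\<^esub> tsum V W m = tsum V W (l @ m)"
  unfolding tens_simps by (rule tsum_cong[symmetric], rule tensor_eq.append) (simp_all add: tsum_eq)

text \<open>Scalars act through the first factor. The rule \<open>bal\<close> is the case with
  content: two scalars meet on the same vector and must commute.\<close>

lemma tensor_eq_smult:
  assumes "tensor_eq V W l m"
  shows "tensor_eq V W (map (\<lambda>(v, w). (c \<odot>\<^bsub>V\<^esub> v, w)) l) (map (\<lambda>(v, w). (c \<odot>\<^bsub>V\<^esub> v, w)) m)"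
  using assms
proof induction
  case (refl l)
  then show ?case by (intro tensor_eq.refl) auto
next
  case (comm l m)
  then show ?case by (simp, intro tensor_eq.comm) auto
next
  case (null w)
  then show ?case by (simp add: tensor_eq.null)
next
  case (addl v v' w)
  then show ?case by (simp add: V.smult_r_distr tensor_eq.addl)
next
  case (bal v w d)
  have "c \<odot>\<^bsub>V\<^esub> (d \<odot>\<^bsub>V\<^esub> v) = (c * d) \<odot>\<^bsub>V\<^esub> v"
    using bal V.smult_assoc1[of c d v] by simp
  also have "\<dots> = d \<odot>\<^bsub>V\<^esub> (c \<odot>\<^bsub>V\<^esub> v)"
    using bal V.smult_assoc1[of d c v] by (simp add: mult.commute[of c])
  finally have "c \<odot>\<^bsub>V\<^esub> (d \<odot>\<^bsub>V\<^esub> v) = d \<odot>\<^bsub>V\<^esub> (c \<odot>\<^bsub>V\<^esub> v)" .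
  then show ?case using bal by (simp add: tensor_eq.bal)
next
  case (trans l m n)
  from trans.IH show ?case by (rule tensor_eq.trans)
next
  case (append l l' m m')
  from tensor_eq.append[OF append.IH] show ?case by simp
next
  case (sym l m)
  from sym.IH show ?case by (rule tensor_eq.sym)
qed (simp_all add: tensor_eq.addr)

lemma tens_smult:
  "wfl l \<Longrightarrow> c \<odot>\<^bsub>tens V W\<^esub> tsum V W l = tsum V W (map (\<lambda>(v, w). (c \<odot>\<^bsub>V\<^esub> v, w)) l)"
  unfolding tens_def by (simp only: module.select_convs) (rule tsum_cong[OF tensor_eq_smult[OF tsum_eq], symmetric])

text \<open>The additive inverse of a formal sum is obtained by scaling its first components by -1.
  In the induction the new term and its negative are not adjacent, so a reordering precedes the
  cancellation.\<close>

lemma tsum_minus: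
  assumes "wfl l"
  shows "tensor_eq V W (map (\<lambda>(v, w). ((- 1) \<odot>\<^bsub>V\<^esub> v, w)) l @ l) []"
  using assms
proof (induction l)
  case (Cons x l)
  obtain v w where x: "x = (v, w)" by fastforce
  let ?m = "map (\<lambda>(v, w). ((- 1) \<odot>\<^bsub>V\<^esub> v, w)) l"
  have vw: "v \<in> carrier V" "w \<in> carrier W" "wfl l" "wfl ?m"
    using Cons.prems x by auto
  have v0: "(- 1) \<odot>\<^bsub>V\<^esub> v \<oplus>\<^bsub>V\<^esub> v = \<zero>\<^bsub>V\<^esub>"
    using V.smult_l_distr[of "- 1" 1 v] V.smult_one[of v] V.smult_l_null[of v] vw by simp
  \<comment> \<open>The new term moves to the left past the negatives of the old terms, until it
    stands next to its own negative.\<close>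
  have "tensor_eq V W ([((- 1) \<odot>\<^bsub>V\<^esub> v, w)] @ (?m @ [x]) @ l) ([((- 1) \<odot>\<^bsub>V\<^esub> v, w)] @ ([x] @ ?m) @ l)"
  proof (rule tensor_eq.append[OF tensor_eq.refl tensor_eq.append[OF tensor_eq.comm tensor_eq.refl]])
  qed (use vw x in auto)
  moreover have "tensor_eq V W [((- 1) \<odot>\<^bsub>V\<^esub> v, w), (v, w)] [(\<zero>\<^bsub>V\<^esub>, w)]"
    using tensor_eq.sym[OF tensor_eq.addl[of "(- 1) \<odot>\<^bsub>V\<^esub> v" V v w W]] vw v0 by simp
  then have "tensor_eq V W ([((- 1) \<odot>\<^bsub>V\<^esub> v, w), (v, w)] @ ?m @ l) ([] @ [])"
    by (rule tensor_eq.append[OF tensor_eq.trans[OF _ tensor_eq.null[OF vw(2)]] Cons.IH[OF vw(3)]])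
  ultimately have "tensor_eq V W ([((- 1) \<odot>\<^bsub>V\<^esub> v, w)] @ (?m @ [x]) @ l) ([] @ [])"
    unfolding x append.simps append_assoc by (rule tensor_eq.trans)
  then show ?case
    by (simp add: x)
qed (simp add: tensor_eq.refl)

lemma abelian_group_tens: "abelian_group (tens V W)"
proof (rule abelian_groupI)
  fix x y z
  assume x: "x \<in> carrier (tens V W)"
  then obtain l where l: "wfl l" "x = tsum V W l" by (rule carrier_tensE)
  show "\<zero>\<^bsub>tens V W\<^esub> \<oplus>\<^bsub>tens V W\<^esub> x = x"
    using l tens_add[of "[]" l] by simp
  show "\<exists>y\<in>carrier (tens V W). y \<oplus>\<^bsub>tens V W\<^esub> x = \<zero>\<^bsub>tens V W\<^esub>"
  proof
    let ?m = "map (\<lambda>(v, w). ((- 1) \<odot>\<^bsub>V\<^esub> v, w)) l"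
    have m: "wfl ?m" using l by auto
    then show "tsum V W ?m \<in> carrier (tens V W)" by simp
    show "tsum V W ?m \<oplus>\<^bsub>tens V W\<^esub> x = \<zero>\<^bsub>tens V W\<^esub>"
      using tens_add[OF m l(1)] tsum_cong[OF tsum_minus[OF l(1)]] l by simp
  qed
  assume y: "y \<in> carrier (tens V W)"
  then obtain m where m: "wfl m" "y = tsum V W m" by (rule carrier_tensE)
  show "x \<oplus>\<^bsub>tens V W\<^esub> y \<in> carrier (tens V W)"
    using l m by (simp add: tens_add del: tens_simps)
  show "x \<oplus>\<^bsub>tens V W\<^esub> y = y \<oplus>\<^bsub>tens V W\<^esub> x"
    using l m by (simp add: tens_add tsum_cong[OF tensor_eq.comm] del: tens_simps)
  assume z: "z \<in> carrier (tens V W)"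
  then obtain n where n: "wfl n" "z = tsum V W n" by (rule carrier_tensE)
  show "x \<oplus>\<^bsub>tens V W\<^esub> y \<oplus>\<^bsub>tens V W\<^esub> z = x \<oplus>\<^bsub>tens V W\<^esub> (y \<oplus>\<^bsub>tens V W\<^esub> z)"
    using l m n by (simp add: tens_add del: tens_simps)
qed simp

sublocale T: abelian_group "tens V W"
  by (rule abelian_group_tens)

text \<open>Turns a formal sum into an actual sum in the group \<open>tens V W\<close>, to which
  additive maps and the laws for sums apply.\<close>

lemma tsum_lsum:
  "wfl l \<Longrightarrow> tsum V W l = lsum (tens V W) (map (\<lambda>x. tsum V W [(fst x, snd x)]) l)"
proof (induction l)
  case (Cons x l)
  then show ?case
    using tens_add[of "[x]" l] by (simp del: tens_simps)
qed simp

lemma pure_add_left: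
  "v \<in> carrier V \<Longrightarrow> v' \<in> carrier V \<Longrightarrow> w \<in> carrier W \<Longrightarrow>
    tsum V W [(v \<oplus>\<^bsub>V\<^esub> v', w)] = tsum V W [(v, w)] \<oplus>\<^bsub>tens V W\<^esub> tsum V W [(v', w)]"
  using tens_add[of "[(v, w)]" "[(v', w)]"] tsum_cong[OF tensor_eq.addl] by (simp del: tens_simps)

lemma pure_add_right:
  "v \<in> carrier V \<Longrightarrow> w \<in> carrier W \<Longrightarrow> w' \<in> carrier W \<Longrightarrow>
    tsum V W [(v, w \<oplus>\<^bsub>W\<^esub> w')] = tsum V W [(v, w)] \<oplus>\<^bsub>tens V W\<^esub> tsum V W [(v, w')]"
  using tens_add[of "[(v, w)]" "[(v, w')]"] tsum_cong[OF tensor_eq.addr] by (simp del: tens_simps)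

lemma pure_smult_left:
  "v \<in> carrier V \<Longrightarrow> w \<in> carrier W \<Longrightarrow>
    tsum V W [(c \<odot>\<^bsub>V\<^esub> v, w)] = c \<odot>\<^bsub>tens V W\<^esub> tsum V W [(v, w)]"
  using tens_smult[of "[(v, w)]" c] by simp

lemma pure_smult_right:
  "v \<in> carrier V \<Longrightarrow> w \<in> carrier W \<Longrightarrow>
    tsum V W [(v, c \<odot>\<^bsub>W\<^esub> w)] = c \<odot>\<^bsub>tens V W\<^esub> tsum V W [(v, w)]"
  using pure_smult_left[of v w c] tsum_cong[OF tensor_eq.bal, of v V w W c] by simp

lemma module_tens: "module complex_field (tens V W)"
proof (rule moduleI[OF cring_complex_field abelian_group_tens])
  fix a b x y
  assume "x \<in> carrier (tens V W)"
  then obtain l where l: "wfl l" "x = tsum V W l" by (rule carrier_tensE)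
  have wfl: "wfl (map (\<lambda>(v, w). (c \<odot>\<^bsub>V\<^esub> v, w)) l)" for c using l by auto
  show "a \<odot>\<^bsub>tens V W\<^esub> x \<in> carrier (tens V W)"
    using l wfl by (simp add: tens_smult)
  show "\<one>\<^bsub>complex_field\<^esub> \<odot>\<^bsub>tens V W\<^esub> x = x"
  proof -
    have "map (\<lambda>(v, w). (1 \<odot>\<^bsub>V\<^esub> v, w)) l = l"
      using l(1) V.smult_one by (intro map_idI) auto
    then show ?thesis using l by (simp add: tens_smult)
  qed
  show "(a \<otimes>\<^bsub>complex_field\<^esub> b) \<odot>\<^bsub>tens V W\<^esub> x = a \<odot>\<^bsub>tens V W\<^esub> (b \<odot>\<^bsub>tens V W\<^esub> x)"
  proof -
    have "map (\<lambda>(v, w). ((a * b) \<odot>\<^bsub>V\<^esub> v, w)) l =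
        map (\<lambda>(v, w). (a \<odot>\<^bsub>V\<^esub> v, w)) (map (\<lambda>(v, w). (b \<odot>\<^bsub>V\<^esub> v, w)) l)"
      using l(1) V.smult_assoc1[of a b] by auto
    then show ?thesis using l wfl[of b] by (simp add: tens_smult del: map_map)
  qed
  show "(a \<oplus>\<^bsub>complex_field\<^esub> b) \<odot>\<^bsub>tens V W\<^esub> x = a \<odot>\<^bsub>tens V W\<^esub> x \<oplus>\<^bsub>tens V W\<^esub> b \<odot>\<^bsub>tens V W\<^esub> x"
  proof -
    \<comment> \<open>The list for the scalar a + b is not a concatenation of the lists for a and b.
      Written as sums in the group, the two parts are separated term by term.\<close>
    have "tsum V W (map (\<lambda>(v, w). ((a + b) \<odot>\<^bsub>V\<^esub> v, w)) l) =
        lsum (tens V W) (map (\<lambda>x. tsum V W [((a + b) \<odot>\<^bsub>V\<^esub> fst x, snd x)]) l)"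
      by (subst tsum_lsum[OF wfl]) (simp add: comp_def split_def)
    also have "\<dots> = lsum (tens V W) (map (\<lambda>x. tsum V W [(a \<odot>\<^bsub>V\<^esub> fst x, snd x)] \<oplus>\<^bsub>tens V W\<^esub>
        tsum V W [(b \<odot>\<^bsub>V\<^esub> fst x, snd x)]) l)"
      using l V.smult_l_distr[of a b]
      by (intro T.lsum_cong) (auto simp: pure_add_left simp del: tens_simps)
    also have "\<dots> = lsum (tens V W) (map (\<lambda>x. tsum V W [(a \<odot>\<^bsub>V\<^esub> fst x, snd x)]) l) \<oplus>\<^bsub>tens V W\<^esub>
        lsum (tens V W) (map (\<lambda>x. tsum V W [(b \<odot>\<^bsub>V\<^esub> fst x, snd x)]) l)"
      using l by (intro T.lsum_add) auto
    also have "\<dots> = tsum V W (map (\<lambda>(v, w). (a \<odot>\<^bsub>V\<^esub> v, w)) l) \<oplus>\<^bsub>tens V W\<^esub>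
        tsum V W (map (\<lambda>(v, w). (b \<odot>\<^bsub>V\<^esub> v, w)) l)"
      by (simp add: tsum_lsum[OF wfl[unfolded split_def]] comp_def split_def del: tens_simps)
    finally show ?thesis using l by (simp add: tens_smult del: tens_simps)
  qed
  assume "y \<in> carrier (tens V W)"
  then obtain m where m: "wfl m" "y = tsum V W m" by (rule carrier_tensE)
  have wfl': "wfl (map (\<lambda>(v, w). (c \<odot>\<^bsub>V\<^esub> v, w)) m)" for c using m by auto
  show "a \<odot>\<^bsub>tens V W\<^esub> (x \<oplus>\<^bsub>tens V W\<^esub> y) = a \<odot>\<^bsub>tens V W\<^esub> x \<oplus>\<^bsub>tens V W\<^esub> a \<odot>\<^bsub>tens V W\<^esub> y"
    using l m wfl wfl' by (simp add: tens_smult tens_add del: tens_simps)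
qed

sublocale T: module complex_field "tens V W"
  by (rule module_tens)

lemma balanced_pure: "balanced V W (tens V W) (\<lambda>v w. tsum V W [(v, w)])"
  by (rule balancedI)
    (simp_all add: pure_add_left pure_add_right pure_smult_left pure_smult_right del: tens_simps)

text \<open>\<open>tsum\<close> replaces a list by an unknown representative. Under a balanced map
  this is invisible, so every evaluation can be carried out on the list that was written
  down.\<close>

lemma lsum_tsum:
  assumes "abelian_group U" "balanced V W U f" "wfl l"
  shows "lsum2 U f (tsum V W l) = lsum2 U f l"
  by (rule tensor_eq_lsum[OF vs assms(1,2) tensor_eq.sym[OF tsum_eq[OF assms(3)]]])

lemma lsum_tens_add:
  assumes "abelian_group U" "balanced V W U f" "s \<in> carrier (tens V W)" "t \<in> carrier (tens V W)"
  shows "lsum2 U f (s \<oplus>\<^bsub>tens V W\<^esub> t) =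
    lsum2 U f s \<oplus>\<^bsub>U\<^esub> lsum2 U f t"
proof -
  interpret U: abelian_group U by fact
  show ?thesis
    using carrier_wf[OF assms(3)] carrier_wf[OF assms(4)]
    by (auto 0 4 simp: lsum_tsum[OF assms(1,2)] intro!: U.lsum_append intro: balancedD(1)[OF assms(2)])
qed

lemma add_map_lift:
  assumes "abelian_group U" "balanced V W U f"
  shows "add_map (tens V W) U (\<lambda>t. lsum2 U f t)"
proof -
  interpret U: abelian_group U by fact
  show ?thesis
    unfolding add_map_def
  proof (intro conjI ballI)
    fix t
    assume "t \<in> carrier (tens V W)"
    from carrier_wf[OF this] show "lsum2 U f t \<in> carrier U"
      by (auto 0 4 intro!: U.lsum_map_closed intro: balancedD(1)[OF assms(2)])
  qed (rule lsum_tens_add[OF assms])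
qed

text \<open>An element of the carrier is a list that represents itself, so it is the sum of the pure
  tensors formed from its own entries.\<close>

lemma tens_induct_eq:
  assumes "abelian_group U" "add_map (tens V W) U f" "add_map (tens V W) U g"
    and "\<And>v w. v \<in> carrier V \<Longrightarrow> w \<in> carrier W \<Longrightarrow> f (tsum V W [(v, w)]) = g (tsum V W [(v, w)])"
    and "t \<in> carrier (tens V W)"
  shows "f t = g t"
proof -
  have wft: "wfl t"
    by (rule carrier_wf) fact
  have t: "lsum (tens V W) (map (\<lambda>x. tsum V W [(fst x, snd x)]) t) = t"
    using tsum_lsum[OF wft] tsum_id[OF assms(5)] by simp
  have cl: "tsum V W [(fst x, snd x)] \<in> carrier (tens V W)" if "x \<in> set t" for x
    using that wft by auto
  have "f t = lsum U (map (\<lambda>x. f (tsum V W [(fst x, snd x)])) t)"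
    using add_map_lsum[OF T.abelian_monoid_axioms assms(1,2), of t "\<lambda>x. tsum V W [(fst x, snd x)]", OF cl] unfolding t by simp
  also have "\<dots> = lsum U (map (\<lambda>x. g (tsum V W [(fst x, snd x)])) t)"
    using wft assms(4) by (intro arg_cong[where f="lsum U"]) auto
  also have "\<dots> = g t"
    using add_map_lsum[OF T.abelian_monoid_axioms assms(1,3), of t "\<lambda>x. tsum V W [(fst x, snd x)]", OF cl] unfolding t by simp
  finally show ?thesis .
qed

end

declare tens_simps [simp del]

lemma add_map_lsum_pointwise:
  assumes "abelian_group U" "\<And>y. y \<in> set t \<Longrightarrow> add_map V U (f y)"
  shows "add_map V U (\<lambda>v. lsum U (map (\<lambda>y. f y v) t))"
proof -
  interpret U: abelian_group U by fact
  have cl: "f y v \<in> carrier U" if "y \<in> set t" "v \<in> carrier V" for y v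
    using assms(2) that by (auto simp: add_map_def)
  have "lsum U (map (\<lambda>y. f y (v \<oplus>\<^bsub>V\<^esub> v')) t) =
      lsum U (map (\<lambda>y. f y v) t) \<oplus>\<^bsub>U\<^esub> lsum U (map (\<lambda>y. f y v') t)"
    if "v \<in> carrier V" "v' \<in> carrier V" for v v'
  proof -
    have "lsum U (map (\<lambda>y. f y (v \<oplus>\<^bsub>V\<^esub> v')) t) = lsum U (map (\<lambda>y. f y v \<oplus>\<^bsub>U\<^esub> f y v') t)"
      using assms(2) that by (intro U.lsum_cong) (auto simp: add_map_def)
    then show ?thesis
      using that cl by (simp add: U.lsum_add)
  qed
  then show ?thesis
    using cl by (auto simp: add_map_def intro!: U.lsum_map_closed)
qed

lemma add_map_comp: "add_map L M g \<Longrightarrow> add_map M N f \<Longrightarrow> add_map L N (\<lambda>x. f (g x))"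
  by (simp add: add_map_def)

lemma balanced_lsum:
  assumes "abelian_group U" "\<And>y. y \<in> set t \<Longrightarrow> balanced V W U (f y)"
  shows "balanced V W U (\<lambda>v w. lsum U (map (\<lambda>y. f y v w) t))"
  unfolding balanced_def
proof (intro conjI ballI allI)
  fix c v w
  assume "v \<in> carrier V" "w \<in> carrier W"
  then show "lsum U (map (\<lambda>y. f y (c \<odot>\<^bsub>V\<^esub> v) w) t) = lsum U (map (\<lambda>y. f y v (c \<odot>\<^bsub>W\<^esub> w)) t)"
    using assms(2) by (intro arg_cong[where f="lsum U"] map_cong) (auto simp: balanced_def)
qed (use assms in \<open>auto simp: balanced_def intro!: add_map_lsum_pointwise\<close>)

section \<open>Tensor products of algebras\<close>

lemma tens_mult:
  "s \<otimes>\<^bsub>tens V W\<^esub> t = tsum V W [(a \<otimes>\<^bsub>V\<^esub> c, b \<otimes>\<^bsub>W\<^esub> d). (a, b) \<leftarrow> s, (c, d) \<leftarrow> t]"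
  by (simp add: tens_def)

text \<open>In \<open>complex_algebra\<close> the unqualified names of these laws refer to the field of scalars.\<close>

lemma (in complex_algebra)
  shows alg_l_distr: "\<lbrakk>x \<in> carrier H; y \<in> carrier H; z \<in> carrier H\<rbrakk> \<Longrightarrow> (x \<oplus> y) \<otimes> z = x \<otimes> z \<oplus> y \<otimes> z"
    and alg_r_distr: "\<lbrakk>x \<in> carrier H; y \<in> carrier H; z \<in> carrier H\<rbrakk> \<Longrightarrow> z \<otimes> (x \<oplus> y) = z \<otimes> x \<oplus> z \<otimes> y"
    and alg_assoc: "\<lbrakk>x \<in> carrier H; y \<in> carrier H; z \<in> carrier H\<rbrakk> \<Longrightarrow> x \<otimes> y \<otimes> z = x \<otimes> (y \<otimes> z)"
    and alg_closed: "\<lbrakk>x \<in> carrier H; y \<in> carrier H\<rbrakk> \<Longrightarrow> x \<otimes> y \<in> carrier H"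
    and alg_one: "\<one> \<in> carrier H"
    and alg_l_one: "x \<in> carrier H \<Longrightarrow> \<one> \<otimes> x = x"
    and alg_r_one: "x \<in> carrier H \<Longrightarrow> x \<otimes> \<one> = x"
proof -
  have "ring H" by unfold_locales
  note * = ringE[OF this] monoid.m_assoc[OF ringE(2)[OF this]] monoid.m_closed[OF ringE(2)[OF this]]
    monoid.one_closed[OF ringE(2)[OF this]] monoid.l_one[OF ringE(2)[OF this]]
    monoid.r_one[OF ringE(2)[OF this]]
  show "\<lbrakk>x \<in> carrier H; y \<in> carrier H; z \<in> carrier H\<rbrakk> \<Longrightarrow> (x \<oplus> y) \<otimes> z = x \<otimes> z \<oplus> y \<otimes> z"
    "\<lbrakk>x \<in> carrier H; y \<in> carrier H; z \<in> carrier H\<rbrakk> \<Longrightarrow> z \<otimes> (x \<oplus> y) = z \<otimes> x \<oplus> z \<otimes> y"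
    "\<lbrakk>x \<in> carrier H; y \<in> carrier H; z \<in> carrier H\<rbrakk> \<Longrightarrow> x \<otimes> y \<otimes> z = x \<otimes> (y \<otimes> z)"
    "\<lbrakk>x \<in> carrier H; y \<in> carrier H\<rbrakk> \<Longrightarrow> x \<otimes> y \<in> carrier H" "\<one> \<in> carrier H"
    "x \<in> carrier H \<Longrightarrow> \<one> \<otimes> x = x" "x \<in> carrier H \<Longrightarrow> x \<otimes> \<one> = x"
    by (simp_all add: *)
qed

locale two_algebras = A: complex_algebra A + B: complex_algebra B
  for A :: "(complex, 'a, 'x) module_scheme" and B :: "(complex, 'b, 'y) module_scheme"

sublocale two_algebras \<subseteq> two_vector_spaces A B
  by unfold_locales

context two_algebras
begin

lemma balanced_mult_left:
  "a \<in> carrier A \<Longrightarrow> b \<in> carrier B \<Longrightarrow>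
    balanced A B (tens A B) (\<lambda>c d. tsum A B [(a \<otimes>\<^bsub>A\<^esub> c, b \<otimes>\<^bsub>B\<^esub> d)])"
  by (rule balancedI)
    (simp_all add: A.alg_r_distr B.alg_r_distr A.smult_mult_right B.smult_mult_right
      pure_add_left pure_add_right pure_smult_left pure_smult_right)

lemma balanced_mult_right:
  "a \<in> carrier A \<Longrightarrow> b \<in> carrier B \<Longrightarrow>
    balanced A B (tens A B) (\<lambda>c d. tsum A B [(c \<otimes>\<^bsub>A\<^esub> a, d \<otimes>\<^bsub>B\<^esub> b)])"
  by (rule balancedI)
    (simp_all add: A.alg_l_distr B.alg_l_distr A.smult_mult_left B.smult_mult_left
      pure_add_left pure_add_right pure_smult_left pure_smult_right)

lemma wfl_mult:
  assumes "wfl l" "wfl m"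
  shows "wfl (concat (map (\<lambda>(a, b). map (\<lambda>(c, d). (a \<otimes>\<^bsub>A\<^esub> c, b \<otimes>\<^bsub>B\<^esub> d)) m) l))"
  using assms by auto

lemma mult_lsum:
  assumes "wfl s" "wfl t"
  shows "s \<otimes>\<^bsub>tens A B\<^esub> t = lsum (tens A B) (map (\<lambda>x. lsum (tens A B)
    (map (\<lambda>y. tsum A B [(fst x \<otimes>\<^bsub>A\<^esub> fst y, snd x \<otimes>\<^bsub>B\<^esub> snd y)]) t)) s)"
proof -
  let ?l = "concat (map (\<lambda>(a, b). map (\<lambda>(c, d). (a \<otimes>\<^bsub>A\<^esub> c, b \<otimes>\<^bsub>B\<^esub> d)) t) s)"
  have "wfl ?l" using assms by auto
  then have "s \<otimes>\<^bsub>tens A B\<^esub> t = lsum (tens A B) (map (\<lambda>x. tsum A B [(fst x, snd x)]) ?l)"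
    unfolding tens_mult by (rule tsum_lsum)
  also have "\<dots> = lsum (tens A B) (map (\<lambda>x. lsum (tens A B)
    (map (\<lambda>y. tsum A B [(fst x \<otimes>\<^bsub>A\<^esub> fst y, snd x \<otimes>\<^bsub>B\<^esub> snd y)]) t)) s)"
    unfolding map_concat map_map using assms
    by (subst T.lsum_concat) (auto simp: split_def comp_def intro!: tsum_carrier dest!: subsetD)
  finally show ?thesis .
qed

text \<open>Well-definedness of the product. The definition multiplies the entries of the stored
  representatives; these are exchanged for \<open>l\<close> and \<open>m\<close> one factor at a
  time, because multiplication by a fixed pair on either side is balanced.\<close>

lemma mult_tsum:
  assumes "wfl l" "wfl m"
  shows "tsum A B l \<otimes>\<^bsub>tens A B\<^esub> tsum A B m =
    tsum A B (concat (map (\<lambda>(a, b). map (\<lambda>(c, d). (a \<otimes>\<^bsub>A\<^esub> c, b \<otimes>\<^bsub>B\<^esub> d)) m) l))"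
proof -
  have "tsum A B l \<otimes>\<^bsub>tens A B\<^esub> tsum A B m = lsum (tens A B) (map (\<lambda>x. lsum (tens A B)
    (map (\<lambda>y. tsum A B [(fst x \<otimes>\<^bsub>A\<^esub> fst y, snd x \<otimes>\<^bsub>B\<^esub> snd y)]) (tsum A B m))) (tsum A B l))"
    using assms by (intro mult_lsum tsum_wf)
  also have "\<dots> = lsum (tens A B) (map (\<lambda>x. lsum (tens A B)
    (map (\<lambda>y. tsum A B [(fst x \<otimes>\<^bsub>A\<^esub> fst y, snd x \<otimes>\<^bsub>B\<^esub> snd y)]) (tsum A B m))) l)"
  proof (rule lsum_tsum[OF T.abelian_group_axioms _ assms(1), where f="\<lambda>a b. lsum (tens A B)
        (map (\<lambda>y. tsum A B [(a \<otimes>\<^bsub>A\<^esub> fst y, b \<otimes>\<^bsub>B\<^esub> snd y)]) (tsum A B m))"])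
    show "balanced A B (tens A B) (\<lambda>a b. lsum (tens A B)
        (map (\<lambda>y. tsum A B [(a \<otimes>\<^bsub>A\<^esub> fst y, b \<otimes>\<^bsub>B\<^esub> snd y)]) (tsum A B m)))"
      using tsum_wf[OF assms(2)]
      by (intro balanced_lsum[OF T.abelian_group_axioms] balanced_mult_right) auto
  qed
  also have "\<dots> = lsum (tens A B) (map (\<lambda>x. lsum (tens A B)
    (map (\<lambda>y. tsum A B [(fst x \<otimes>\<^bsub>A\<^esub> fst y, snd x \<otimes>\<^bsub>B\<^esub> snd y)]) m)) l)"
    using assms
    by (intro T.lsum_cong
      lsum_tsum[OF T.abelian_group_axioms, where f="\<lambda>c d. tsum A B [(_ \<otimes>\<^bsub>A\<^esub> c, _ \<otimes>\<^bsub>B\<^esub> d)]"]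
      balanced_mult_left) auto
  also have "\<dots> = l \<otimes>\<^bsub>tens A B\<^esub> m"
    using assms by (simp add: mult_lsum)
  finally show ?thesis
    unfolding tens_mult[of A B l m] .
qed

lemma mult_pure:
  "a \<in> carrier A \<Longrightarrow> b \<in> carrier B \<Longrightarrow> c \<in> carrier A \<Longrightarrow> d \<in> carrier B \<Longrightarrow>
    tsum A B [(a, b)] \<otimes>\<^bsub>tens A B\<^esub> tsum A B [(c, d)] = tsum A B [(a \<otimes>\<^bsub>A\<^esub> c, b \<otimes>\<^bsub>B\<^esub> d)]"
  by (simp add: mult_tsum)

lemma mult_closed:
  "s \<in> carrier (tens A B) \<Longrightarrow> t \<in> carrier (tens A B) \<Longrightarrow> s \<otimes>\<^bsub>tens A B\<^esub> t \<in> carrier (tens A B)"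
  by (erule carrier_tensE, erule carrier_tensE) (simp only: mult_tsum wfl_mult tsum_carrier)

lemma add_map_mult_right:
  assumes "s \<in> carrier (tens A B)"
  shows "add_map (tens A B) (tens A B) (\<lambda>t. s \<otimes>\<^bsub>tens A B\<^esub> t)"
proof -
  have s: "wfl s" by (rule carrier_wf) fact
  have "balanced A B (tens A B) (\<lambda>c d. tsum A B [(fst x \<otimes>\<^bsub>A\<^esub> c, snd x \<otimes>\<^bsub>B\<^esub> d)])" if "x \<in> set s" for x
    using that s by (intro balanced_mult_left) auto
  then have "add_map (tens A B) (tens A B) (\<lambda>t. lsum (tens A B) (map (\<lambda>x. lsum (tens A B)
    (map (\<lambda>y. tsum A B [(fst x \<otimes>\<^bsub>A\<^esub> fst y, snd x \<otimes>\<^bsub>B\<^esub> snd y)]) t)) s))"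
    by (intro add_map_lsum_pointwise add_map_lift T.abelian_group_axioms)
  then show ?thesis
    using s by (simp add: add_map_def mult_lsum carrier_wf T.add.m_closed)
qed

lemma add_map_mult_left:
  assumes "t \<in> carrier (tens A B)"
  shows "add_map (tens A B) (tens A B) (\<lambda>s. s \<otimes>\<^bsub>tens A B\<^esub> t)"
proof -
  have t: "wfl t" by (rule carrier_wf) fact
  have "balanced A B (tens A B) (\<lambda>a b. tsum A B [(a \<otimes>\<^bsub>A\<^esub> fst y, b \<otimes>\<^bsub>B\<^esub> snd y)])" if "y \<in> set t" for y
    using that t by (intro balanced_mult_right) auto
  then have "add_map (tens A B) (tens A B) (\<lambda>s. lsum (tens A B) (map (\<lambda>x. lsum (tens A B)
    (map (\<lambda>y. tsum A B [(fst x \<otimes>\<^bsub>A\<^esub> fst y, snd x \<otimes>\<^bsub>B\<^esub> snd y)]) t)) s))"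
    by (intro add_map_lift[OF T.abelian_group_axioms balanced_lsum[OF T.abelian_group_axioms]])
  then show ?thesis
    using t by (simp add: add_map_def mult_lsum carrier_wf T.add.m_closed)
qed

lemma add_map_smult: "add_map (tens A B) (tens A B) (\<lambda>t. c \<odot>\<^bsub>tens A B\<^esub> t)"
  by (simp add: add_map_def T.smult_r_distr)

lemmas tens_ext = tens_induct_eq[OF T.abelian_group_axioms]

text \<open>Both sides are additive in each argument. The arguments are replaced by pure tensors one
  after another, from the right, until associativity in the two factors applies.\<close>

lemma mult_assoc:
  assumes "x \<in> carrier (tens A B)" "y \<in> carrier (tens A B)" "z \<in> carrier (tens A B)"
  shows "x \<otimes>\<^bsub>tens A B\<^esub> y \<otimes>\<^bsub>tens A B\<^esub> z = x \<otimes>\<^bsub>tens A B\<^esub> (y \<otimes>\<^bsub>tens A B\<^esub> z)"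
proof (rule tens_ext[OF _ _ _ assms(3)])
  fix a3 b3
  assume 3: "a3 \<in> carrier A" "b3 \<in> carrier B"
  let ?z = "tsum A B [(a3, b3)]"
  show "x \<otimes>\<^bsub>tens A B\<^esub> y \<otimes>\<^bsub>tens A B\<^esub> ?z = x \<otimes>\<^bsub>tens A B\<^esub> (y \<otimes>\<^bsub>tens A B\<^esub> ?z)"
  proof (rule tens_ext[OF _ _ _ assms(2)])
    fix a2 b2
    assume 2: "a2 \<in> carrier A" "b2 \<in> carrier B"
    let ?y = "tsum A B [(a2, b2)]"
    show "x \<otimes>\<^bsub>tens A B\<^esub> ?y \<otimes>\<^bsub>tens A B\<^esub> ?z = x \<otimes>\<^bsub>tens A B\<^esub> (?y \<otimes>\<^bsub>tens A B\<^esub> ?z)"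
    proof (rule tens_ext[OF _ _ _ assms(1)])
      fix a1 b1
      assume 1: "a1 \<in> carrier A" "b1 \<in> carrier B"
      show "tsum A B [(a1, b1)] \<otimes>\<^bsub>tens A B\<^esub> ?y \<otimes>\<^bsub>tens A B\<^esub> ?z =
          tsum A B [(a1, b1)] \<otimes>\<^bsub>tens A B\<^esub> (?y \<otimes>\<^bsub>tens A B\<^esub> ?z)"
        using 1 2 3 by (simp add: mult_pure A.alg_assoc B.alg_assoc)
    qed (use 2 3 in \<open>intro add_map_comp[OF add_map_mult_left add_map_mult_left] add_map_mult_left
        mult_closed tsum_carrier; simp\<close>)+
  qed (use 3 assms(1) in \<open>intro add_map_comp[OF add_map_mult_left add_map_mult_right]
      add_map_comp[OF add_map_mult_right add_map_mult_left] tsum_carrier; simp\<close>)+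
next
  show "add_map (tens A B) (tens A B) (\<lambda>a. x \<otimes>\<^bsub>tens A B\<^esub> y \<otimes>\<^bsub>tens A B\<^esub> a)"
    by (intro add_map_mult_right mult_closed assms)
  show "add_map (tens A B) (tens A B) (\<lambda>a. x \<otimes>\<^bsub>tens A B\<^esub> (y \<otimes>\<^bsub>tens A B\<^esub> a))"
    by (intro add_map_comp[OF add_map_mult_right add_map_mult_right] assms)
qed

lemma monoid_tens: "monoid (tens A B)"
proof (rule monoidI)
  fix x
  assume x: "x \<in> carrier (tens A B)"
  show "\<one>\<^bsub>tens A B\<^esub> \<otimes>\<^bsub>tens A B\<^esub> x = x"
    unfolding tens_simps
    by (rule tens_ext[OF add_map_mult_right _ _ x]) (auto simp: mult_pure add_map_def)
  show "x \<otimes>\<^bsub>tens A B\<^esub> \<one>\<^bsub>tens A B\<^esub> = x"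
    unfolding tens_simps
    by (rule tens_ext[OF add_map_mult_left _ _ x]) (auto simp: mult_pure add_map_def)
qed (simp_all add: mult_closed mult_assoc tens_simps)

text \<open>Closes the construction under iteration: \<open>tens3 H\<close> and
  \<open>tens4 H\<close> are again tensor products of two algebras, with first factor
  \<open>H\<close>.\<close>

lemma complex_algebra_tens: "complex_algebra (tens A B)"
proof (intro complex_algebra.intro ringI abelian_group_tens monoid_tens module_tens
    complex_algebra_axioms.intro)
  fix x y c
  assume x: "x \<in> carrier (tens A B)" and y: "y \<in> carrier (tens A B)"
  show "(c \<odot>\<^bsub>tens A B\<^esub> x) \<otimes>\<^bsub>tens A B\<^esub> y = c \<odot>\<^bsub>tens A B\<^esub> (x \<otimes>\<^bsub>tens A B\<^esub> y)"
  proof (rule tens_ext[OF _ _ _ x])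
    fix a b
    assume 1: "a \<in> carrier A" "b \<in> carrier B"
    let ?x = "tsum A B [(a, b)]"
    show "(c \<odot>\<^bsub>tens A B\<^esub> ?x) \<otimes>\<^bsub>tens A B\<^esub> y = c \<odot>\<^bsub>tens A B\<^esub> (?x \<otimes>\<^bsub>tens A B\<^esub> y)"
      by (rule tens_ext[OF _ _ _ y])
        (use 1 in \<open>auto simp: mult_pure A.smult_mult_left pure_smult_left[symmetric]
          intro!: add_map_mult_right add_map_comp[OF add_map_mult_right add_map_smult]\<close>)
  qed (intro add_map_comp[OF add_map_smult add_map_mult_left] add_map_comp[OF add_map_mult_left add_map_smult] y)+
  show "x \<otimes>\<^bsub>tens A B\<^esub> (c \<odot>\<^bsub>tens A B\<^esub> y) = c \<odot>\<^bsub>tens A B\<^esub> (x \<otimes>\<^bsub>tens A B\<^esub> y)"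
  proof (rule tens_ext[OF _ _ _ x])
    fix a b
    assume 1: "a \<in> carrier A" "b \<in> carrier B"
    let ?x = "tsum A B [(a, b)]"
    show "?x \<otimes>\<^bsub>tens A B\<^esub> (c \<odot>\<^bsub>tens A B\<^esub> y) = c \<odot>\<^bsub>tens A B\<^esub> (?x \<otimes>\<^bsub>tens A B\<^esub> y)"
      by (rule tens_ext[OF _ _ _ y])
        (use 1 in \<open>auto simp: mult_pure A.smult_mult_right pure_smult_left[symmetric]
          intro!: add_map_comp[OF add_map_smult add_map_mult_right] add_map_comp[OF add_map_mult_right add_map_smult]\<close>)
  qed (intro add_map_mult_left add_map_comp[OF add_map_mult_left add_map_smult] T.smult_closed y; simp)+
next
  fix x y z
  assume "x \<in> carrier (tens A B)" "y \<in> carrier (tens A B)" "z \<in> carrier (tens A B)"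
  then show "(x \<oplus>\<^bsub>tens A B\<^esub> y) \<otimes>\<^bsub>tens A B\<^esub> z = x \<otimes>\<^bsub>tens A B\<^esub> z \<oplus>\<^bsub>tens A B\<^esub> y \<otimes>\<^bsub>tens A B\<^esub> z"
    "z \<otimes>\<^bsub>tens A B\<^esub> (x \<oplus>\<^bsub>tens A B\<^esub> y) = z \<otimes>\<^bsub>tens A B\<^esub> x \<oplus>\<^bsub>tens A B\<^esub> z \<otimes>\<^bsub>tens A B\<^esub> y"
    using add_map_mult_left[of z] add_map_mult_right[of z] by (auto simp: add_map_def)
qed

end

section \<open>Multilinear evaluation\<close>

text \<open>Balance in two neighbouring arguments, the third being fixed, gives additivity in all
  three arguments and free passage of scalars among them. As for \<open>balanced\<close>,
  conjugate-linear maps are included.\<close>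

definition trilinear where
  "trilinear V W X U F \<longleftrightarrow>
     (\<forall>a\<in>carrier V. balanced W X U (F a)) \<and> (\<forall>c\<in>carrier X. balanced V W U (\<lambda>a b. F a b c))"

definition quadrilinear where
  "quadrilinear V W X Y U F \<longleftrightarrow>
     (\<forall>a\<in>carrier V. trilinear W X Y U (F a)) \<and>
     (\<forall>c\<in>carrier X. \<forall>d\<in>carrier Y. balanced V W U (\<lambda>a b. F a b c d))"

text \<open>Scalars act on the tensor product of \<open>W\<close> and \<open>X\<close> through
  \<open>W\<close>, so a scalar has to pass only from \<open>V\<close> to \<open>W\<close>. This
  merges the last two arguments, which fits the bracketing of the tensor powers of
  \<open>H\<close>.\<close>

lemma balanced_lift:
  assumes V: "vector_space_over V" and W: "vector_space_over W" and X: "vector_space_over X"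
    and U: "abelian_group U" and F: "trilinear V W X U F"
  shows "balanced V (tens W X) U (\<lambda>a s. lsum2 U (F a) s)"
proof -
  interpret V: module complex_field V by fact
  interpret T: two_vector_spaces W X by (simp add: two_vector_spaces_def W X)
  interpret U: abelian_group U by fact
  have Fa: "balanced W X U (F a)" if "a \<in> carrier V" for a
    using F that by (simp add: trilinear_def)
  have Fc: "balanced V W U (\<lambda>a b. F a b c)" if "c \<in> carrier X" for c
    using F that by (simp add: trilinear_def)
  show ?thesis
    unfolding balanced_def
  proof (intro conjI ballI allI)
    fix a
    assume "a \<in> carrier V"
    then show "add_map (tens W X) U (\<lambda>s. lsum2 U (F a) s)"
      by (intro T.add_map_lift U Fa)
  next
    fix s
    assume "s \<in> carrier (tens W X)"
    from T.carrier_wf[OF this] show "add_map V U (\<lambda>a. lsum2 U (F a) s)"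
      using Fc by (intro add_map_lsum_pointwise U) (auto simp: balanced_def)
  next
    fix c a s
    assume a: "a \<in> carrier V" and s: "s \<in> carrier (tens W X)"
    have wf: "T.wfl s" by (rule T.carrier_wf) fact
    let ?m = "map (\<lambda>(v, w). (c \<odot>\<^bsub>W\<^esub> v, w)) s"
    have m: "T.wfl ?m"
      using wf by auto
    have "lsum2 U (F a) (c \<odot>\<^bsub>tens W X\<^esub> s) =
        lsum2 U (F a) (tsum W X ?m)"
      using T.tens_smult[OF wf, of c] s by simp
    also have "\<dots> = lsum2 U (F a) ?m"
      by (rule T.lsum_tsum[OF U Fa[OF a] m])
    also have "\<dots> = lsum U (map (\<lambda>x. F a (c \<odot>\<^bsub>W\<^esub> fst x) (snd x)) s)"
      by (simp add: comp_def split_def)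
    also have "\<dots> = lsum U (map (\<lambda>x. F (c \<odot>\<^bsub>V\<^esub> a) (fst x) (snd x)) s)"
      using wf a by (intro U.lsum_cong) (auto simp: balancedD(4)[OF Fc])
    finally show "lsum U (map (\<lambda>x. F (c \<odot>\<^bsub>V\<^esub> a) (fst x) (snd x)) s) =
        lsum2 U (F a) (c \<odot>\<^bsub>tens W X\<^esub> s)" ..
  qed
qed

lemma carrier_tens_wf:
  assumes "vector_space_over V" "vector_space_over W" "t \<in> carrier (tens V W)" "x \<in> set t"
  shows "fst x \<in> carrier V" "snd x \<in> carrier W"
  using two_vector_spaces.carrier_wf[of V W t] assms by (auto simp: two_vector_spaces_def)

lemma vector_space_tens:
  "vector_space_over V \<Longrightarrow> vector_space_over W \<Longrightarrow> vector_space_over (tens V W)"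
  by (rule two_vector_spaces.module_tens) (simp add: two_vector_spaces_def)

lemma triplesD:
  assumes "vector_space_over V" "vector_space_over W" "vector_space_over X"
    and "t \<in> carrier (tens V (tens W X))" "x \<in> set (triples t)"
  shows "fst x \<in> carrier V" "fst (snd x) \<in> carrier W" "snd (snd x) \<in> carrier X"
  using carrier_tens_wf[OF assms(1) vector_space_tens[OF assms(2,3)] assms(4)]
    carrier_tens_wf[OF assms(2,3)] assms(5)
  by (fastforce simp: triples_def)+

lemma lsum_triples:
  assumes "vector_space_over V" "vector_space_over W" "vector_space_over X" "abelian_group U"
    and "t \<in> carrier (tens V (tens W X))"
    and "\<And>a b c. a \<in> carrier V \<Longrightarrow> b \<in> carrier W \<Longrightarrow> c \<in> carrier X \<Longrightarrow> F a b c \<in> carrier U"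
  shows "lsum3 U F (triples t) =
    lsum U (map (\<lambda>x. lsum U (map (\<lambda>y. F (fst x) (fst y) (snd y)) (snd x))) t)"
proof -
  interpret U: abelian_group U by fact
  have cl: "F (fst x) (fst y) (snd y) \<in> carrier U" if "x \<in> set t" "y \<in> set (snd x)" for x y
    using carrier_tens_wf[OF assms(1) vector_space_tens[OF assms(2,3)] assms(5) that(1)]
      carrier_tens_wf[OF assms(2,3) _ that(2)] by (intro assms(6))
  show ?thesis
    unfolding triples_def map_concat map_map using cl
    by (subst U.lsum_concat) (auto simp: comp_def split_def)
qed

lemma trilinear_lift:
  assumes V: "vector_space_over V" and W: "vector_space_over W" and X: "vector_space_over X"
    and Y: "vector_space_over Y" and U: "abelian_group U" and F: "quadrilinear V W X Y U F"
  shows "trilinear V W (tens X Y) U (\<lambda>a b s. lsum2 U (F a b) s)"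
  unfolding trilinear_def
proof (intro conjI ballI)
  fix a
  assume "a \<in> carrier V"
  then show "balanced W (tens X Y) U (\<lambda>b s. lsum2 U (F a b) s)"
    using F by (intro balanced_lift W X Y U) (auto simp: quadrilinear_def)
next
  fix s
  assume s: "s \<in> carrier (tens X Y)"
  show "balanced V W U (\<lambda>a b. lsum2 U (F a b) s)"
    using F carrier_tens_wf[OF X Y s] by (intro balanced_lsum U) (auto simp: quadrilinear_def)
qed

section \<open>Evaluation and multiplication in the tensor powers of an algebra\<close>

context complex_algebra
begin

interpretation T2: two_algebras H H
  by unfold_locales

lemma complex_algebra_tens2: "complex_algebra (tens2 H)"
  by (rule T2.complex_algebra_tens)

interpretation T3: two_algebras H "tens2 H"
  by (intro two_algebras.intro complex_algebra_tens2 complex_algebra_axioms)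

lemma complex_algebra_tens3: "complex_algebra (tens3 H)"
  by (rule T3.complex_algebra_tens)

interpretation T4: two_algebras H "tens3 H"
  by (intro two_algebras.intro complex_algebra_tens3 complex_algebra_axioms)

abbreviation "wf3 l \<equiv> set l \<subseteq> carrier H \<times> carrier H \<times> carrier H"
abbreviation "wf4 l \<equiv> set l \<subseteq> carrier H \<times> carrier H \<times> carrier H \<times> carrier H"

lemma vs_H: "vector_space_over H"
  by unfold_locales

lemma vs_tens: "vector_space_over (tens2 H)" "vector_space_over (tens3 H)"
  by (intro vector_space_tens vs_H)+

lemma lsum_tsum2:
  assumes "abelian_group U" "balanced H H U F" "set l \<subseteq> carrier H \<times> carrier H"
  shows "lsum2 U F (tsum H H l) = lsum2 U F l"
  using assms by (rule T2.lsum_tsum)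

lemma wf3_pairs:
  "wf3 l \<Longrightarrow> set [(a, tsum H H [(b, c)]). (a, b, c) \<leftarrow> l] \<subseteq> carrier H \<times> carrier (tens2 H)"
  by (auto intro!: T2.tsum_carrier)

lemma tsum3_closed: "wf3 l \<Longrightarrow> tsum3 H l \<in> carrier (tens3 H)"
  unfolding tsum3_def by (rule T3.tsum_carrier[OF wf3_pairs])

lemma wf4_pairs:
  "wf4 l \<Longrightarrow> set [(a, tsum3 H [(b, c, d)]). (a, b, c, d) \<leftarrow> l] \<subseteq> carrier H \<times> carrier (tens3 H)"
  by (auto intro!: tsum3_closed)

text \<open>\<open>tsum3\<close> chooses representatives on two levels. The outer choice is undone
  by the balanced map obtained from \<open>balanced_lift\<close>, the inner one by
  \<open>lsum_tsum2\<close> for each fixed first entry.\<close>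

lemma lsum_tsum3:
  assumes U: "abelian_group U" and F: "trilinear H H H U F" and l: "wf3 l"
  shows "lsum3 U F (triples (tsum3 H l)) =
    lsum3 U F l"
proof -
  interpret U: abelian_group U by fact
  have Fa: "balanced H H U (F a)" if "a \<in> carrier H" for a
    using F that by (simp add: trilinear_def)
  let ?G = "\<lambda>a s. lsum2 U (F a) s"
  have "lsum3 U F (triples (tsum3 H l)) =
      lsum2 U ?G (tsum3 H l)"
    by (rule lsum_triples[OF vs_H vs_H vs_H U tsum3_closed[OF l] balancedD(1)[OF Fa]])
  also have "\<dots> = lsum2 U ?G ([(a, tsum H H [(b, c)]). (a, b, c) \<leftarrow> l])"
    unfolding tsum3_def
    by (rule T3.lsum_tsum[OF U balanced_lift[OF vs_H vs_H vs_H U F] wf3_pairs[OF l]])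
  also have "\<dots> = lsum U (map (\<lambda>x. ?G (fst x) (tsum H H [(fst (snd x), snd (snd x))])) l)"
    by (simp add: comp_def split_def)
  also have "\<dots> = lsum3 U F l"
  proof (rule U.lsum_cong)
    fix x
    assume "x \<in> set l"
    then have x: "fst x \<in> carrier H" "fst (snd x) \<in> carrier H" "snd (snd x) \<in> carrier H"
      using l by auto
    then show "?G (fst x) (tsum H H [(fst (snd x), snd (snd x))]) = F (fst x) (fst (snd x)) (snd (snd x))"
      using lsum_tsum2[OF U Fa[OF x(1)], of "[(fst (snd x), snd (snd x))]"]
        balancedD(1)[OF Fa[OF x(1)] x(2,3)] by (simp add: mem_Times_iff)
  qed
  finally show ?thesis .
qed

lemma trilinear_eval:
  assumes "abelian_group U" "trilinear H H H U F" "wf3 l" "wf3 m" "tsum3 H l = tsum3 H m"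
  shows "lsum3 U F l =
    lsum3 U F m"
  using lsum_tsum3[OF assms(1,2,3)] lsum_tsum3[OF assms(1,2,4)] assms(5) by simp

text \<open>One factor is peeled off: the last two and then the last three arguments are merged by
  lifting, and the inner threefold tensors are evaluated by the trilinear case.\<close>

lemma quadrilinear_eval:
  assumes U: "abelian_group U" and F: "quadrilinear H H H H U F" and "wf4 l" "wf4 m"
    and "tsum4 H l = tsum4 H m"
  shows "lsum U (map (\<lambda>x. F (fst x) (fst (snd x)) (fst (snd (snd x))) (snd (snd (snd x)))) l) =
    lsum U (map (\<lambda>x. F (fst x) (fst (snd x)) (fst (snd (snd x))) (snd (snd (snd x)))) m)"
proof -
  interpret U: abelian_group U by fact
  have Fa: "trilinear H H H U (F a)" if "a \<in> carrier H" for a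
    using F that by (simp add: quadrilinear_def)
  have cl: "F a b c d \<in> carrier U"
    if "a \<in> carrier H" "b \<in> carrier H" "c \<in> carrier H" "d \<in> carrier H" for a b c d
    using that Fa[of a] by (auto simp: trilinear_def intro: balancedD(1)[of H H])
  let ?F = "\<lambda>a x. F a (fst x) (fst (snd x)) (snd (snd x))"
  let ?F3 = "\<lambda>a b s. lsum2 U (F a b) s"
  let ?G = "\<lambda>a s. lsum2 U (?F3 a) s"
  have G: "?G a s = lsum U (map (?F a) (triples s))"
    if "a \<in> carrier H" "s \<in> carrier (tens3 H)" for a s
    using lsum_triples[OF vs_H vs_H vs_H U that(2), of "F a"] cl that by simp
  have bal: "balanced H (tens3 H) U ?G"
    by (intro balanced_lift trilinear_lift vs_H vs_tens U F)
  have "lsum2 U ?F l = lsum2 U ?G (tsum4 H l)"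
    if l: "wf4 l" for l
  proof -
    have "lsum2 U ?G (tsum4 H l) =
        lsum2 U ?G ([(a, tsum3 H [(b, c, d)]). (a, b, c, d) \<leftarrow> l])"
      unfolding tsum4_def by (rule T4.lsum_tsum[OF U bal wf4_pairs[OF l]])
    also have "\<dots> = lsum U (map (\<lambda>x. ?G (fst x) (tsum3 H [snd x])) l)"
      by (simp add: comp_def split_def)
    also have "\<dots> = lsum2 U ?F l"
    proof (rule U.lsum_cong)
      fix x
      assume "x \<in> set l"
      then have x: "fst x \<in> carrier H" "wf3 [snd x]"
        using l by auto
      then have "?G (fst x) (tsum3 H [snd x]) = lsum U (map (?F (fst x)) [snd x])"
        using lsum_tsum3[OF U Fa[OF x(1)] x(2)] G[OF x(1) tsum3_closed[OF x(2)]] by simp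
      then show "?G (fst x) (tsum3 H [snd x]) = ?F (fst x) (snd x)"
        using x cl by auto
    qed
    finally show ?thesis ..
  qed
  then show ?thesis
    using assms(3-5) by simp
qed

definition prod3 :: "('h \<times> 'h \<times> 'h) list \<Rightarrow> ('h \<times> 'h \<times> 'h) list \<Rightarrow> ('h \<times> 'h \<times> 'h) list" where
  "prod3 l m =
    [(fst x \<otimes> fst y, fst (snd x) \<otimes> fst (snd y), snd (snd x) \<otimes> snd (snd y)). x \<leftarrow> l, y \<leftarrow> m]"

text \<open>Keeps products as flat lists, so that a product of several elements can be evaluated
  without ever inspecting the representative of an intermediate result.\<close>

lemma tsum3_prod:
  assumes l: "wf3 l" and m: "wf3 m"
  shows "tsum3 H l \<otimes>\<^bsub>tens3 H\<^esub> tsum3 H m = tsum3 H (prod3 l m)"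
proof -
  have "tsum H H [(fst (snd x), snd (snd x))] \<otimes>\<^bsub>tens2 H\<^esub> tsum H H [(fst (snd y), snd (snd y))] =
      tsum H H [(fst (snd x) \<otimes> fst (snd y), snd (snd x) \<otimes> snd (snd y))]"
    if "x \<in> set l" "y \<in> set m" for x y
    using that l m by (intro T2.mult_pure) auto
  then show ?thesis
    unfolding tsum3_def prod3_def
    by (subst T3.mult_tsum[OF wf3_pairs[OF l] wf3_pairs[OF m]])
      (auto simp: map_concat comp_def split_def intro!: arg_cong[where f="tsum H (tens2 H)"]
        arg_cong[where f=concat])
qed

definition prod4 :: "('h \<times> 'h \<times> 'h \<times> 'h) list \<Rightarrow> ('h \<times> 'h \<times> 'h \<times> 'h) list \<Rightarrow> ('h \<times> 'h \<times> 'h \<times> 'h) list" where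
  "prod4 l m =
    [(fst x \<otimes> fst y, fst (snd x) \<otimes> fst (snd y), fst (snd (snd x)) \<otimes> fst (snd (snd y)),
      snd (snd (snd x)) \<otimes> snd (snd (snd y))). x \<leftarrow> l, y \<leftarrow> m]"

lemma tsum4_prod:
  assumes l: "wf4 l" and m: "wf4 m"
  shows "tsum4 H l \<otimes>\<^bsub>tens4 H\<^esub> tsum4 H m = tsum4 H (prod4 l m)"
proof -
  have "tsum3 H [snd x] \<otimes>\<^bsub>tens3 H\<^esub> tsum3 H [snd y] =
      tsum3 H [(fst (snd x) \<otimes> fst (snd y), fst (snd (snd x)) \<otimes> fst (snd (snd y)),
        snd (snd (snd x)) \<otimes> snd (snd (snd y)))]"
    if "x \<in> set l" "y \<in> set m" for x y
    using that l m by (subst tsum3_prod) (auto simp: prod3_def)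
  then show ?thesis
    unfolding tsum4_def prod4_def
    by (subst T4.mult_tsum[OF wf4_pairs[OF l] wf4_pairs[OF m]])
      (auto simp: map_concat comp_def split_def intro!: arg_cong[where f="tsum H (tens3 H)"]
        arg_cong[where f=concat])
qed

lemma tsum2_mult:
  assumes l: "set l \<subseteq> carrier H \<times> carrier H" and m: "set m \<subseteq> carrier H \<times> carrier H"
  shows "tsum H H l \<otimes>\<^bsub>tens2 H\<^esub> tsum H H m =
    tsum H H [(fst x \<otimes> fst y, snd x \<otimes> snd y). x \<leftarrow> l, y \<leftarrow> m]"
  by (subst T2.mult_tsum[OF assms]) (simp add: split_def)

lemma tens3_one: "\<one>\<^bsub>tens3 H\<^esub> = tsum3 H [(\<one>, \<one>, \<one>)]"
  by (simp add: tens_simps tsum3_def)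

lemma tens2_id: "t \<in> carrier (tens2 H) \<Longrightarrow> tsum H H t = t"
  by (rule T2.tsum_id)

lemma tens2_wf: "t \<in> carrier (tens2 H) \<Longrightarrow> set t \<subseteq> carrier H \<times> carrier H"
  by (rule T2.carrier_wf)

lemma triples_wf: "t \<in> carrier (tens3 H) \<Longrightarrow> wf3 (triples t)"
  using triplesD[OF vs_H vs_H vs_H] by (metis mem_Times_iff subsetI)

text \<open>An element such as \<phi> is given only as a nested list. This allows its flat list of
  elementary tensors to stand for it in products: each second entry is the sum of its own pure
  tensors, and tensoring with a fixed first entry is additive.\<close>

lemma tsum3_triples:
  assumes t: "t \<in> carrier (tens3 H)"
  shows "tsum3 H (triples t) = t"
proof -
  let ?P = "\<lambda>a b c. tsum H (tens2 H) [(a, tsum H H [(b, c)])]"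
  have "tsum3 H (triples t) = lsum3 (tens3 H) ?P (triples t)"
    unfolding tsum3_def using T3.tsum_lsum[OF wf3_pairs[OF triples_wf[OF t]]]
    by (simp add: comp_def split_def)
  also have "\<dots> = lsum (tens3 H) (map (\<lambda>x. lsum (tens3 H) (map (\<lambda>y. ?P (fst x) (fst y) (snd y)) (snd x))) t)"
    by (rule lsum_triples[OF vs_H vs_H vs_H T3.abelian_group_tens t]) simp
  also have "\<dots> = lsum (tens3 H) (map (\<lambda>x. tsum H (tens2 H) [(fst x, snd x)]) t)"
  proof (rule T3.T.lsum_cong)
    fix x
    assume "x \<in> set t"
    then have x: "fst x \<in> carrier H" "snd x \<in> carrier (tens2 H)"
      using T3.carrier_wf[OF t] by auto
    have "add_map (tens2 H) (tens3 H) (\<lambda>s. tsum H (tens2 H) [(fst x, s)])"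
      using T3.balanced_pure x by (auto simp: balanced_def)
    moreover have "tsum H H [(fst y, snd y)] \<in> carrier (tens2 H)" if "y \<in> set (snd x)" for y
      using tens2_wf[OF x(2)] that by (intro T2.tsum_carrier) auto
    ultimately have "tsum H (tens2 H) [(fst x, lsum (tens2 H) (map (\<lambda>y. tsum H H [(fst y, snd y)]) (snd x)))] =
        lsum (tens3 H) (map (\<lambda>y. ?P (fst x) (fst y) (snd y)) (snd x))"
      by (rule add_map_lsum[OF T2.T.abelian_monoid_axioms T3.abelian_group_tens])
    then show "lsum (tens3 H) (map (\<lambda>y. ?P (fst x) (fst y) (snd y)) (snd x)) =
        tsum H (tens2 H) [(fst x, snd x)]"
      using T2.tsum_lsum[OF tens2_wf[OF x(2)], symmetric] tens2_id[OF x(2)] by simp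
  qed
  also have "\<dots> = t"
    using T3.tsum_lsum[OF T3.carrier_wf[OF t], symmetric] T3.tsum_id[OF t] by simp
  finally show ?thesis .
qed

end

section \<open>Tensor products of modules\<close>

text \<open>The mirror image of \<open>balanced_lift\<close>. The source of the associator is
  bracketed to the left, while the tensor powers of \<open>H\<close> are bracketed to the right, so
  both versions are needed. Here a scalar travels from \<open>V\<close> through \<open>W\<close> to
  \<open>X\<close>, in two steps.\<close>

lemma balanced_lift_left:
  assumes V: "vector_space_over V" and W: "vector_space_over W" and X: "vector_space_over X"
    and U: "abelian_group U" and F: "trilinear V W X U F"
  shows "balanced (tens V W) X U (\<lambda>s c. lsum U (map (\<lambda>x. F (fst x) (snd x) c) s))"
proof -
  interpret X: module complex_field X by fact
  interpret T: two_vector_spaces V W by (simp add: two_vector_spaces_def V W)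
  interpret U: abelian_group U by fact
  have Fa: "balanced W X U (F a)" if "a \<in> carrier V" for a
    using F that by (simp add: trilinear_def)
  have Fc: "balanced V W U (\<lambda>a b. F a b c)" if "c \<in> carrier X" for c
    using F that by (simp add: trilinear_def)
  show ?thesis
    unfolding balanced_def
  proof (intro conjI ballI allI)
    fix c
    assume "c \<in> carrier X"
    then show "add_map (tens V W) U (\<lambda>s. lsum U (map (\<lambda>x. F (fst x) (snd x) c) s))"
      by (intro T.add_map_lift[where f="\<lambda>a b. F a b c"] U Fc)
  next
    fix s
    assume "s \<in> carrier (tens V W)"
    from T.carrier_wf[OF this] show "add_map X U (\<lambda>c. lsum U (map (\<lambda>x. F (fst x) (snd x) c) s))"
      using Fa by (intro add_map_lsum_pointwise U) (auto simp: balanced_def)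
  next
    fix k s c
    assume c: "c \<in> carrier X" and s: "s \<in> carrier (tens V W)"
    have wf: "T.wfl s" by (rule T.carrier_wf) fact
    let ?m = "map (\<lambda>(v, w). (k \<odot>\<^bsub>V\<^esub> v, w)) s"
    have m: "T.wfl ?m"
      using wf by auto
    have "lsum U (map (\<lambda>x. F (fst x) (snd x) c) (k \<odot>\<^bsub>tens V W\<^esub> s)) =
        lsum U (map (\<lambda>x. F (fst x) (snd x) c) (tsum V W ?m))"
      using T.tens_smult[OF wf, of k] s by simp
    also have "\<dots> = lsum U (map (\<lambda>x. F (fst x) (snd x) c) ?m)"
      by (rule T.lsum_tsum[where f="\<lambda>a b. F a b c", OF U Fc[OF c] m])
    also have "\<dots> = lsum U (map (\<lambda>x. F (k \<odot>\<^bsub>V\<^esub> fst x) (snd x) c) s)"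
      by (simp add: comp_def split_def)
    also have "\<dots> = lsum U (map (\<lambda>x. F (fst x) (snd x) (k \<odot>\<^bsub>X\<^esub> c)) s)"
      using wf c by (intro U.lsum_cong) (auto simp: balancedD(4)[OF Fc] balancedD(4)[OF Fa])
    finally show "lsum U (map (\<lambda>x. F (fst x) (snd x) c) (k \<odot>\<^bsub>tens V W\<^esub> s)) =
        lsum U (map (\<lambda>x. F (fst x) (snd x) (k \<odot>\<^bsub>X\<^esub> c)) s)" .
  qed
qed

section \<open>The tensor product of two modules as a vector space\<close>

definition lift :: "('u, 'z) ring_scheme \<Rightarrow> ('a univ \<Rightarrow> 'a univ \<Rightarrow> 'u) \<Rightarrow> 'a univ \<Rightarrow> 'u" where
  "lift U F t = lsum2 U F (tens_of t)"

locale two_modules = two_vector_spaces X Y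
  for X Y :: "('h, 'a) umod" +
  fixes H :: "('h, 'x) quasi_hopf_scheme"
begin

abbreviation "XY \<equiv> tens_mod H X Y"

lemma tens_mod_sel:
  "carrier XY = Tens ` carrier (tens X Y)" "\<zero>\<^bsub>XY\<^esub> = Tens \<zero>\<^bsub>tens X Y\<^esub>"
  "s \<oplus>\<^bsub>XY\<^esub> t = Tens (tens_of s \<oplus>\<^bsub>tens X Y\<^esub> tens_of t)"
  "c \<odot>\<^bsub>XY\<^esub> t = Tens (c \<odot>\<^bsub>tens X Y\<^esub> tens_of t)"
  by (simp_all add: tens_mod_def)

lemma usum_closed: "wfl l \<Longrightarrow> usum X Y l \<in> carrier XY"
  by (simp add: tens_mod_sel usum_def)

lemma module_tens_mod: "module complex_field XY"
proof (rule moduleI[OF cring_complex_field])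
  show "abelian_group XY"
  proof (rule abelian_groupI)
    fix x
    assume "x \<in> carrier XY"
    then obtain s where s: "x = Tens s" "s \<in> carrier (tens X Y)"
      by (auto simp: tens_mod_sel)
    then have "Tens (\<ominus>\<^bsub>tens X Y\<^esub> s) \<in> carrier XY" "Tens (\<ominus>\<^bsub>tens X Y\<^esub> s) \<oplus>\<^bsub>XY\<^esub> x = \<zero>\<^bsub>XY\<^esub>"
      by (auto simp: tens_mod_sel T.l_neg)
    then show "\<exists>y\<in>carrier XY. y \<oplus>\<^bsub>XY\<^esub> x = \<zero>\<^bsub>XY\<^esub>" ..
  qed (auto simp: tens_mod_sel T.a_ac)
qed (auto simp: tens_mod_sel T.smult_l_distr[simplified] T.smult_r_distr[simplified]
    T.smult_assoc1[simplified] T.smult_one[simplified])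

lemma lsum_Tens: "lsum XY (map (\<lambda>x. Tens (f x)) l) = Tens (lsum (tens X Y) (map f l))"
  by (induction l) (simp_all add: lsum_def tens_mod_sel)

lemma usum_lsum: "wfl l \<Longrightarrow> usum X Y l = lsum XY (map (\<lambda>x. pure X Y (fst x) (snd x)) l)"
  unfolding usum_def lsum_Tens by (simp only: tsum_lsum[symmetric])

lemma balanced_pure_mod: "balanced X Y XY (pure X Y)"
  using balanced_pure by (auto simp: balanced_def add_map_def usum_def tens_mod_sel)

lemma pure_smult:
  assumes "v \<in> carrier X" "w \<in> carrier Y"
  shows "pure X Y (c \<odot>\<^bsub>X\<^esub> v) w = c \<odot>\<^bsub>XY\<^esub> pure X Y v w"
    and "pure X Y v (c \<odot>\<^bsub>Y\<^esub> w) = c \<odot>\<^bsub>XY\<^esub> pure X Y v w"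
  using assms by (simp_all add: usum_def tens_mod_sel pure_smult_left pure_smult_right)

text \<open>Justifies \<open>lift\<close> as the induced map of the universal property: it reads the
  stored representative, but its value may be computed from any list.\<close>

lemma lift_usum:
  assumes "abelian_group U" "balanced X Y U F" "wfl l"
  shows "lift U F (usum X Y l) = lsum2 U F l"
  using lsum_tsum[OF assms] by (simp add: lift_def usum_def)

lemma lift_pure:
  assumes "abelian_group U" "balanced X Y U F" "v \<in> carrier X" "w \<in> carrier Y"
  shows "lift U F (pure X Y v w) = F v w"
proof -
  interpret U: abelian_group U by fact
  show ?thesis
    using assms balancedD(1)[OF assms(2)] by (subst lift_usum) auto
qed

lemma add_map_lift_mod:
  assumes "abelian_group U" "balanced X Y U F"
  shows "add_map XY U (lift U F)"
  using add_map_lift[OF assms] by (auto simp: add_map_def lift_def tens_mod_sel)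

lemma tens_of_wf: "t \<in> carrier XY \<Longrightarrow> wfl (tens_of t)"
  using carrier_wf by (fastforce simp: tens_mod_sel)

lemma add_map_ext:
  assumes "abelian_group U" "add_map XY U f" "add_map XY U g"
    and "\<And>v w. v \<in> carrier X \<Longrightarrow> w \<in> carrier Y \<Longrightarrow> f (pure X Y v w) = g (pure X Y v w)"
    and "t \<in> carrier XY"
  shows "f t = g t"
proof -
  obtain s where s: "t = Tens s" "s \<in> carrier (tens X Y)"
    using assms(5) by (auto simp: tens_mod_sel)
  have "f (Tens s) = g (Tens s)"
    by (rule tens_induct_eq[OF assms(1) _ _ _ s(2)])
      (use assms(2-4) in \<open>auto simp: add_map_def tens_mod_sel usum_def\<close>)
  then show ?thesis using s by simp
qed

end

lemma two_modulesI: "vector_space_over X \<Longrightarrow> vector_space_over Y \<Longrightarrow> two_modules X Y"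
  by (simp add: two_modules_def two_vector_spaces_def)

section \<open>Evaluation of the algebra operations of the tensor square\<close>

context complex_algebra
begin

lemma tens2_mult_eval:
  assumes U: "abelian_group U" and F: "balanced H H U F"
    and s: "s \<in> carrier (tens2 H)" and t: "t \<in> carrier (tens2 H)"
  shows "lsum2 U F (s \<otimes>\<^bsub>tens2 H\<^esub> t) =
    lsum U (map (\<lambda>x. lsum U (map (\<lambda>y. F (fst x \<otimes> fst y) (snd x \<otimes> snd y)) t)) s)"
proof -
  interpret U: abelian_group U by fact
  have wf: "set s \<subseteq> carrier H \<times> carrier H" "set t \<subseteq> carrier H \<times> carrier H"
    using s t tens2_wf by auto
  let ?l = "[(fst x \<otimes> fst y, snd x \<otimes> snd y). x \<leftarrow> s, y \<leftarrow> t]"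
  have l: "set ?l \<subseteq> carrier H \<times> carrier H"
    using wf by (auto intro!: alg_closed dest!: subsetD)
  have "s \<otimes>\<^bsub>tens2 H\<^esub> t = tsum H H ?l"
    using tsum2_mult[OF wf] s t by (simp add: tens2_id)
  then have "lsum2 U F (s \<otimes>\<^bsub>tens2 H\<^esub> t) =
      lsum2 U F ?l"
    using lsum_tsum2[OF U F l] by simp
  also have "\<dots> = lsum U (map (\<lambda>x. lsum U (map (\<lambda>y. F (fst x \<otimes> fst y) (snd x \<otimes> snd y)) t)) s)"
    unfolding map_concat map_map using wf
    by (subst U.lsum_concat) (auto simp: comp_def intro!: balancedD(1)[OF F] alg_closed dest!: subsetD)
  finally show ?thesis .
qed

lemma tens2_one_eval:
  assumes U: "abelian_group U" and F: "balanced H H U F"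
  shows "lsum2 U F (\<one>\<^bsub>tens2 H\<^esub>) = F \<one> \<one>"
proof -
  interpret U: abelian_group U by fact
  show ?thesis
    using balancedD(1)[OF F alg_one alg_one]
    unfolding tens_simps by (subst lsum_tsum2[OF U F]) (simp_all add: alg_one)
qed

lemma tens2_smult_eval:
  assumes U: "abelian_group U" and F: "balanced H H U F" and s: "s \<in> carrier (tens2 H)"
  shows "lsum2 U F (c \<odot>\<^bsub>tens2 H\<^esub> s) =
    lsum U (map (\<lambda>x. F (c \<odot> fst x) (snd x)) s)"
proof -
  interpret T: two_vector_spaces H H by unfold_locales
  have wf: "set s \<subseteq> carrier H \<times> carrier H"
    using s tens2_wf by auto
  have "c \<odot>\<^bsub>tens2 H\<^esub> s = tsum H H (map (\<lambda>(v, w). (c \<odot> v, w)) s)"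
    using T.tens_smult[OF wf] s by simp
  moreover have "set (map (\<lambda>(v, w). (c \<odot> v, w)) s) \<subseteq> carrier H \<times> carrier H"
    using wf by auto
  ultimately show ?thesis
    using lsum_tsum2[OF U F] by (simp add: comp_def split_def)
qed

lemma tens2_add_eval:
  assumes U: "abelian_group U" and F: "balanced H H U F" and "s \<in> carrier (tens2 H)" "t \<in> carrier (tens2 H)"
  shows "lsum2 U F (s \<oplus>\<^bsub>tens2 H\<^esub> t) =
    lsum2 U F s \<oplus>\<^bsub>U\<^esub> lsum2 U F t"
proof -
  interpret T: two_vector_spaces H H by unfold_locales
  show ?thesis by (rule T.lsum_tens_add[OF assms])
qed

end

lemma (in complex_algebra) alg_ring: "ring H" and alg_monoid: "monoid H"
  by unfold_locales

text \<open>The module laws restated with the single premise \<open>left_module H X\<close>, which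
  the simplifier can discharge for arbitrarily nested tensor products and conjugates.\<close>

lemma left_module_simps [simp]:
  assumes "left_module H X"
  shows "vector_space_over X"
    and "\<zero>\<^bsub>X\<^esub> \<in> carrier X"
    and "v \<in> carrier X \<Longrightarrow> w \<in> carrier X \<Longrightarrow> v \<oplus>\<^bsub>X\<^esub> w \<in> carrier X"
    and "v \<in> carrier X \<Longrightarrow> c \<odot>\<^bsub>X\<^esub> v \<in> carrier X"
    and "v \<in> carrier X \<Longrightarrow> w \<in> carrier X \<Longrightarrow> c \<odot>\<^bsub>X\<^esub> (v \<oplus>\<^bsub>X\<^esub> w) = c \<odot>\<^bsub>X\<^esub> v \<oplus>\<^bsub>X\<^esub> c \<odot>\<^bsub>X\<^esub> w"
    and "(\<And>x. x \<in> set l \<Longrightarrow> g x \<in> carrier X) \<Longrightarrow> lsum X (map g l) \<in> carrier X"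
proof -
  interpret left_module H X by fact
  show "vector_space_over X" by unfold_locales
  show "\<zero>\<^bsub>X\<^esub> \<in> carrier X"
    "v \<in> carrier X \<Longrightarrow> w \<in> carrier X \<Longrightarrow> v \<oplus>\<^bsub>X\<^esub> w \<in> carrier X"
    "v \<in> carrier X \<Longrightarrow> c \<odot>\<^bsub>X\<^esub> v \<in> carrier X"
    "v \<in> carrier X \<Longrightarrow> w \<in> carrier X \<Longrightarrow> c \<odot>\<^bsub>X\<^esub> (v \<oplus>\<^bsub>X\<^esub> w) = c \<odot>\<^bsub>X\<^esub> v \<oplus>\<^bsub>X\<^esub> c \<odot>\<^bsub>X\<^esub> w"
    "(\<And>x. x \<in> set l \<Longrightarrow> g x \<in> carrier X) \<Longrightarrow> lsum X (map g l) \<in> carrier X"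
    by (auto simp: smult_r_distr intro: M.lsum_map_closed)
qed

lemmas left_module_act [simp] =
  left_module.act_closed left_module.act_add_right left_module.act_smult_right
  left_module.act_add_left left_module.act_smult_left left_module.act_mult left_module.act_one

lemma lsum_smult:
  "left_module H X \<Longrightarrow> (\<And>x. x \<in> set l \<Longrightarrow> g x \<in> carrier X) \<Longrightarrow>
    c \<odot>\<^bsub>X\<^esub> lsum X (map g l) = lsum X (map (\<lambda>x. c \<odot>\<^bsub>X\<^esub> g x) l)"
  by (rule add_map_lsum) (simp_all add: add_map_def)

lemma lsum_act:
  "left_module H X \<Longrightarrow> h \<in> carrier H \<Longrightarrow> (\<And>x. x \<in> set l \<Longrightarrow> g x \<in> carrier X) \<Longrightarrow>
    act X h (lsum X (map g l)) = lsum X (map (\<lambda>x. act X h (g x)) l)"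
  by (rule add_map_lsum) (simp_all add: add_map_def)

lemma left_module_lsum_cong:
  "left_module H X \<Longrightarrow> (\<And>x. x \<in> set l \<Longrightarrow> f x = g x) \<Longrightarrow> lsum X (map f l) = lsum X (map g l)"
  by (metis map_cong)

section \<open>The monoidal structure\<close>

context quasi_hopf_algebra
begin

abbreviation tensor_mod :: "('h, 'a) umod \<Rightarrow> ('h, 'a) umod \<Rightarrow> ('h, 'a) umod" (infixl "**" 70) where
  "X ** Y \<equiv> tens_mod H X Y"

declare alg_closed [simp] alg_one [simp] alg_l_one [simp] alg_r_one [simp]

lemma comul_closed [simp]: "h \<in> carrier H \<Longrightarrow> comul H h \<in> carrier (tens2 H)"
  by (rule ring_hom_closed[OF comul_hom])

lemma tens2_mem:
  "t \<in> carrier (tens2 H) \<Longrightarrow> p \<in> set t \<Longrightarrow> fst p \<in> carrier H"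
  "t \<in> carrier (tens2 H) \<Longrightarrow> p \<in> set t \<Longrightarrow> snd p \<in> carrier H"
  using tens2_wf by fastforce+

lemma comul_mem [simp]:
  "p \<in> set (comul H h) \<Longrightarrow> h \<in> carrier H \<Longrightarrow> fst p \<in> carrier H"
  "p \<in> set (comul H h) \<Longrightarrow> h \<in> carrier H \<Longrightarrow> snd p \<in> carrier H"
  using tens2_mem[OF comul_closed] by simp_all

lemma tens3_mem:
  "t \<in> carrier (tens3 H) \<Longrightarrow> p \<in> set (triples t) \<Longrightarrow> fst p \<in> carrier H"
  "t \<in> carrier (tens3 H) \<Longrightarrow> p \<in> set (triples t) \<Longrightarrow> fst (snd p) \<in> carrier H"
  "t \<in> carrier (tens3 H) \<Longrightarrow> p \<in> set (triples t) \<Longrightarrow> snd (snd p) \<in> carrier H"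
  using triples_wf by fastforce+

lemma two_modules_left [simp]: "left_module H X \<Longrightarrow> left_module H Y \<Longrightarrow> two_modules X Y"
  by (simp add: two_modulesI)

lemma vs_tens_mod [simp]:
  "left_module H X \<Longrightarrow> left_module H Y \<Longrightarrow> vector_space_over (X ** Y)"
  by (simp add: two_modules.module_tens_mod)

lemma pure_closed [simp]:
  "left_module H X \<Longrightarrow> left_module H Y \<Longrightarrow> v \<in> carrier X \<Longrightarrow> w \<in> carrier Y \<Longrightarrow>
    pure X Y v w \<in> carrier (X ** Y)"
  by (rule two_modules.usum_closed) auto

lemma pure_add [simp]:
  assumes "left_module H X" "left_module H Y" "v \<in> carrier X" "w \<in> carrier Y"
  shows "v' \<in> carrier X \<Longrightarrow> pure X Y (v \<oplus>\<^bsub>X\<^esub> v') w = pure X Y v w \<oplus>\<^bsub>X ** Y\<^esub> pure X Y v' w"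
    and "w' \<in> carrier Y \<Longrightarrow> pure X Y v (w \<oplus>\<^bsub>Y\<^esub> w') = pure X Y v w \<oplus>\<^bsub>X ** Y\<^esub> pure X Y v w'"
  using balancedD(2,3)[OF two_modules.balanced_pure_mod[of X Y H]] assms by simp_all

lemma pure_smult [simp]:
  assumes "left_module H X" "left_module H Y" "v \<in> carrier X" "w \<in> carrier Y"
  shows "pure X Y (c \<odot>\<^bsub>X\<^esub> v) w = c \<odot>\<^bsub>X ** Y\<^esub> pure X Y v w"
    and "pure X Y v (c \<odot>\<^bsub>Y\<^esub> w) = c \<odot>\<^bsub>X ** Y\<^esub> pure X Y v w"
  using assms by (simp_all add: two_modules.pure_smult)

lemma pure_lsum:
  assumes "left_module H X" "left_module H Y"
  shows "(\<And>x. x \<in> set l \<Longrightarrow> g x \<in> carrier X) \<Longrightarrow> w \<in> carrier Y \<Longrightarrow>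
      pure X Y (lsum X (map g l)) w = lsum (X ** Y) (map (\<lambda>x. pure X Y (g x) w) l)"
    and "(\<And>x. x \<in> set l \<Longrightarrow> g x \<in> carrier Y) \<Longrightarrow> v \<in> carrier X \<Longrightarrow>
      pure X Y v (lsum Y (map g l)) = lsum (X ** Y) (map (\<lambda>x. pure X Y v (g x)) l)"
proof -
  note bal = two_modules.balanced_pure_mod[OF two_modules_left[OF assms], of H]
  show "(\<And>x. x \<in> set l \<Longrightarrow> g x \<in> carrier X) \<Longrightarrow> w \<in> carrier Y \<Longrightarrow>
      pure X Y (lsum X (map g l)) w = lsum (X ** Y) (map (\<lambda>x. pure X Y (g x) w) l)"
    by (rule add_map_lsum[where f="\<lambda>v. pure X Y v w"]) (use assms bal in \<open>auto simp: balanced_def\<close>)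
  show "(\<And>x. x \<in> set l \<Longrightarrow> g x \<in> carrier Y) \<Longrightarrow> v \<in> carrier X \<Longrightarrow>
      pure X Y v (lsum Y (map g l)) = lsum (X ** Y) (map (\<lambda>x. pure X Y v (g x)) l)"
    by (rule add_map_lsum[where f="\<lambda>w. pure X Y v w"]) (use assms bal in \<open>auto simp: balanced_def\<close>)
qed

lemma tens_mod_smult_add [simp]:
  assumes "left_module H X" "left_module H Y" "s \<in> carrier (X ** Y)" "t \<in> carrier (X ** Y)"
  shows "c \<odot>\<^bsub>X ** Y\<^esub> (s \<oplus>\<^bsub>X ** Y\<^esub> t) =
    c \<odot>\<^bsub>X ** Y\<^esub> s \<oplus>\<^bsub>X ** Y\<^esub> c \<odot>\<^bsub>X ** Y\<^esub> t"
    and "c \<odot>\<^bsub>X ** Y\<^esub> s \<in> carrier (X ** Y)"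
    and "s \<oplus>\<^bsub>X ** Y\<^esub> t \<in> carrier (X ** Y)"
proof -
  interpret module complex_field "X ** Y" using assms by simp
  show "c \<odot>\<^bsub>X ** Y\<^esub> (s \<oplus>\<^bsub>X ** Y\<^esub> t) =
    c \<odot>\<^bsub>X ** Y\<^esub> s \<oplus>\<^bsub>X ** Y\<^esub> c \<odot>\<^bsub>X ** Y\<^esub> t"
    "c \<odot>\<^bsub>X ** Y\<^esub> s \<in> carrier (X ** Y)"
    "s \<oplus>\<^bsub>X ** Y\<^esub> t \<in> carrier (X ** Y)"
    using assms by (simp_all add: smult_r_distr)
qed

section \<open>The action on a tensor product\<close>

lemma balanced_act:
  assumes "left_module H X" "left_module H Y" "a \<in> carrier H" "b \<in> carrier H"
  shows "balanced X Y (X ** Y) (\<lambda>v w. pure X Y (act X a v) (act Y b w))"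
  by (rule balancedI) (use assms in simp_all)

lemma balanced_act_elem:
  assumes "left_module H X" "left_module H Y" "v \<in> carrier X" "w \<in> carrier Y"
  shows "balanced H H (X ** Y) (\<lambda>a b. pure X Y (act X a v) (act Y b w))"
  by (rule balancedI) (use assms in simp_all)

text \<open>The action is defined by a comprehension over the stored representative of
  \<open>t\<close>. As a sum of lifts over the coproduct it is visibly additive in \<open>t\<close>
  and can be computed on pure tensors.\<close>

lemma act_tens:
  assumes X: "left_module H X" and Y: "left_module H Y" and h: "h \<in> carrier H"
    and t: "t \<in> carrier (X ** Y)"
  shows "act (X ** Y) h t = lsum (X ** Y)
    (map (\<lambda>p. lift (X ** Y) (\<lambda>v w. pure X Y (act X (fst p) v) (act Y (snd p) w)) t) (comul H h))"
proof -
  interpret T: two_modules X Y H using X Y by simp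
  interpret M: module complex_field "X ** Y" using X Y by simp
  have t: "set (tens_of t) \<subseteq> carrier X \<times> carrier Y"
    using t by (rule T.tens_of_wf)
  have cl: "act X (fst p) (fst q) \<in> carrier X" "act Y (snd p) (snd q) \<in> carrier Y"
    if "p \<in> set (comul H h)" "q \<in> set (tens_of t)" for p q
  proof -
    have "fst q \<in> carrier X" "snd q \<in> carrier Y"
      using that(2) t by auto
    then show "act X (fst p) (fst q) \<in> carrier X" "act Y (snd p) (snd q) \<in> carrier Y"
      using X Y h that(1) by simp_all
  qed
  let ?l = "concat (map (\<lambda>p. map (\<lambda>q. (act X (fst p) (fst q), act Y (snd p) (snd q))) (tens_of t)) (comul H h))"
  have "act (X ** Y) h t = usum X Y ?l"
    by (simp add: tens_mod_def split_def)
  also have "\<dots> = lsum (X ** Y) (map (\<lambda>x. pure X Y (fst x) (snd x)) ?l)"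
    by (rule T.usum_lsum) (use cl in auto)
  also have "\<dots> = lsum (X ** Y) (map (\<lambda>p. lsum (X ** Y)
      (map (\<lambda>q. pure X Y (act X (fst p) (fst q)) (act Y (snd p) (snd q))) (tens_of t))) (comul H h))"
    unfolding map_concat map_map using X Y cl
    by (subst M.lsum_concat) (auto simp: comp_def)
  finally show ?thesis
    by (simp add: lift_def)
qed

lemma act_pure:
  assumes "left_module H X" "left_module H Y" "h \<in> carrier H" "v \<in> carrier X" "w \<in> carrier Y"
  shows "act (X ** Y) h (pure X Y v w) = lsum (X ** Y)
    (map (\<lambda>p. pure X Y (act X (fst p) v) (act Y (snd p) w)) (comul H h))"
proof -
  interpret T: two_modules X Y H using assms by simp
  interpret M: module complex_field "X ** Y" using assms by simp
  show ?thesis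
    using assms by (simp only: act_tens pure_closed)
      (intro M.lsum_cong T.lift_pure balanced_act; simp)
qed

lemma add_map_act_tens:
  assumes X: "left_module H X" and Y: "left_module H Y" and h: "h \<in> carrier H"
  shows "add_map (X ** Y) (X ** Y) (act (X ** Y) h)"
proof -
  interpret T: two_modules X Y H using X Y by simp
  have "add_map (X ** Y) (X ** Y) (\<lambda>t. lsum (X ** Y)
    (map (\<lambda>p. lift (X ** Y) (\<lambda>v w. pure X Y (act X (fst p) v) (act Y (snd p) w)) t) (comul H h)))"
    using X Y h by (intro add_map_lsum_pointwise T.add_map_lift_mod balanced_act) simp_all
  then show ?thesis
    using X Y h by (simp add: add_map_def act_tens)
qed

text \<open>On pure tensors each module law is a property of \<Delta>, evaluated under the map that
  sends a and b to the tensor of a x and b y: \<Delta> preserves the unit, sums, scalar multiples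
  and products.\<close>

lemma left_module_tens [simp]:
  assumes X: "left_module H X" and Y: "left_module H Y"
  shows "left_module H (X ** Y)"
proof -
  let ?T = "X ** Y"
  interpret T: two_modules X Y H using X Y by simp
  interpret M: module complex_field ?T using X Y by simp
  note ext = T.add_map_ext[OF M.abelian_group_axioms]
  note act = add_map_act_tens[OF X Y]
  note pure = act_pure[OF X Y]
  have smult: "add_map ?T ?T (\<lambda>v. c \<odot>\<^bsub>?T\<^esub> v)" for c
    using X Y by (simp add: add_map_def)
  have add: "add_map ?T ?T (\<lambda>v. f v \<oplus>\<^bsub>?T\<^esub> g v)" if "add_map ?T ?T f" "add_map ?T ?T g" for f g
    using that by (auto simp: add_map_def M.add.m_ac)
  have comp: "add_map ?T ?T (\<lambda>v. f (g v))" if "add_map ?T ?T f" "add_map ?T ?T g" for f g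
    using that by (auto simp: add_map_def)
  have lsum: "f (lsum ?T (map g l)) = lsum ?T (map (\<lambda>x. f (g x)) l)"
    if "add_map ?T ?T f" "\<And>x. x \<in> set l \<Longrightarrow> g x \<in> carrier ?T" for f g and l :: "('h \<times> 'h) list"
    using that M.abelian_group_axioms M.abelian_monoid_axioms by (intro add_map_lsum)
  show ?thesis
  proof (intro left_module.intro left_module_axioms.intro M.module_axioms)
    fix v
    assume v: "v \<in> carrier ?T"
    show "act ?T \<one> v = v"
    proof (rule ext[OF act _ _ v])
      show "add_map ?T ?T (\<lambda>v. v)" by (simp add: add_map_def)
      fix x y
      assume x: "x \<in> carrier X" and y: "y \<in> carrier Y"
      show "act ?T \<one> (pure X Y x y) = pure X Y x y"
        using pure[OF alg_one x y] ring_hom_one[OF comul_hom]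
          tens2_one_eval[OF M.abelian_group_axioms balanced_act_elem[OF X Y x y]] X Y x y by simp
    qed simp
  next
    fix h k c v
    assume h: "h \<in> carrier H" and v: "v \<in> carrier ?T"
    show "act ?T h v \<in> carrier ?T"
      using act[OF h] v by (simp add: add_map_def)
    show "act ?T h (c \<odot>\<^bsub>?T\<^esub> v) = c \<odot>\<^bsub>?T\<^esub> act ?T h v"
    proof (rule ext[OF comp[OF act[OF h] smult] comp[OF smult act[OF h]] _ v])
      fix x y
      assume x: "x \<in> carrier X" and y: "y \<in> carrier Y"
      \<comment> \<open>The scalar is absorbed by the first vector, where it commutes with the
        action of each first leg of the coproduct.\<close>
      have "act ?T h (c \<odot>\<^bsub>?T\<^esub> pure X Y x y) = act ?T h (pure X Y (c \<odot>\<^bsub>X\<^esub> x) y)"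
        using X Y x y by simp
      also have "\<dots> = lsum ?T (map (\<lambda>p. c \<odot>\<^bsub>?T\<^esub> pure X Y (act X (fst p) x) (act Y (snd p) y)) (comul H h))"
        using X Y x y h by (simp only: pure left_module_simps) (intro M.lsum_cong; simp)
      also have "\<dots> = c \<odot>\<^bsub>?T\<^esub> act ?T h (pure X Y x y)"
        using X Y x y h pure by (subst lsum[OF smult, symmetric]) simp_all
      finally show "act ?T h (c \<odot>\<^bsub>?T\<^esub> pure X Y x y) = c \<odot>\<^bsub>?T\<^esub> act ?T h (pure X Y x y)" .
    qed
    show "act ?T (c \<odot> h) v = c \<odot>\<^bsub>?T\<^esub> act ?T h v"
    proof (rule ext[OF act comp[OF smult act[OF h]] _ v])
      show ch: "c \<odot> h \<in> carrier H"
        using h vs_H by (simp add: module.smult_closed)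
      fix x y
      assume x: "x \<in> carrier X" and y: "y \<in> carrier Y"
      have "act ?T (c \<odot> h) (pure X Y x y) =
          lsum ?T (map (\<lambda>p. pure X Y (act X (fst p) x) (act Y (snd p) y)) (c \<odot>\<^bsub>tens2 H\<^esub> comul H h))"
        using pure[OF ch x y] comul_smult[OF h] by simp
      also have "\<dots> = lsum ?T (map (\<lambda>p. pure X Y (act X (c \<odot> fst p) x) (act Y (snd p) y)) (comul H h))"
        by (rule tens2_smult_eval[OF M.abelian_group_axioms balanced_act_elem[OF X Y x y] comul_closed[OF h]])
      also have "\<dots> = lsum ?T (map (\<lambda>p. c \<odot>\<^bsub>?T\<^esub> pure X Y (act X (fst p) x) (act Y (snd p) y)) (comul H h))"
        using X Y x y h by (intro M.lsum_cong) simp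
      also have "\<dots> = c \<odot>\<^bsub>?T\<^esub> act ?T h (pure X Y x y)"
        using X Y x y h pure by (subst lsum[OF smult, symmetric]) simp_all
      finally show "act ?T (c \<odot> h) (pure X Y x y) = c \<odot>\<^bsub>?T\<^esub> act ?T h (pure X Y x y)" .
    qed
    assume k: "k \<in> carrier H"
    show "act ?T (h \<oplus> k) v = act ?T h v \<oplus>\<^bsub>?T\<^esub> act ?T k v"
    proof (rule ext[OF act add[OF act[OF h] act[OF k]] _ v])
      show hk: "h \<oplus> k \<in> carrier H"
        using h k alg_ring by (simp add: ring.ring_simprules)
      fix x y
      assume x: "x \<in> carrier X" and y: "y \<in> carrier Y"
      show "act ?T (h \<oplus> k) (pure X Y x y) = act ?T h (pure X Y x y) \<oplus>\<^bsub>?T\<^esub> act ?T k (pure X Y x y)"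
        using pure[OF hk x y] pure[OF h x y] pure[OF k x y] ring_hom_add[OF comul_hom h k]
          tens2_add_eval[OF M.abelian_group_axioms balanced_act_elem[OF X Y x y] comul_closed[OF h] comul_closed[OF k]]
        by simp
    qed
    show "act ?T (h \<otimes> k) v = act ?T h (act ?T k v)"
    proof (rule ext[OF act comp[OF act[OF h] act[OF k]] _ v])
      show hk: "h \<otimes> k \<in> carrier H"
        using h k by simp
      fix x y
      assume x: "x \<in> carrier X" and y: "y \<in> carrier Y"
      have "act ?T (h \<otimes> k) (pure X Y x y) = lsum ?T (map (\<lambda>p. lsum ?T (map (\<lambda>q.
          pure X Y (act X (fst p \<otimes> fst q) x) (act Y (snd p \<otimes> snd q) y)) (comul H k))) (comul H h))"
        using pure[OF hk x y] ring_hom_mult[OF comul_hom h k]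
          tens2_mult_eval[OF M.abelian_group_axioms balanced_act_elem[OF X Y x y] comul_closed[OF h] comul_closed[OF k]]
        by simp
      also have "\<dots> = lsum ?T (map (\<lambda>p. lsum ?T (map (\<lambda>q.
          pure X Y (act X (fst p) (act X (fst q) x)) (act Y (snd p) (act Y (snd q) y))) (comul H k))) (comul H h))"
        using X Y x y h k by (intro M.lsum_cong) simp
      \<comment> \<open>The product h k has the legs of h as outer sum, but k acts first; the
        exchange puts the sum that belongs to k outside.\<close>
      also have "\<dots> = lsum ?T (map (\<lambda>q. lsum ?T (map (\<lambda>p.
          pure X Y (act X (fst p) (act X (fst q) x)) (act Y (snd p) (act Y (snd q) y))) (comul H h))) (comul H k))"
        using X Y x y h k by (intro M.lsum_swap) simp
      also have "\<dots> = lsum ?T (map (\<lambda>q. act ?T h (pure X Y (act X (fst q) x) (act Y (snd q) y))) (comul H k))"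
        using X Y x y h k by (intro M.lsum_cong) (simp add: pure)
      also have "\<dots> = act ?T h (act ?T k (pure X Y x y))"
        using X Y x y k pure by (subst lsum[OF act[OF h], symmetric]) simp_all
      finally show "act ?T (h \<otimes> k) (pure X Y x y) = act ?T h (act ?T k (pure X Y x y))" .
    qed
    fix w
    assume "w \<in> carrier ?T"
    then show "act ?T h (v \<oplus>\<^bsub>?T\<^esub> w) = act ?T h v \<oplus>\<^bsub>?T\<^esub> act ?T h w"
      using act[OF h] v by (simp add: add_map_def)
  qed
qed

end

section \<open>Sums over products in the third and fourth tensor power\<close>

context complex_algebra
begin

lemma prod3_wf: "wf3 l \<Longrightarrow> wf3 m \<Longrightarrow> wf3 (prod3 l m)"
  unfolding prod3_def by (auto intro!: alg_closed dest!: subsetD)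

lemma prod4_wf: "wf4 l \<Longrightarrow> wf4 m \<Longrightarrow> wf4 (prod4 l m)"
  unfolding prod4_def by (auto intro!: alg_closed dest!: subsetD)

text \<open>The right factor acts first on modules, so its sum is the outer one.\<close>

lemma lsum_prod3:
  assumes "abelian_group U" "wf3 l" "wf3 m"
    and "\<And>x. fst x \<in> carrier H \<Longrightarrow> fst (snd x) \<in> carrier H \<Longrightarrow> snd (snd x) \<in> carrier H \<Longrightarrow> f x \<in> carrier U"
  shows "lsum U (map f (prod3 l m)) = lsum U (map (\<lambda>y. lsum U (map (\<lambda>x.
      f (fst x \<otimes> fst y, fst (snd x) \<otimes> fst (snd y), snd (snd x) \<otimes> snd (snd y))) l)) m)"
proof -
  interpret U: abelian_group U by fact
  have cl: "f (fst x \<otimes> fst y, fst (snd x) \<otimes> fst (snd y), snd (snd x) \<otimes> snd (snd y)) \<in> carrier U"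
    if "x \<in> set l" "y \<in> set m" for x y
  proof -
    have "x \<in> carrier H \<times> carrier H \<times> carrier H" "y \<in> carrier H \<times> carrier H \<times> carrier H"
      using that assms(2,3) by auto
    then show ?thesis
      by (intro assms(4)) (simp_all add: mem_Times_iff alg_closed)
  qed
  have "lsum U (map f (prod3 l m)) = lsum U (map (\<lambda>x. lsum U (map (\<lambda>y.
      f (fst x \<otimes> fst y, fst (snd x) \<otimes> fst (snd y), snd (snd x) \<otimes> snd (snd y))) m)) l)"
    unfolding prod3_def map_concat map_map comp_def by (rule U.lsum_concat2) (rule cl)
  also have "\<dots> = lsum U (map (\<lambda>y. lsum U (map (\<lambda>x.
      f (fst x \<otimes> fst y, fst (snd x) \<otimes> fst (snd y), snd (snd x) \<otimes> snd (snd y))) l)) m)"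
    by (rule U.lsum_swap) (rule cl)
  finally show ?thesis .
qed

lemma lsum_prod4:
  assumes "abelian_group U" "wf4 l" "wf4 m"
    and "\<And>x. fst x \<in> carrier H \<Longrightarrow> fst (snd x) \<in> carrier H \<Longrightarrow> fst (snd (snd x)) \<in> carrier H \<Longrightarrow>
      snd (snd (snd x)) \<in> carrier H \<Longrightarrow> f x \<in> carrier U"
  shows "lsum U (map f (prod4 l m)) = lsum U (map (\<lambda>y. lsum U (map (\<lambda>x.
      f (fst x \<otimes> fst y, fst (snd x) \<otimes> fst (snd y), fst (snd (snd x)) \<otimes> fst (snd (snd y)),
        snd (snd (snd x)) \<otimes> snd (snd (snd y)))) l)) m)"
proof -
  interpret U: abelian_group U by fact
  have cl: "f (fst x \<otimes> fst y, fst (snd x) \<otimes> fst (snd y), fst (snd (snd x)) \<otimes> fst (snd (snd y)), snd (snd (snd x)) \<otimes> snd (snd (snd y))) \<in> carrier U"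
    if "x \<in> set l" "y \<in> set m" for x y
  proof -
    have "x \<in> carrier H \<times> carrier H \<times> carrier H \<times> carrier H" "y \<in> carrier H \<times> carrier H \<times> carrier H \<times> carrier H"
      using that assms(2,3) by auto
    then show ?thesis
      by (intro assms(4)) (simp_all add: mem_Times_iff alg_closed)
  qed
  have "lsum U (map f (prod4 l m)) = lsum U (map (\<lambda>x. lsum U (map (\<lambda>y.
      f (fst x \<otimes> fst y, fst (snd x) \<otimes> fst (snd y), fst (snd (snd x)) \<otimes> fst (snd (snd y)),
        snd (snd (snd x)) \<otimes> snd (snd (snd y)))) m)) l)"
    unfolding prod4_def map_concat map_map comp_def by (rule U.lsum_concat2) (rule cl)
  also have "\<dots> = lsum U (map (\<lambda>y. lsum U (map (\<lambda>x.
      f (fst x \<otimes> fst y, fst (snd x) \<otimes> fst (snd y), fst (snd (snd x)) \<otimes> fst (snd (snd y)),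
        snd (snd (snd x)) \<otimes> snd (snd (snd y)))) l)) m)"
    by (rule U.lsum_swap) (rule cl)
  finally show ?thesis .
qed

end

section \<open>Isomorphisms in a category\<close>

lemma (in category) inverse_arrows_sym: "inverse_arrows C X Y f g \<Longrightarrow> inverse_arrows C Y X g f"
  by (simp add: inverse_arrows_def)

lemma (in category) iso_arrow_comp:
  assumes o: "X \<in> Ob C" "Y \<in> Ob C" "Z \<in> Ob C" and f: "iso_arrow C X Y f" and g: "iso_arrow C Y Z g"
  shows "iso_arrow C X Z (g \<cdot> f)"
proof -
  obtain f' where f': "f \<in> Hom C X Y" "f' \<in> Hom C Y X" "f' \<cdot> f = Idn C X" "f \<cdot> f' = Idn C Y"
    using f by (auto simp: iso_arrow_def inverse_arrows_def)
  obtain g' where g': "g \<in> Hom C Y Z" "g' \<in> Hom C Z Y" "g' \<cdot> g = Idn C Y" "g \<cdot> g' = Idn C Z"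
    using g by (auto simp: iso_arrow_def inverse_arrows_def)
  have gf: "g \<cdot> f \<in> Hom C X Z" and fg: "f' \<cdot> g' \<in> Hom C Z X"
    using Comp_in_Hom[OF o(1,2,3) f'(1) g'(1)] Comp_in_Hom[OF o(3,2,1) g'(2) f'(2)] by simp_all
  have "(f' \<cdot> g') \<cdot> (g \<cdot> f) = f' \<cdot> (g' \<cdot> (g \<cdot> f))"
    by (rule Comp_assoc[OF o(1,3,2,1) gf g'(2) f'(2)])
  also have "g' \<cdot> (g \<cdot> f) = f"
    using Comp_assoc[OF o(1,2,3,2) f'(1) g'(1,2)] Idn_left[OF o(1,2) f'(1)] g'(3) by simp
  finally have 1: "(f' \<cdot> g') \<cdot> (g \<cdot> f) = Idn C X"
    using f'(3) by simp
  have "(g \<cdot> f) \<cdot> (f' \<cdot> g') = g \<cdot> (f \<cdot> (f' \<cdot> g'))"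
    by (rule Comp_assoc[OF o(3,1,2,3) fg f'(1) g'(1)])
  also have "f \<cdot> (f' \<cdot> g') = g'"
    using Comp_assoc[OF o(3,2,1,2) g'(2) f'(2,1)] Idn_left[OF o(3,2) g'(2)] f'(4) by simp
  finally have "(g \<cdot> f) \<cdot> (f' \<cdot> g') = Idn C Z"
    using g'(4) by simp
  with 1 gf fg show ?thesis
    by (auto simp: iso_arrow_def inverse_arrows_def)
qed

section \<open>Module maps\<close>

lemma module_mapsD:
  assumes "f \<in> module_maps H X Y"
  shows "v \<in> carrier X \<Longrightarrow> f v \<in> carrier Y"
    and "v \<in> carrier X \<Longrightarrow> w \<in> carrier X \<Longrightarrow> f (v \<oplus>\<^bsub>X\<^esub> w) = f v \<oplus>\<^bsub>Y\<^esub> f w"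
    and "v \<in> carrier X \<Longrightarrow> f (c \<odot>\<^bsub>X\<^esub> v) = c \<odot>\<^bsub>Y\<^esub> f v"
    and "h \<in> carrier H \<Longrightarrow> v \<in> carrier X \<Longrightarrow> f (act X h v) = act Y h (f v)"
    and "v \<notin> carrier X \<Longrightarrow> f v = undefined"
  using assms by (auto simp: module_maps_def PiE_def extensional_def)

lemma module_maps_restrictI:
  assumes "\<And>v. v \<in> carrier X \<Longrightarrow> f v \<in> carrier Y"
    and "\<And>v w. v \<in> carrier X \<Longrightarrow> w \<in> carrier X \<Longrightarrow> f (v \<oplus>\<^bsub>X\<^esub> w) = f v \<oplus>\<^bsub>Y\<^esub> f w"
    and "\<And>c v. v \<in> carrier X \<Longrightarrow> f (c \<odot>\<^bsub>X\<^esub> v) = c \<odot>\<^bsub>Y\<^esub> f v"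
    and "\<And>h v. h \<in> carrier H \<Longrightarrow> v \<in> carrier X \<Longrightarrow> f (act X h v) = act Y h (f v)"
    and "left_module H X"
  shows "restrict f (carrier X) \<in> module_maps H X Y"
  using assms by (auto simp: module_maps_def)

section \<open>Conjugate modules\<close>

lemma bar_mod_simps [simp]:
  "carrier (bar_mod H X) = carrier X" "zero (bar_mod H X) = zero X" "add (bar_mod H X) = add X"
  "smult (bar_mod H X) c = smult X (cnj c)" "act (bar_mod H X) h = act X (starT H h)"
  "lsum (bar_mod H X) = lsum X"
  by (simp_all add: bar_mod_def lsum_def fun_eq_iff)

lemma add_map_bar [simp]:
  "add_map (bar_mod H X) U = add_map X U" "add_map V (bar_mod H X) = add_map V X"
  by (simp_all add: add_map_def fun_eq_iff)

lemma abelian_group_bar [simp]: "abelian_group X \<Longrightarrow> abelian_group (bar_mod H X)"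
  using abelian_groupE[of X] by (intro abelian_groupI) auto

context star_quasi_hopf_algebra
begin

abbreviation bar :: "('h, 'a) umod \<Rightarrow> ('h, 'a) umod" where
  "bar \<equiv> bar_mod H"

lemma starT_simps [simp]:
  "h \<in> carrier H \<Longrightarrow> starT H h \<in> carrier H"
  "h \<in> carrier H \<Longrightarrow> k \<in> carrier H \<Longrightarrow> starT H (h \<oplus> k) = starT H h \<oplus> starT H k"
  "h \<in> carrier H \<Longrightarrow> k \<in> carrier H \<Longrightarrow> starT H (h \<otimes> k) = starT H h \<otimes> starT H k"
  "starT H \<one> = \<one>"
  "h \<in> carrier H \<Longrightarrow> starT H (c \<odot> h) = cnj c \<odot> starT H h"
  using ring_hom_memE[OF starT_hom] by (auto simp: starT_smult)

text \<open>\<open>T\<close> is multiplicative, not anti-multiplicative, so the twisted action is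
  again a left action. Its conjugate-linearity is compensated by the conjugated scalars of the
  conjugate module.\<close>

lemma left_module_bar [simp]: "left_module H X \<Longrightarrow> left_module H (bar X)"
proof -
  assume X: "left_module H X"
  interpret left_module H X by fact
  note M = smult_l_distr[simplified] smult_r_distr[simplified] smult_assoc1[simplified] smult_one[simplified]
  show ?thesis
    by (intro left_module.intro moduleI cring_complex_field left_module_axioms.intro abelian_group_bar
        M.abelian_group_axioms) (use X in \<open>simp_all add: M\<close>)
qed

text \<open>The simplifier rewrites the operations of \<open>bar X\<close> to those of
  \<open>X\<close>, after which the general rules for pure tensors no longer match. This lemma and
  the next two are their forms after that rewriting; the conjugated scalars come from the conjugate
  factor.\<close>

lemma pure_bar_add [simp]:
  assumes "left_module H X" "left_module H Y" "v \<in> carrier X" "w \<in> carrier Y"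
  shows "v' \<in> carrier X \<Longrightarrow> pure (bar X) Y (v \<oplus>\<^bsub>X\<^esub> v') w =
      pure (bar X) Y v w \<oplus>\<^bsub>(bar X) ** Y\<^esub> pure (bar X) Y v' w"
    and "w' \<in> carrier Y \<Longrightarrow> pure X (bar Y) v (w \<oplus>\<^bsub>Y\<^esub> w') =
      pure X (bar Y) v w \<oplus>\<^bsub>X ** (bar Y)\<^esub> pure X (bar Y) v w'"
  using pure_add(1)[of "bar X" Y v w v'] pure_add(2)[of X "bar Y" v w w'] assms by simp_all

lemma pure_bar_smult [simp]:
  assumes "left_module H X" "left_module H Y" "v \<in> carrier X" "w \<in> carrier Y"
  shows "pure (bar X) Y (c \<odot>\<^bsub>X\<^esub> v) w = cnj c \<odot>\<^bsub>(bar X) ** Y\<^esub> pure (bar X) Y v w"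
    and "pure X (bar Y) v (c \<odot>\<^bsub>Y\<^esub> w) = cnj c \<odot>\<^bsub>X ** (bar Y)\<^esub> pure X (bar Y) v w"
  using pure_smult(1)[of "bar X" Y v w "cnj c"] pure_smult(2)[of X "bar Y" v w "cnj c"] assms
  by simp_all

lemma pure_bar_lsum:
  assumes "left_module H X" "left_module H Y"
  shows "(\<And>x. x \<in> set l \<Longrightarrow> g x \<in> carrier X) \<Longrightarrow> w \<in> carrier Y \<Longrightarrow>
      pure (bar X) Y (lsum X (map g l)) w =
      lsum ((bar X) ** Y) (map (\<lambda>x. pure (bar X) Y (g x) w) l)"
    and "(\<And>x. x \<in> set l \<Longrightarrow> g x \<in> carrier Y) \<Longrightarrow> v \<in> carrier X \<Longrightarrow>
      pure X (bar Y) v (lsum Y (map g l)) =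
      lsum (X ** (bar Y)) (map (\<lambda>x. pure X (bar Y) v (g x)) l)"
  using pure_lsum(1)[of "bar X" Y l g w] pure_lsum(2)[of X "bar Y" l g v] assms by simp_all

section \<open>The unit module\<close>

lemma unit_mod_simps [simp]:
  "carrier (unit_mod H) = range Scal" "zero (unit_mod H) = Scal 0"
  "add (unit_mod H) x y = Scal (scal_of x + scal_of y)"
  "smult (unit_mod H) c x = Scal (c * scal_of x)" "act (unit_mod H) h x = Scal (counit H h * scal_of x)"
  by (simp_all add: unit_mod_def)

lemma counit_simps [simp]:
  "h \<in> carrier H \<Longrightarrow> k \<in> carrier H \<Longrightarrow> counit H (h \<oplus> k) = counit H h + counit H k"
  "h \<in> carrier H \<Longrightarrow> k \<in> carrier H \<Longrightarrow> counit H (h \<otimes> k) = counit H h * counit H k"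
  "counit H \<one> = 1"
  "h \<in> carrier H \<Longrightarrow> counit H (c \<odot> h) = c * counit H h"
  using ring_hom_memE[OF counit_hom] by (auto simp: counit_smult)

lemma left_module_unit [simp]: "left_module H (unit_mod H)"
proof (intro left_module.intro moduleI cring_complex_field left_module_axioms.intro abelian_groupI)
  fix x :: "'a univ"
  assume x: "x \<in> carrier (unit_mod H)"
  then have "Scal (- scal_of x) \<in> carrier (unit_mod H)"
    "Scal (- scal_of x) \<oplus>\<^bsub>unit_mod H\<^esub> x = \<zero>\<^bsub>unit_mod H\<^esub>"
    by auto
  then show "\<exists>y\<in>carrier (unit_mod H). y \<oplus>\<^bsub>unit_mod H\<^esub> x = \<zero>\<^bsub>unit_mod H\<^esub>" ..
qed (auto simp: algebra_simps)

section \<open>The category of modules\<close>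

definition id_arrow where "id_arrow X = Arrow X (\<lambda>v\<in>carrier X. v) X"

definition comp_arrow where
  "comp_arrow g f = Arrow (src f) (compose (carrier (src f)) (map_of_arrow g) (map_of_arrow f)) (trg g)"

definition bar_arrow where
  "bar_arrow f = Arrow (bar (src f)) (map_of_arrow f) (bar (trg f))"

definition lunit_arrow where
  "lunit_arrow X = Arrow X (\<lambda>v\<in>carrier X. pure X (unit_mod H) v (Scal 1)) (X ** (unit_mod H))"

definition runit_arrow where
  "runit_arrow X = Arrow X (\<lambda>v\<in>carrier X. pure (unit_mod H) X (Scal 1) v) ((unit_mod H) ** X)"

definition bb_arrow where
  "bb_arrow X = Arrow X (\<lambda>x\<in>carrier X. act X (gam H) x) (bar (bar X))"

definition star_arrow :: "('h, 'a) marrow" where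
  "star_arrow = Arrow (unit_mod H) (\<lambda>z\<in>carrier (unit_mod H :: ('h, 'a) umod). Scal (cnj (scal_of z)))
    (bar (unit_mod H))"

definition ups_arrow where
  "ups_arrow X Y = Arrow (bar (X ** Y))
     (\<lambda>t\<in>carrier (bar (X ** Y)).
        usum (bar Y) (bar X) [(act Y b y, act X a x). (a, b) \<leftarrow> gauge H, (x, y) \<leftarrow> tens_of t])
     ((bar Y) ** (bar X))"

definition mor :: "('h, 'a) umod \<Rightarrow> ('h, 'a) umod \<Rightarrow> ('h, 'a) marrow set" where
  "mor X Y = {Arrow X f Y | f. f \<in> module_maps H X Y}"

text \<open>From here on the record \<open>HMod H\<close> is never unfolded: all statements about
  the category turn into statements about the named arrows above.\<close>

lemma HMod_simps [simp]:
  "Ob (HMod H) = {X. left_module H X}" "Hom (HMod H) = mor" "Idn (HMod H) = id_arrow"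
  "Comp (HMod H) = comp_arrow" "TensO (HMod H) = tens_mod H" "TensM (HMod H) = tens_arrow H"
  "Unit (HMod H) = unit_mod H" "Assoc (HMod H) = assoc_arrow H" "LUnit (HMod H) = lunit_arrow"
  "RUnit (HMod H) = runit_arrow" "BarO (HMod H) = bar" "BarM (HMod H) = bar_arrow"
  "BB (HMod H) = bb_arrow" "Star (HMod H) = star_arrow" "Ups (HMod H) = ups_arrow"
  unfolding HMod_def cat.select_convs monoidal_cat.select_convs bar_cat.select_convs fun_eq_iff
    mor_def id_arrow_def comp_arrow_def bar_arrow_def lunit_arrow_def runit_arrow_def bb_arrow_def
    star_arrow_def ups_arrow_def
  by (simp_all only: refl simp_thms)

lemma mor_iff: "A \<in> mor X Y \<longleftrightarrow> src A = X \<and> trg A = Y \<and> map_of_arrow A \<in> module_maps H X Y"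
  by (cases A) (auto simp: mor_def)

lemma mor_src: "A \<in> mor X Y \<Longrightarrow> src A = X" and mor_trg: "A \<in> mor X Y \<Longrightarrow> trg A = Y"
  by (simp_all add: mor_iff)

lemma mor_map:
  assumes "A \<in> mor X Y"
  shows "v \<in> carrier X \<Longrightarrow> map_of_arrow A v \<in> carrier Y"
    and "v \<in> carrier X \<Longrightarrow> w \<in> carrier X \<Longrightarrow>
      map_of_arrow A (v \<oplus>\<^bsub>X\<^esub> w) = map_of_arrow A v \<oplus>\<^bsub>Y\<^esub> map_of_arrow A w"
    and "v \<in> carrier X \<Longrightarrow> map_of_arrow A (c \<odot>\<^bsub>X\<^esub> v) = c \<odot>\<^bsub>Y\<^esub> map_of_arrow A v"
    and "h \<in> carrier H \<Longrightarrow> v \<in> carrier X \<Longrightarrow> map_of_arrow A (act X h v) = act Y h (map_of_arrow A v)"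
    and "v \<notin> carrier X \<Longrightarrow> map_of_arrow A v = undefined"
proof -
  have "map_of_arrow A \<in> module_maps H X Y"
    using assms by (simp add: mor_iff)
  note * = module_mapsD[OF this]
  show "v \<in> carrier X \<Longrightarrow> map_of_arrow A v \<in> carrier Y"
    "v \<in> carrier X \<Longrightarrow> w \<in> carrier X \<Longrightarrow>
      map_of_arrow A (v \<oplus>\<^bsub>X\<^esub> w) = map_of_arrow A v \<oplus>\<^bsub>Y\<^esub> map_of_arrow A w"
    "v \<in> carrier X \<Longrightarrow> map_of_arrow A (c \<odot>\<^bsub>X\<^esub> v) = c \<odot>\<^bsub>Y\<^esub> map_of_arrow A v"
    "h \<in> carrier H \<Longrightarrow> v \<in> carrier X \<Longrightarrow> map_of_arrow A (act X h v) = act Y h (map_of_arrow A v)"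
    "v \<notin> carrier X \<Longrightarrow> map_of_arrow A v = undefined"
    by (fact *)+
qed

lemma mor_add_map: "A \<in> mor X Y \<Longrightarrow> add_map X Y (map_of_arrow A)"
  unfolding add_map_def by (blast intro: mor_map)

lemma mor_lsum:
  "A \<in> mor X Y \<Longrightarrow> left_module H X \<Longrightarrow> left_module H Y \<Longrightarrow>
    (\<And>x. x \<in> set l \<Longrightarrow> g x \<in> carrier X) \<Longrightarrow>
    map_of_arrow A (lsum X (map g l)) = lsum Y (map (\<lambda>x. map_of_arrow A (g x)) l)"
  by (rule add_map_lsum[OF _ _ mor_add_map]) simp_all

text \<open>Off the source both maps are \<open>undefined\<close>, so agreement on the carrier is
  equality of arrows.\<close>

lemma mor_eqI:
  assumes "A \<in> mor X Y" "B \<in> mor X Y" "\<And>x. x \<in> carrier X \<Longrightarrow> map_of_arrow A x = map_of_arrow B x"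
  shows "A = B"
proof -
  have "map_of_arrow A = map_of_arrow B"
  proof
    fix x
    show "map_of_arrow A x = map_of_arrow B x"
      using assms(3) mor_map(5)[OF assms(1)] mor_map(5)[OF assms(2)] by (cases "x \<in> carrier X") simp_all
  qed
  moreover have "src A = src B" "trg A = trg B"
    using assms(1,2) by (simp_all add: mor_iff)
  ultimately show ?thesis
    by (intro marrow.expand conjI)
qed

lemma mor_restrictI:
  assumes "\<And>v. v \<in> carrier X \<Longrightarrow> f v \<in> carrier Y"
    and "\<And>v w. v \<in> carrier X \<Longrightarrow> w \<in> carrier X \<Longrightarrow> f (v \<oplus>\<^bsub>X\<^esub> w) = f v \<oplus>\<^bsub>Y\<^esub> f w"
    and "\<And>c v. v \<in> carrier X \<Longrightarrow> f (c \<odot>\<^bsub>X\<^esub> v) = c \<odot>\<^bsub>Y\<^esub> f v"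
    and "\<And>h v. h \<in> carrier H \<Longrightarrow> v \<in> carrier X \<Longrightarrow> f (act X h v) = act Y h (f v)"
    and "left_module H X"
  shows "Arrow X (restrict f (carrier X)) Y \<in> mor X Y"
  using module_maps_restrictI[OF assms] by (simp add: mor_iff)

lemma id_mor [simp]: "left_module H X \<Longrightarrow> id_arrow X \<in> mor X X"
  unfolding id_arrow_def by (rule mor_restrictI) simp_all

lemma comp_mor:
  assumes "left_module H X" "A \<in> mor X Y" "B \<in> mor Y Z"
  shows "comp_arrow B A \<in> mor X Z"
proof -
  have "Arrow X (restrict (\<lambda>x. map_of_arrow B (map_of_arrow A x)) (carrier X)) Z \<in> mor X Z"
    using assms(1) mor_map[OF assms(2)] mor_map[OF assms(3)] by (intro mor_restrictI) simp_all
  then show ?thesis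
    using mor_src[OF assms(2)] mor_trg[OF assms(3)] by (simp add: comp_arrow_def compose_def)
qed

lemma id_map [simp]: "x \<in> carrier X \<Longrightarrow> map_of_arrow (id_arrow X) x = x"
  by (simp add: id_arrow_def)

lemma comp_map: "A \<in> mor X Y \<Longrightarrow> x \<in> carrier X \<Longrightarrow>
    map_of_arrow (comp_arrow B A) x = map_of_arrow B (map_of_arrow A x)"
  by (simp add: comp_arrow_def compose_def mor_src)

lemma category_HMod: "category (HMod H)"
proof (rule category.intro)
  fix W X Y Z f g h
  assume o: "W \<in> Ob (HMod H)" "X \<in> Ob (HMod H)" "Y \<in> Ob (HMod H)" "Z \<in> Ob (HMod H)"
    and m: "f \<in> Hom (HMod H) W X" "g \<in> Hom (HMod H) X Y" "h \<in> Hom (HMod H) Y Z"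
  have "comp_arrow (comp_arrow h g) f = comp_arrow h (comp_arrow g f)"
  proof (rule mor_eqI[of _ W Z])
    show "comp_arrow (comp_arrow h g) f \<in> mor W Z" "comp_arrow h (comp_arrow g f) \<in> mor W Z"
      using o m by (auto intro: comp_mor)
  qed (use o m in \<open>simp_all add: comp_map[of _ W X] comp_map[of _ X Y] comp_map[OF comp_mor, of W f X g Y] mor_map(1)[of _ W X]\<close>)
  then show "h \<cdot>\<^bsub>HMod H\<^esub> g \<cdot>\<^bsub>HMod H\<^esub> f = h \<cdot>\<^bsub>HMod H\<^esub> (g \<cdot>\<^bsub>HMod H\<^esub> f)"
    by simp
next
  fix X Y f
  assume o: "X \<in> Ob (HMod H)" "Y \<in> Ob (HMod H)" and m: "f \<in> Hom (HMod H) X Y"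
  have "comp_arrow (id_arrow Y) f = f" "comp_arrow f (id_arrow X) = f"
    by (rule mor_eqI[of _ X Y]; use o m in \<open>simp add: comp_mor[of X _ Y] comp_mor[of X _ X] comp_map[of _ X Y] comp_map[of _ X X] mor_map(1)[of _ X Y]\<close>)+
  then show "Idn (HMod H) Y \<cdot>\<^bsub>HMod H\<^esub> f = f" "f \<cdot>\<^bsub>HMod H\<^esub> Idn (HMod H) X = f"
    by simp_all
qed (simp_all add: comp_mor)

section \<open>Conjugation of arrows and criteria for isomorphisms\<close>

lemma bar_map [simp]: "map_of_arrow (bar_arrow A) = map_of_arrow A"
  by (simp add: bar_arrow_def)

lemma bar_mor [simp]: "left_module H X \<Longrightarrow> A \<in> mor X Y \<Longrightarrow> bar_arrow A \<in> mor (bar X) (bar Y)"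
  by (auto simp: mor_iff bar_arrow_def module_maps_def)

text \<open>Linearity and equivariance of \<open>g\<close> follow from those of \<open>A\<close> by
  applying the bijection \<open>A\<close>. Hence only the two cancellation laws have to be verified
  for the candidates built from the inverse of \<phi> or of the gauge.\<close>

lemma mor_inverse:
  assumes X: "left_module H X" and Y: "left_module H Y" and A: "A \<in> mor X Y"
    and g: "\<And>y. y \<in> carrier Y \<Longrightarrow> g y \<in> carrier X" "\<And>y. y \<in> carrier Y \<Longrightarrow> map_of_arrow A (g y) = y"
      "\<And>x. x \<in> carrier X \<Longrightarrow> g (map_of_arrow A x) = x"
  shows "inverse_arrows (HMod H) X Y A (Arrow Y (restrict g (carrier Y)) X)"
proof -
  have *: "g y = x" if "x \<in> carrier X" "map_of_arrow A x = y" for x y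
    using that g(3) by auto
  have B: "Arrow Y (restrict g (carrier Y)) X \<in> mor Y X"
    by (rule mor_restrictI) (use X Y g(1,2) mor_map[OF A] in \<open>auto intro!: *\<close>)
  then show ?thesis
    using X Y A g comp_mor[OF X A B] comp_mor[OF Y B A]
      mor_eqI[OF comp_mor[OF X A B] id_mor[OF X]] mor_eqI[OF comp_mor[OF Y B A] id_mor[OF Y]]
    by (simp add: inverse_arrows_def comp_map[OF A] comp_map[OF B] mor_map(1)[OF A])
qed

lemma mor_isoI:
  assumes "left_module H X" "left_module H Y" "A \<in> mor X Y"
    and "\<And>y. y \<in> carrier Y \<Longrightarrow> g y \<in> carrier X" "\<And>y. y \<in> carrier Y \<Longrightarrow> map_of_arrow A (g y) = y"
      "\<And>x. x \<in> carrier X \<Longrightarrow> g (map_of_arrow A x) = x"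
  shows "iso_arrow (HMod H) X Y A"
  using mor_inverse[OF assms] by (auto simp: iso_arrow_def)

section \<open>Extensionality on pure tensors\<close>

lemma tens_ext2:
  assumes X: "left_module H X" and Y: "left_module H Y" and U: "abelian_group U"
    and f: "add_map (X ** Y) U f" and g: "add_map (X ** Y) U g"
    and eq: "\<And>x y. x \<in> carrier X \<Longrightarrow> y \<in> carrier Y \<Longrightarrow> f (pure X Y x y) = g (pure X Y x y)"
    and t: "t \<in> carrier (X ** Y)"
  shows "f t = g t"
  by (rule two_modules.add_map_ext[OF two_modules_left[OF X Y] U f g eq t])

lemma add_map_pure:
  assumes "left_module H X" "left_module H Y"
  shows "y \<in> carrier Y \<Longrightarrow> add_map X (X ** Y) (\<lambda>x. pure X Y x y)"
    and "x \<in> carrier X \<Longrightarrow> add_map Y (X ** Y) (\<lambda>y. pure X Y x y)"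
  using assms by (simp_all add: add_map_def)

text \<open>For a fixed last vector both maps are additive in the element of \<open>X ** Y\<close>,
  so the twofold principle is applied twice.\<close>

lemma tens_ext3:
  assumes X: "left_module H X" and Y: "left_module H Y" and Z: "left_module H Z" and U: "abelian_group U"
    and f: "add_map ((X ** Y) ** Z) U f" and g: "add_map ((X ** Y) ** Z) U g"
    and eq: "\<And>x y z. x \<in> carrier X \<Longrightarrow> y \<in> carrier Y \<Longrightarrow> z \<in> carrier Z \<Longrightarrow>
      f (pure (X ** Y) Z (pure X Y x y) z) = g (pure (X ** Y) Z (pure X Y x y) z)"
    and t: "t \<in> carrier ((X ** Y) ** Z)"
  shows "f t = g t"
proof (rule tens_ext2[OF left_module_tens[OF X Y] Z U f g _ t])
  fix s z
  assume s: "s \<in> carrier (X ** Y)" and z: "z \<in> carrier Z"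
  note p = add_map_pure(1)[OF left_module_tens[OF X Y] Z z]
  show "f (pure (X ** Y) Z s z) = g (pure (X ** Y) Z s z)"
    by (rule tens_ext2[OF X Y U add_map_comp[OF p f] add_map_comp[OF p g] eq s]) (use z in simp_all)
qed

text \<open>The version for sources bracketed to the right, used where the inverse associator acts
  first.\<close>

lemma tens_ext3_right:
  assumes X: "left_module H X" and Y: "left_module H Y" and Z: "left_module H Z" and U: "abelian_group U"
    and f: "add_map (X ** (Y ** Z)) U f" and g: "add_map (X ** (Y ** Z)) U g"
    and eq: "\<And>x y z. x \<in> carrier X \<Longrightarrow> y \<in> carrier Y \<Longrightarrow> z \<in> carrier Z \<Longrightarrow>
      f (pure X (Y ** Z) x (pure Y Z y z)) = g (pure X (Y ** Z) x (pure Y Z y z))"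
    and t: "t \<in> carrier (X ** (Y ** Z))"
  shows "f t = g t"
proof (rule tens_ext2[OF X left_module_tens[OF Y Z] U f g _ t])
  fix x s
  assume x: "x \<in> carrier X" and s: "s \<in> carrier (Y ** Z)"
  note p = add_map_pure(2)[OF X left_module_tens[OF Y Z] x]
  show "f (pure X (Y ** Z) x s) = g (pure X (Y ** Z) x s)"
    by (rule tens_ext2[OF Y Z U add_map_comp[OF p f] add_map_comp[OF p g] eq s]) (use x in simp_all)
qed

lemma tens_ext4:
  assumes W: "left_module H W" and X: "left_module H X" and Y: "left_module H Y" and Z: "left_module H Z"
    and U: "abelian_group U"
    and f: "add_map (((W ** X) ** Y) ** Z) U f"
    and g: "add_map (((W ** X) ** Y) ** Z) U g"
    and eq: "\<And>w x y z. w \<in> carrier W \<Longrightarrow> x \<in> carrier X \<Longrightarrow> y \<in> carrier Y \<Longrightarrow> z \<in> carrier Z \<Longrightarrow>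
      f (pure ((W ** X) ** Y) Z (pure (W ** X) Y (pure W X w x) y) z) =
      g (pure ((W ** X) ** Y) Z (pure (W ** X) Y (pure W X w x) y) z)"
    and t: "t \<in> carrier (((W ** X) ** Y) ** Z)"
  shows "f t = g t"
proof (rule tens_ext2[OF left_module_tens[OF left_module_tens[OF W X] Y] Z U f g _ t])
  fix s z
  assume s: "s \<in> carrier ((W ** X) ** Y)" and z: "z \<in> carrier Z"
  note p = add_map_pure(1)[OF left_module_tens[OF left_module_tens[OF W X] Y] Z z]
  show "f (pure ((W ** X) ** Y) Z s z) = g (pure ((W ** X) ** Y) Z s z)"
    by (rule tens_ext3[OF W X Y U add_map_comp[OF p f] add_map_comp[OF p g] eq s]) (use z in simp_all)
qed

text \<open>The source may be a tensor product or the conjugate of one: both have the same elements.\<close>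

lemma mor_ext2:
  assumes "left_module H X" "left_module H Y" "left_module H U" "A \<in> mor P U" "B \<in> mor P U"
    and P: "P = X ** Y \<or> P = bar (X ** Y)"
    and "\<And>x y. x \<in> carrier X \<Longrightarrow> y \<in> carrier Y \<Longrightarrow>
      map_of_arrow A (pure X Y x y) = map_of_arrow B (pure X Y x y)"
  shows "A = B"
proof -
  have "add_map (X ** Y) U (map_of_arrow A)" "add_map (X ** Y) U (map_of_arrow B)"
    using P mor_add_map[OF assms(4)] mor_add_map[OF assms(5)] by auto
  from tens_ext2[OF assms(1,2) _ this assms(7)] show ?thesis
    using P assms(3) by (auto intro!: mor_eqI[OF assms(4,5)])
qed

lemma mor_ext3:
  assumes "left_module H X" "left_module H Y" "left_module H Z" "left_module H U" "A \<in> mor P U" "B \<in> mor P U"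
    and P: "P = (X ** Y) ** Z \<or> P = bar ((X ** Y) ** Z)"
    and "\<And>x y z. x \<in> carrier X \<Longrightarrow> y \<in> carrier Y \<Longrightarrow> z \<in> carrier Z \<Longrightarrow>
      map_of_arrow A (pure (X ** Y) Z (pure X Y x y) z) =
      map_of_arrow B (pure (X ** Y) Z (pure X Y x y) z)"
  shows "A = B"
proof -
  have "add_map ((X ** Y) ** Z) U (map_of_arrow A)"
    "add_map ((X ** Y) ** Z) U (map_of_arrow B)"
    using P mor_add_map[OF assms(5)] mor_add_map[OF assms(6)] by auto
  from tens_ext3[OF assms(1-3) _ this assms(8)] show ?thesis
    using P assms(4) by (auto intro!: mor_eqI[OF assms(5,6)])
qed

lemma mor_ext4:
  assumes "left_module H W" "left_module H X" "left_module H Y" "left_module H Z" "left_module H U"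
    and A: "A \<in> mor (((W ** X) ** Y) ** Z) U"
    and B: "B \<in> mor (((W ** X) ** Y) ** Z) U"
    and "\<And>w x y z. w \<in> carrier W \<Longrightarrow> x \<in> carrier X \<Longrightarrow> y \<in> carrier Y \<Longrightarrow> z \<in> carrier Z \<Longrightarrow>
      map_of_arrow A (pure ((W ** X) ** Y) Z (pure (W ** X) Y (pure W X w x) y) z) =
      map_of_arrow B (pure ((W ** X) ** Y) Z (pure (W ** X) Y (pure W X w x) y) z)"
  shows "A = B"
  using tens_ext4[OF assms(1-4) _ mor_add_map[OF A] mor_add_map[OF B] assms(8)] assms(5)
  by (auto intro!: mor_eqI[OF A B])

lemma arrow_ends [simp]:
  "src (id_arrow X) = X" "trg (id_arrow X) = X"
  "src (comp_arrow B A) = src A" "trg (comp_arrow B A) = trg B"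
  "src (bar_arrow A) = bar (src A)" "trg (bar_arrow A) = bar (trg A)"
  "src (lunit_arrow X) = X" "trg (lunit_arrow X) = X ** (unit_mod H)"
  "src (runit_arrow X) = X" "trg (runit_arrow X) = (unit_mod H) ** X"
  "src (bb_arrow X) = X" "trg (bb_arrow X) = bar (bar X)"
  "src star_arrow = unit_mod H" "trg star_arrow = bar (unit_mod H)"
  "src (ups_arrow X Y) = bar (X ** Y)"
  "trg (ups_arrow X Y) = (bar Y) ** (bar X)"
  "src (assoc_arrow H X Y Z) = (X ** Y) ** Z"
  "trg (assoc_arrow H X Y Z) = X ** (Y ** Z)"
  "src (tens_arrow H A B) = (src A) ** (src B)"
  "trg (tens_arrow H A B) = (trg A) ** (trg B)"
  by (simp_all only: id_arrow_def comp_arrow_def bar_arrow_def lunit_arrow_def runit_arrow_def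
    bb_arrow_def star_arrow_def ups_arrow_def assoc_arrow_def tens_arrow_def marrow.sel)

text \<open>The source is read off the arrow itself, so nested composites are unfolded by rewriting
  alone, with no intermediate object to be guessed. \<open>mor_lsum_trg\<close> does the same for
  targets.\<close>

lemma comp_map_src: "x \<in> carrier (src A) \<Longrightarrow>
    map_of_arrow (comp_arrow B A) x = map_of_arrow B (map_of_arrow A x)"
  by (simp add: comp_arrow_def compose_def)

lemma mor_lsum_trg:
  "A \<in> mor X (trg A) \<Longrightarrow> left_module H X \<Longrightarrow> left_module H (trg A) \<Longrightarrow>
    (\<And>x. x \<in> set l \<Longrightarrow> g x \<in> carrier X) \<Longrightarrow>
    map_of_arrow A (lsum X (map g l)) = lsum (trg A) (map (\<lambda>x. map_of_arrow A (g x)) l)"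
  by (rule mor_lsum)

text \<open>Sums in \<open>bar X\<close> are rewritten to sums in \<open>X\<close>, so an arrow
  whose source is a conjugate module meets a sum that is labelled by \<open>X\<close>.\<close>

lemma mor_lsum_trg_bar:
  "A \<in> mor (bar X) (trg A) \<Longrightarrow> left_module H X \<Longrightarrow> left_module H (trg A) \<Longrightarrow>
    (\<And>x. x \<in> set l \<Longrightarrow> g x \<in> carrier X) \<Longrightarrow>
    map_of_arrow A (lsum X (map g l)) = lsum (trg A) (map (\<lambda>x. map_of_arrow A (g x)) l)"
  using mor_lsum[of A "bar X" "trg A" l g] by simp

section \<open>The tensor product of morphisms\<close>

lemma tens_arrow_lift:
  assumes X: "left_module H X" and Y: "left_module H Y" and X': "left_module H X'" and Y': "left_module H Y'"
    and A: "A \<in> mor X X'" and B: "B \<in> mor Y Y'"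
  shows "balanced X Y (X' ** Y') (\<lambda>v w. pure X' Y' (map_of_arrow A v) (map_of_arrow B w))"
    and "t \<in> carrier (X ** Y) \<Longrightarrow> map_of_arrow (tens_arrow H A B) t =
      lift (X' ** Y') (\<lambda>v w. pure X' Y' (map_of_arrow A v) (map_of_arrow B w)) t"
proof -
  show "balanced X Y (X' ** Y') (\<lambda>v w. pure X' Y' (map_of_arrow A v) (map_of_arrow B w))"
    by (rule balancedI) (use assms mor_map[OF A] mor_map[OF B] in simp_all)
  assume t: "t \<in> carrier (X ** Y)"
  interpret T: two_modules X Y H using X Y by simp
  interpret T': two_modules X' Y' H using X' Y' by simp
  have "set [(map_of_arrow A v, map_of_arrow B w). (v, w) \<leftarrow> tens_of t] \<subseteq> carrier X' \<times> carrier Y'"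
    using T.tens_of_wf[OF t] mor_map(1)[OF A] mor_map(1)[OF B] by auto
  from T'.usum_lsum[OF this] show "map_of_arrow (tens_arrow H A B) t =
      lift (X' ** Y') (\<lambda>v w. pure X' Y' (map_of_arrow A v) (map_of_arrow B w)) t"
    using t mor_src[OF A] mor_src[OF B] mor_trg[OF A] mor_trg[OF B]
    by (simp add: tens_arrow_def lift_def comp_def split_def)
qed

lemma tens_arrow_pure:
  assumes X: "left_module H X" and Y: "left_module H Y" and X': "left_module H X'" and Y': "left_module H Y'"
    and A: "A \<in> mor X X'" and B: "B \<in> mor Y Y'" and "x \<in> carrier X" "y \<in> carrier Y"
  shows "map_of_arrow (tens_arrow H A B) (pure X Y x y) = pure X' Y' (map_of_arrow A x) (map_of_arrow B y)"
  using assms tens_arrow_lift[OF assms(1-6)]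
  by (simp add: two_modules.lift_pure[where U="X' ** Y'"])

text \<open>Additivity is inherited from the lift. Homogeneity and equivariance are then equalities
  of additive maps, tested on pure tensors; there \<open>A\<close> commutes with the first legs and
  \<open>B\<close> with the second legs of the coproduct.\<close>

lemma tens_arrow_mor:
  assumes X: "left_module H X" and Y: "left_module H Y" and X': "left_module H X'" and Y': "left_module H Y'"
    and A: "A \<in> mor X X'" and B: "B \<in> mor Y Y'"
  shows "tens_arrow H A B \<in> mor (X ** Y) (X' ** Y')"
proof -
  let ?f = "map_of_arrow (tens_arrow H A B)"
  note A' = mor_map[OF A] and B' = mor_map[OF B]
  have vs: "abelian_group (X' ** Y')" using X' Y' by simp
  have add: "add_map (X ** Y) (X' ** Y') ?f"
    using two_modules.add_map_lift_mod[OF two_modules_left[OF X Y] vs tens_arrow_lift(1)[OF assms], of H]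
      tens_arrow_lift(2)[OF assms] X Y by (simp add: add_map_def)
  note pure = tens_arrow_pure[OF assms]
  have "Arrow (X ** Y) (restrict ?f (carrier (X ** Y))) (X' ** Y')
      \<in> mor (X ** Y) (X' ** Y')"
  proof (rule mor_restrictI)
    fix c t
    assume t: "t \<in> carrier (X ** Y)"
    show "?f t \<in> carrier (X' ** Y')"
      using add t by (simp add: add_map_def)
    have sm: "add_map (P ** Q) (P ** Q) (\<lambda>t. c \<odot>\<^bsub>P ** Q\<^esub> t)"
      if "left_module H P" "left_module H Q" for P Q :: "('h, 'a) umod"
      using that by (simp add: add_map_def)
    show "?f (c \<odot>\<^bsub>X ** Y\<^esub> t) = c \<odot>\<^bsub>X' ** Y'\<^esub> ?f t"
    proof (rule tens_ext2[OF X Y vs add_map_comp[OF sm add] add_map_comp[OF add sm] _ t])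
      fix x y
      assume "x \<in> carrier X" "y \<in> carrier Y"
      then show "?f (c \<odot>\<^bsub>X ** Y\<^esub> pure X Y x y) = c \<odot>\<^bsub>X' ** Y'\<^esub> ?f (pure X Y x y)"
        using assms A' B' pure[of "c \<odot>\<^bsub>X\<^esub> x" y] by (simp add: pure)
    qed (use assms in simp_all)
  next
    fix h t
    assume h: "h \<in> carrier H" and t: "t \<in> carrier (X ** Y)"
    have ac: "add_map (P ** Q) (P ** Q) (act (P ** Q) h)"
      if "left_module H P" "left_module H Q" for P Q :: "('h, 'a) umod"
      using that h by (rule add_map_act_tens)
    show "?f (act (X ** Y) h t) = act (X' ** Y') h (?f t)"
    proof (rule tens_ext2[OF X Y vs add_map_comp[OF ac add] add_map_comp[OF add ac] _ t])
      fix x y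
      assume xy: "x \<in> carrier X" "y \<in> carrier Y"
      have "?f (act (X ** Y) h (pure X Y x y)) =
          lsum (X' ** Y') (map (\<lambda>p. ?f (pure X Y (act X (fst p) x) (act Y (snd p) y))) (comul H h))"
        using assms xy h by (simp add: act_pure) (rule add_map_lsum[OF _ _ add]; simp)
      then show "?f (act (X ** Y) h (pure X Y x y)) = act (X' ** Y') h (?f (pure X Y x y))"
        using assms xy h A' B' by (simp add: act_pure pure cong: map_cong)
    qed (use assms in simp_all)
  qed (use add X Y in \<open>simp_all add: add_map_def\<close>)
  moreover have "restrict ?f (carrier (X ** Y)) = ?f"
    using mor_src[OF A] mor_src[OF B] by (simp add: tens_arrow_def)
  ultimately show ?thesis
    using mor_src[OF A] mor_src[OF B] mor_trg[OF A] mor_trg[OF B] by (simp add: mor_iff)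
qed

lemma tens_arrow_pure_trg:
  assumes "left_module H X" "left_module H Y" "left_module H (trg A)" "left_module H (trg B)"
    and "A \<in> mor X (trg A)" "B \<in> mor Y (trg B)" "x \<in> carrier X" "y \<in> carrier Y"
  shows "map_of_arrow (tens_arrow H A B) (pure X Y x y) =
    pure (trg A) (trg B) (map_of_arrow A x) (map_of_arrow B y)"
  by (rule tens_arrow_pure[OF assms])

lemma tens_id:
  assumes "left_module H X" "left_module H Y"
  shows "tens_arrow H (id_arrow X) (id_arrow Y) = id_arrow (X ** Y)"
  by (rule mor_ext2[OF assms left_module_tens[OF assms], where P="X ** Y"])
    (use assms in \<open>simp_all add: tens_arrow_mor tens_arrow_pure\<close>)

lemma tens_comp:
  assumes "left_module H X" "left_module H X'" "left_module H X''" "left_module H Y" "left_module H Y'" "left_module H Y''"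
    and f: "f \<in> mor X X'" "f' \<in> mor X' X''" and g: "g \<in> mor Y Y'" "g' \<in> mor Y' Y''"
  shows "tens_arrow H (comp_arrow f' f) (comp_arrow g' g) = comp_arrow (tens_arrow H f' g') (tens_arrow H f g)"
proof (rule mor_ext2)
  show "tens_arrow H (comp_arrow f' f) (comp_arrow g' g) \<in> mor (X ** Y) (X'' ** Y'')"
    "comp_arrow (tens_arrow H f' g') (tens_arrow H f g) \<in> mor (X ** Y) (X'' ** Y'')"
    using assms by (auto intro!: comp_mor tens_arrow_mor)
  fix x y
  assume "x \<in> carrier X" "y \<in> carrier Y"
  then show "map_of_arrow (tens_arrow H (comp_arrow f' f) (comp_arrow g' g)) (pure X Y x y) =
      map_of_arrow (comp_arrow (tens_arrow H f' g') (tens_arrow H f g)) (pure X Y x y)"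
    using assms mor_map(1)[OF f(1)] mor_map(1)[OF g(1)]
    by (simp add: comp_map_src mor_src[OF f(1)] mor_src[OF g(1)] tens_arrow_pure[of X Y X' Y']
        tens_arrow_pure[of X' Y' X'' Y''] tens_arrow_pure[OF _ _ _ _ comp_mor comp_mor, of X Y X'' Y'' f X' f' g Y' g'])
qed (use assms in simp_all)

section \<open>The associator\<close>

lemma tens3_monoid: "monoid (tens3 H)" and tens2_monoid: "monoid (tens2 H)"
  using complex_algebra.alg_monoid[OF complex_algebra_tens3] complex_algebra.alg_monoid[OF complex_algebra_tens2]
  by simp_all

lemma reassoc_closed: "reassoc H \<in> carrier (tens3 H)"
  and reassoc_inv_closed: "inv\<^bsub>tens3 H\<^esub> (reassoc H) \<in> carrier (tens3 H)"
  using monoid.Units_closed[OF tens3_monoid reassoc_unit] monoid.Units_inv_closed[OF tens3_monoid reassoc_unit]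
  by simp_all

lemmas reassoc_mem [simp] = tens3_mem[OF reassoc_closed] tens3_mem[OF reassoc_inv_closed]

text \<open>Invertibility of \<phi> as an identity between flat lists, the form in which
  \<open>trilinear_eval\<close> can use it.\<close>

lemma reassoc_inv:
  "tsum3 H (prod3 (triples (reassoc H)) (triples (inv\<^bsub>tens3 H\<^esub> (reassoc H)))) = tsum3 H [(\<one>, \<one>, \<one>)]"
  "tsum3 H (prod3 (triples (inv\<^bsub>tens3 H\<^esub> (reassoc H))) (triples (reassoc H))) = tsum3 H [(\<one>, \<one>, \<one>)]"
  using monoid.Units_r_inv[OF tens3_monoid reassoc_unit] monoid.Units_l_inv[OF tens3_monoid reassoc_unit]
    tsum3_prod[OF triples_wf[OF reassoc_closed] triples_wf[OF reassoc_inv_closed]]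
    tsum3_prod[OF triples_wf[OF reassoc_inv_closed] triples_wf[OF reassoc_closed]]
    reassoc_closed reassoc_inv_closed
  by (simp_all add: tsum3_triples tens3_one)

text \<open>The same expression is used in two roles. As a function of the vectors it is lifted to
  define the associator and its inverse; as a function of the algebra elements it evaluates
  identities for \<phi>. Each role occurs with both bracketings of the target.\<close>

lemma trilinear_act:
  assumes "left_module H X" "left_module H Y" "left_module H Z"
  shows "a \<in> carrier H \<Longrightarrow> b \<in> carrier H \<Longrightarrow> c \<in> carrier H \<Longrightarrow>
      trilinear X Y Z (X ** (Y ** Z))
        (\<lambda>x y z. pure X (Y ** Z) (act X a x) (pure Y Z (act Y b y) (act Z c z)))"
    and "a \<in> carrier H \<Longrightarrow> b \<in> carrier H \<Longrightarrow> c \<in> carrier H \<Longrightarrow>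
      trilinear X Y Z ((X ** Y) ** Z)
        (\<lambda>x y z. pure (X ** Y) Z (pure X Y (act X a x) (act Y b y)) (act Z c z))"
    and "x \<in> carrier X \<Longrightarrow> y \<in> carrier Y \<Longrightarrow> z \<in> carrier Z \<Longrightarrow>
      trilinear H H H (X ** (Y ** Z))
        (\<lambda>a b c. pure X (Y ** Z) (act X a x) (pure Y Z (act Y b y) (act Z c z)))"
    and "x \<in> carrier X \<Longrightarrow> y \<in> carrier Y \<Longrightarrow> z \<in> carrier Z \<Longrightarrow>
      trilinear H H H ((X ** Y) ** Z)
        (\<lambda>a b c. pure (X ** Y) Z (pure X Y (act X a x) (act Y b y)) (act Z c z))"
  unfolding trilinear_def by (intro conjI ballI balancedI; use assms in simp)+

lemma lift_left_balanced:
  assumes X: "left_module H X" and Y: "left_module H Y" and Z: "left_module H Z" and U: "abelian_group U"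
    and F: "trilinear X Y Z U F"
  shows "balanced (X ** Y) Z U (\<lambda>s z. lift U (\<lambda>x y. F x y z) s)"
  using balanced_lift_left[OF _ _ _ U F] X Y Z
  by (auto simp: balanced_def add_map_def lift_def tens_mod_def)

lemma lift_right_balanced:
  assumes X: "left_module H X" and Y: "left_module H Y" and Z: "left_module H Z" and U: "abelian_group U"
    and F: "trilinear X Y Z U F"
  shows "balanced X (Y ** Z) U (\<lambda>x s. lift U (F x) s)"
  using balanced_lift[OF _ _ _ U F] X Y Z
  by (auto simp: balanced_def add_map_def lift_def tens_mod_def)

lemma lift_left_pure:
  assumes X: "left_module H X" and Y: "left_module H Y" and Z: "left_module H Z" and U: "abelian_group U"
    and F: "trilinear X Y Z U F" and "x \<in> carrier X" "y \<in> carrier Y" "z \<in> carrier Z"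
  shows "lift U (\<lambda>s z. lift U (\<lambda>x y. F x y z) s) (pure (X ** Y) Z (pure X Y x y) z) = F x y z"
proof -
  have "lift U (\<lambda>s z. lift U (\<lambda>x y. F x y z) s) (pure (X ** Y) Z (pure X Y x y) z) =
      lift U (\<lambda>x y. F x y z) (pure X Y x y)"
    by (rule two_modules.lift_pure[OF _ U lift_left_balanced[OF assms(1-5)]]) (use assms in simp_all)
  also have "\<dots> = F x y z"
    by (rule two_modules.lift_pure[OF _ U]) (use assms in \<open>simp_all add: trilinear_def\<close>)
  finally show ?thesis .
qed

lemma lift_right_pure:
  assumes X: "left_module H X" and Y: "left_module H Y" and Z: "left_module H Z" and U: "abelian_group U"
    and F: "trilinear X Y Z U F" and "x \<in> carrier X" "y \<in> carrier Y" "z \<in> carrier Z"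
  shows "lift U (\<lambda>x s. lift U (F x) s) (pure X (Y ** Z) x (pure Y Z y z)) = F x y z"
proof -
  have "lift U (\<lambda>x s. lift U (F x) s) (pure X (Y ** Z) x (pure Y Z y z)) =
      lift U (F x) (pure Y Z y z)"
    by (rule two_modules.lift_pure[OF _ U lift_right_balanced[OF assms(1-5)]]) (use assms in simp_all)
  also have "\<dots> = F x y z"
    by (rule two_modules.lift_pure[OF _ U]) (use assms in \<open>simp_all add: trilinear_def\<close>)
  finally show ?thesis .
qed

text \<open>\<open>assoc_arrow\<close> unpacks representatives on two levels. Rewritten as a sum
  over \<phi> of iterated lifts, its value no longer depends on those choices.\<close>

lemma assoc_map:
  assumes X: "left_module H X" and Y: "left_module H Y" and Z: "left_module H Z"
    and t: "t \<in> carrier ((X ** Y) ** Z)"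
  shows "map_of_arrow (assoc_arrow H X Y Z) t = lsum (X ** (Y ** Z)) (map (\<lambda>p.
    lift (X ** (Y ** Z)) (\<lambda>s w. lift (X ** (Y ** Z)) (\<lambda>u v.
      pure X (Y ** Z) (act X (fst p) u) (pure Y Z (act Y (fst (snd p)) v) (act Z (snd (snd p)) w))) s) t)
    (triples (reassoc H)))"
proof -
  let ?U = "X ** (Y ** Z)"
  interpret T: two_modules "X ** Y" Z H using X Y Z by simp
  interpret TXY: two_modules X Y H using X Y by simp
  interpret TU: two_modules X "Y ** Z" H using X Y Z by simp
  interpret M: module complex_field ?U using X Y Z by simp
  have q: "fst q \<in> carrier (X ** Y)" "snd q \<in> carrier Z" if "q \<in> set (tens_of t)" for q
    using T.tens_of_wf[OF t] that by auto
  have r: "fst r \<in> carrier X" "snd r \<in> carrier Y" if "q \<in> set (tens_of t)" "r \<in> set (tens_of (fst q))" for q r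
    using TXY.tens_of_wf[OF q(1)[OF that(1)]] that(2) by auto
  let ?f = "\<lambda>p q r. (act X (fst p) (fst r), pure Y Z (act Y (fst (snd p)) (snd r)) (act Z (snd (snd p)) (snd q)))"
  let ?l = "concat (map (\<lambda>p. concat (map (\<lambda>q. map (?f p q) (tens_of (fst q))) (tens_of t))) (triples (reassoc H)))"
  have cl: "fst (?f p q r) \<in> carrier X" "snd (?f p q r) \<in> carrier (Y ** Z)"
    if "p \<in> set (triples (reassoc H))" "q \<in> set (tens_of t)" "r \<in> set (tens_of (fst q))" for p q r
    using X Y Z q[OF that(2)] r[OF that(2,3)] that(1) by simp_all
  have "map_of_arrow (assoc_arrow H X Y Z) t = usum X (Y ** Z) ?l"
    using t by (simp add: assoc_arrow_def split_def)
  also have "\<dots> = lsum ?U (map (\<lambda>x. pure X (Y ** Z) (fst x) (snd x)) ?l)"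
    by (rule TU.usum_lsum, rule set_concat3_subset) (simp only: mem_Times_iff cl)
  also have "\<dots> = lsum ?U (map (\<lambda>p. lsum ?U (map (\<lambda>q. lsum ?U (map (\<lambda>r.
      pure X (Y ** Z) (fst (?f p q r)) (snd (?f p q r))) (tens_of (fst q)))) (tens_of t)))
      (triples (reassoc H)))"
    unfolding map_concat map_map comp_def
    by (rule M.lsum_concat3) (rule pure_closed[OF X left_module_tens[OF Y Z] cl])
  finally show ?thesis
    by (simp add: lift_def)
qed

lemma assoc_pure:
  assumes X: "left_module H X" and Y: "left_module H Y" and Z: "left_module H Z"
    and xyz: "x \<in> carrier X" "y \<in> carrier Y" "z \<in> carrier Z"
  shows "map_of_arrow (assoc_arrow H X Y Z) (pure (X ** Y) Z (pure X Y x y) z) =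
    lsum (X ** (Y ** Z)) (map (\<lambda>p. pure X (Y ** Z) (act X (fst p) x)
      (pure Y Z (act Y (fst (snd p)) y) (act Z (snd (snd p)) z))) (triples (reassoc H)))"
proof -
  have U: "left_module H (X ** (Y ** Z))" "abelian_group (X ** (Y ** Z))"
    using X Y Z by simp_all
  show ?thesis
    by (subst assoc_map[OF X Y Z], use X Y Z xyz in simp, rule left_module_lsum_cong[OF U(1)],
        rule lift_left_pure[OF X Y Z U(2) trilinear_act(1)[OF X Y Z]])
      (use xyz in simp_all)
qed

lemma assoc_add_map:
  assumes X: "left_module H X" and Y: "left_module H Y" and Z: "left_module H Z"
  shows "add_map ((X ** Y) ** Z) (X ** (Y ** Z)) (map_of_arrow (assoc_arrow H X Y Z))"
proof -
  let ?U = "X ** (Y ** Z)"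
  have U: "abelian_group ?U" using X Y Z by simp
  have "add_map ((X ** Y) ** Z) ?U (\<lambda>t. lsum ?U (map (\<lambda>p.
    lift ?U (\<lambda>s w. lift ?U (\<lambda>u v.
      pure X (Y ** Z) (act X (fst p) u) (pure Y Z (act Y (fst (snd p)) v) (act Z (snd (snd p)) w))) s) t)
    (triples (reassoc H))))"
    using X Y Z by (intro add_map_lsum_pointwise U two_modules.add_map_lift_mod lift_left_balanced trilinear_act) simp_all
  then show ?thesis
    using X Y Z by (simp add: add_map_def assoc_map)
qed

text \<open>The candidate for the inverse associator: the inverse of \<phi> acts, and the brackets
  are moved back. It is a plain function, which \<open>mor_isoI\<close> makes into an arrow.\<close>

definition assoc_inv where
  "assoc_inv X Y Z t = lsum ((X ** Y) ** Z) (map (\<lambda>p.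
    lift ((X ** Y) ** Z) (\<lambda>u s. lift ((X ** Y) ** Z) (\<lambda>v w.
      pure (X ** Y) Z (pure X Y (act X (fst p) u) (act Y (fst (snd p)) v)) (act Z (snd (snd p)) w)) s) t)
    (triples (inv\<^bsub>tens3 H\<^esub> (reassoc H))))"

lemma assoc_inv_pure:
  assumes X: "left_module H X" and Y: "left_module H Y" and Z: "left_module H Z"
    and xyz: "x \<in> carrier X" "y \<in> carrier Y" "z \<in> carrier Z"
  shows "assoc_inv X Y Z (pure X (Y ** Z) x (pure Y Z y z)) =
    lsum ((X ** Y) ** Z) (map (\<lambda>p. pure (X ** Y) Z
      (pure X Y (act X (fst p) x) (act Y (fst (snd p)) y)) (act Z (snd (snd p)) z))
      (triples (inv\<^bsub>tens3 H\<^esub> (reassoc H))))"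
proof -
  have U: "left_module H ((X ** Y) ** Z)" "abelian_group ((X ** Y) ** Z)"
    using X Y Z by simp_all
  show ?thesis
    unfolding assoc_inv_def
    by (rule left_module_lsum_cong[OF U(1)], rule lift_right_pure[OF X Y Z U(2) trilinear_act(2)[OF X Y Z]])
      (use xyz in simp_all)
qed

lemma assoc_inv_add_map:
  assumes X: "left_module H X" and Y: "left_module H Y" and Z: "left_module H Z"
  shows "add_map (X ** (Y ** Z)) ((X ** Y) ** Z) (assoc_inv X Y Z)"
  unfolding assoc_inv_def
  using X Y Z by (intro add_map_lsum_pointwise two_modules.add_map_lift_mod lift_right_balanced trilinear_act) simp_all

text \<open>Quasi-coassociativity multiplied by \<phi> from the right. Without the inverse, its two
  sides are exactly what acting after and before the associator produces on pure tensors.\<close>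

lemma quasi_coassoc_prod:
  assumes h: "h \<in> carrier H"
  shows "tsum3 H (prod3 [(a, b, c). (a, d) \<leftarrow> comul H h, (b, c) \<leftarrow> comul H d] (triples (reassoc H))) =
    tsum3 H (prod3 (triples (reassoc H)) [(a, b, c). (d, c) \<leftarrow> comul H h, (a, b) \<leftarrow> comul H d])"
proof -
  let ?A = "[(a, b, c). (a, d) \<leftarrow> comul H h, (b, c) \<leftarrow> comul H d]"
  let ?B = "[(a, b, c). (d, c) \<leftarrow> comul H h, (a, b) \<leftarrow> comul H d]"
  have wf: "wf3 ?A" "wf3 ?B"
    unfolding split_def by (rule set_concat2_subset; use h in \<open>simp add: mem_Times_iff\<close>)+
  have cl: "tsum3 H ?A \<in> carrier (tens3 H)" "tsum3 H ?B \<in> carrier (tens3 H)"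
    using wf by (simp_all only: tsum3_closed)
  interpret M: monoid "tens3 H" by (rule tens3_monoid)
  have "tsum3 H ?A \<otimes>\<^bsub>tens3 H\<^esub> reassoc H = reassoc H \<otimes>\<^bsub>tens3 H\<^esub> tsum3 H ?B"
    unfolding quasi_coassoc[OF h] using cl reassoc_closed reassoc_inv_closed reassoc_unit
    by (simp only: M.m_assoc M.m_closed M.Units_l_inv M.r_one)
  then show ?thesis
    using tsum3_prod[OF wf(1) triples_wf[OF reassoc_closed]] tsum3_prod[OF triples_wf[OF reassoc_closed] wf(2)]
    by (simp only: tsum3_triples[OF reassoc_closed])
qed

lemma lsum_concat2_mod:
  "left_module H U \<Longrightarrow> (\<And>x y. x \<in> set l \<Longrightarrow> y \<in> set (m x) \<Longrightarrow> f x y \<in> carrier U) \<Longrightarrow>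
    lsum U (concat (map (\<lambda>x. map (f x) (m x)) l)) = lsum U (map (\<lambda>x. lsum U (map (f x) (m x))) l)"
  by (rule abelian_monoid.lsum_concat2) simp_all

lemma lsum_single: "left_module H U \<Longrightarrow> x \<in> carrier U \<Longrightarrow> lsum U [x] = x"
proof -
  assume "left_module H U" "x \<in> carrier U"
  then interpret abelian_group U by simp
  show ?thesis using \<open>x \<in> carrier U\<close> by simp
qed

text \<open>Pulls every sum outwards, so that a composite of structure maps at a pure tensor becomes
  a nested sum of pure tensors, ready for comparison with a product of formal sums.\<close>

lemmas eval_simps = left_module_simps[where H=H] left_module_act[where H=H] act_pure pure_lsum lsum_act[where H=H] lsum_smult[where H=H] pure_bar_lsum map_concat split_def comp_def
  lsum_concat2_mod lsum_single mem_Times_iff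

lemma assoc_lsum:
  assumes "left_module H X" "left_module H Y" "left_module H Z"
    and "\<And>x. x \<in> set l \<Longrightarrow> g x \<in> carrier ((X ** Y) ** Z)"
  shows "map_of_arrow (assoc_arrow H X Y Z) (lsum ((X ** Y) ** Z) (map g l)) =
    lsum (X ** (Y ** Z)) (map (\<lambda>x. map_of_arrow (assoc_arrow H X Y Z) (g x)) l)"
  by (rule add_map_lsum[OF _ _ assoc_add_map]) (use assms in simp_all)

lemma comul_left_wf: "h \<in> carrier H \<Longrightarrow> wf3 [(a, b, c). (d, c) \<leftarrow> comul H h, (a, b) \<leftarrow> comul H d]"
  and comul_right_wf: "h \<in> carrier H \<Longrightarrow> wf3 [(a, b, c). (a, d) \<leftarrow> comul H h, (b, c) \<leftarrow> comul H d]"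
  unfolding split_def by (rule set_concat2_subset; simp add: mem_Times_iff)+

lemma assoc_mor:
  assumes X: "left_module H X" and Y: "left_module H Y" and Z: "left_module H Z"
  shows "assoc_arrow H X Y Z \<in> mor ((X ** Y) ** Z) (X ** (Y ** Z))"
proof -
  let ?T = "(X ** Y) ** Z" and ?U = "X ** (Y ** Z)"
  let ?f = "map_of_arrow (assoc_arrow H X Y Z)"
  have T: "left_module H ?T" and U: "left_module H ?U"
    using assms by simp_all
  have vs: "abelian_group ?U" using U by simp
  note add = assoc_add_map[OF assms] and pure = assoc_pure[OF assms]
  have "Arrow ?T (restrict ?f (carrier ?T)) ?U \<in> mor ?T ?U"
  proof (rule mor_restrictI)
    fix c t
    assume t: "t \<in> carrier ?T"
    show "?f t \<in> carrier ?U"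
      using add t by (simp add: add_map_def)
    have sm: "add_map M M (\<lambda>t. c \<odot>\<^bsub>M\<^esub> t)" if "left_module H M" for M :: "('h, 'a) umod"
      using that by (simp add: add_map_def)
    show "?f (c \<odot>\<^bsub>?T\<^esub> t) = c \<odot>\<^bsub>?U\<^esub> ?f t"
    proof (rule tens_ext3[OF X Y Z vs add_map_comp[OF sm[OF T] add] add_map_comp[OF add sm[OF U]] _ t])
      fix x y z
      assume xyz: "x \<in> carrier X" "y \<in> carrier Y" "z \<in> carrier Z"
      \<comment> \<open>A scalar multiple of a pure tensor is again pure, with the scalar absorbed
        by the first vector.\<close>
      have "?f (c \<odot>\<^bsub>?T\<^esub> pure (X ** Y) Z (pure X Y x y) z) =
          ?f (pure (X ** Y) Z (pure X Y (c \<odot>\<^bsub>X\<^esub> x) y) z)"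
        using assms xyz by simp
      also have "\<dots> = c \<odot>\<^bsub>?U\<^esub> ?f (pure (X ** Y) Z (pure X Y x y) z)"
        using assms xyz by (subst (1 2) pure) (simp_all add: eval_simps cong: map_cong)
      finally show "?f (c \<odot>\<^bsub>?T\<^esub> pure (X ** Y) Z (pure X Y x y) z) =
          c \<odot>\<^bsub>?U\<^esub> ?f (pure (X ** Y) Z (pure X Y x y) z)" .
    qed
  next
    fix h t
    assume h: "h \<in> carrier H" and t: "t \<in> carrier ?T"
    have ac: "add_map M M (act M h)" if "left_module H M" for M :: "('h, 'a) umod"
      using that h by (simp add: add_map_def)
    show "?f (act ?T h t) = act ?U h (?f t)"
    proof (rule tens_ext3[OF X Y Z vs add_map_comp[OF ac[OF T] add] add_map_comp[OF add ac[OF U]] _ t])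
      fix x y z
      assume xyz: "x \<in> carrier X" "y \<in> carrier Y" "z \<in> carrier Z"
      let ?F = "\<lambda>a b c. pure X (Y ** Z) (act X a x) (pure Y Z (act Y b y) (act Z c z))"
      let ?G = "\<lambda>p. ?F (fst p) (fst (snd p)) (snd (snd p))"
      let ?A = "[(a, b, c). (a, d) \<leftarrow> comul H h, (b, c) \<leftarrow> comul H d]"
      let ?B = "[(a, b, c). (d, c) \<leftarrow> comul H h, (a, b) \<leftarrow> comul H d]"
      let ?P = "triples (reassoc H)"
      note wfs = comul_left_wf[OF h] comul_right_wf[OF h] triples_wf[OF reassoc_closed]
      \<comment> \<open>\<phi> multiplies from the left because the associator is applied after h;
        \<open>?B\<close> contains the coproduct split on its first leg, in accordance with the
        bracketing of the source.\<close>
      have "?f (act ?T h (pure (X ** Y) Z (pure X Y x y) z)) = lsum ?U (map ?G (prod3 ?P ?B))"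
        using assms xyz h wfs
        by (subst lsum_prod3) (simp_all add: eval_simps assoc_lsum pure cong: map_cong)
      also have "\<dots> = lsum ?U (map ?G (prod3 ?A ?P))"
        by (rule trilinear_eval[OF vs trilinear_act(3)[OF assms xyz] prod3_wf prod3_wf])
          (use wfs quasi_coassoc_prod[OF h] in simp_all)
      also have "\<dots> = act ?U h (?f (pure (X ** Y) Z (pure X Y x y) z))"
        using assms xyz h wfs
        by (subst lsum_prod3) (simp_all add: eval_simps pure cong: map_cong)
      finally show "?f (act ?T h (pure (X ** Y) Z (pure X Y x y) z)) =
          act ?U h (?f (pure (X ** Y) Z (pure X Y x y) z))" .
    qed
  qed (use add T in \<open>simp_all add: add_map_def\<close>)
  moreover have "restrict ?f (carrier ?T) = ?f"
    by (simp add: assoc_arrow_def)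
  ultimately show ?thesis
    by (simp add: mor_iff)
qed

lemma assoc_iso:
  assumes X: "left_module H X" and Y: "left_module H Y" and Z: "left_module H Z"
  shows "iso_arrow (HMod H) ((X ** Y) ** Z) (X ** (Y ** Z)) (assoc_arrow H X Y Z)"
proof (rule mor_isoI[OF _ _ assoc_mor[OF assms], where g="assoc_inv X Y Z"])
  let ?T = "(X ** Y) ** Z" and ?U = "X ** (Y ** Z)"
  let ?f = "map_of_arrow (assoc_arrow H X Y Z)" and ?g = "assoc_inv X Y Z"
  let ?P = "triples (reassoc H)" and ?Q = "triples (inv\<^bsub>tens3 H\<^esub> (reassoc H))"
  show T: "left_module H ?T" and U: "left_module H ?U"
    using assms by simp_all
  have id: "add_map M M (\<lambda>x. x)" for M :: "('h, 'a) umod"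
    by (simp add: add_map_def)
  note f = assoc_add_map[OF assms] and g = assoc_inv_add_map[OF assms]
  note wfs = triples_wf[OF reassoc_closed] triples_wf[OF reassoc_inv_closed]
  have lsum: "?g (lsum ?U (map k l)) = lsum ?T (map (\<lambda>x. ?g (k x)) l)"
    if "\<And>x. x \<in> set l \<Longrightarrow> k x \<in> carrier ?U" for k and l :: "('h \<times> 'h \<times> 'h) list"
    by (rule add_map_lsum[OF _ _ g]) (use assms that in simp_all)
  show "?g y \<in> carrier ?T" if "y \<in> carrier ?U" for y
    using g that by (simp add: add_map_def)
  show "?g (?f t) = t" if t: "t \<in> carrier ?T" for t
  proof (rule tens_ext3[OF X Y Z _ add_map_comp[OF f g] id _ t])
    fix x y z
    assume xyz: "x \<in> carrier X" "y \<in> carrier Y" "z \<in> carrier Z"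
    let ?F = "\<lambda>a b c. pure (X ** Y) Z (pure X Y (act X a x) (act Y b y)) (act Z c z)"
    let ?G = "\<lambda>p. ?F (fst p) (fst (snd p)) (snd (snd p))"
    have "?g (?f (pure (X ** Y) Z (pure X Y x y) z)) = lsum ?T (map ?G (prod3 ?Q ?P))"
      using assms xyz wfs
      by (subst lsum_prod3) (simp_all add: lsum assoc_pure assoc_inv_pure cong: map_cong)
    also have "\<dots> = lsum ?T (map ?G [(\<one>, \<one>, \<one>)])"
      by (rule trilinear_eval[OF _ trilinear_act(4)[OF assms xyz] prod3_wf])
        (use assms wfs reassoc_inv in simp_all)
    also have "\<dots> = pure (X ** Y) Z (pure X Y x y) z"
      using assms xyz by (simp add: lsum_single)
    finally show "?g (?f (pure (X ** Y) Z (pure X Y x y) z)) = pure (X ** Y) Z (pure X Y x y) z" .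
  qed (use assms in simp)
  show "?f (?g t) = t" if t: "t \<in> carrier ?U" for t
  proof (rule tens_ext3_right[OF X Y Z _ add_map_comp[OF g f] id _ t])
    fix x y z
    assume xyz: "x \<in> carrier X" "y \<in> carrier Y" "z \<in> carrier Z"
    let ?F = "\<lambda>a b c. pure X (Y ** Z) (act X a x) (pure Y Z (act Y b y) (act Z c z))"
    let ?G = "\<lambda>p. ?F (fst p) (fst (snd p)) (snd (snd p))"
    have "?f (?g (pure X (Y ** Z) x (pure Y Z y z))) = lsum ?U (map ?G (prod3 ?P ?Q))"
      using assms xyz wfs
      by (subst lsum_prod3) (simp_all add: assoc_lsum assoc_pure assoc_inv_pure cong: map_cong)
    also have "\<dots> = lsum ?U (map ?G [(\<one>, \<one>, \<one>)])"
      by (rule trilinear_eval[OF _ trilinear_act(3)[OF assms xyz] prod3_wf])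
        (use assms wfs reassoc_inv in simp_all)
    also have "\<dots> = pure X (Y ** Z) x (pure Y Z y z)"
      using assms xyz by (simp add: lsum_single)
    finally show "?f (?g (pure X (Y ** Z) x (pure Y Z y z))) = pure X (Y ** Z) x (pure Y Z y z)" .
  qed (use assms in simp)
qed

lemma assoc_natural:
  assumes "left_module H X" "left_module H X'" "left_module H Y" "left_module H Y'" "left_module H Z" "left_module H Z'"
    and f: "f \<in> mor X X'" and g: "g \<in> mor Y Y'" and h: "h \<in> mor Z Z'"
  shows "comp_arrow (assoc_arrow H X' Y' Z') (tens_arrow H (tens_arrow H f g) h) =
    comp_arrow (tens_arrow H f (tens_arrow H g h)) (assoc_arrow H X Y Z)"
proof (rule mor_ext3)
  show "comp_arrow (assoc_arrow H X' Y' Z') (tens_arrow H (tens_arrow H f g) h)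
      \<in> mor ((X ** Y) ** Z) (X' ** (Y' ** Z'))"
    "comp_arrow (tens_arrow H f (tens_arrow H g h)) (assoc_arrow H X Y Z)
      \<in> mor ((X ** Y) ** Z) (X' ** (Y' ** Z'))"
    using assms by (auto intro!: comp_mor tens_arrow_mor assoc_mor)
  fix x y z
  assume xyz: "x \<in> carrier X" "y \<in> carrier Y" "z \<in> carrier Z"
  note fgh = mor_map[OF f] mor_map[OF g] mor_map[OF h]
  note src = mor_src[OF f] mor_src[OF g] mor_src[OF h] mor_trg[OF f] mor_trg[OF g] mor_trg[OF h]
  have gh: "tens_arrow H g h \<in> mor (Y ** Z) (Y' ** Z')"
    and fg: "tens_arrow H f g \<in> mor (X ** Y) (X' ** Y')"
    and f_gh: "tens_arrow H f (tens_arrow H g h) \<in> mor (X ** (Y ** Z)) (X' ** (Y' ** Z'))"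
    using assms by (auto intro!: tens_arrow_mor)
  show "map_of_arrow (comp_arrow (assoc_arrow H X' Y' Z') (tens_arrow H (tens_arrow H f g) h))
      (pure (X ** Y) Z (pure X Y x y) z) =
    map_of_arrow (comp_arrow (tens_arrow H f (tens_arrow H g h)) (assoc_arrow H X Y Z))
      (pure (X ** Y) Z (pure X Y x y) z)"
    using assms xyz fgh fg gh f_gh
    by (simp add: comp_map_src src tens_arrow_pure_trg assoc_pure mor_lsum_trg cong: map_cong)
qed (use assms in simp_all)

section \<open>The unit constraints\<close>

text \<open>Scalars travel between the vector and the unit factor. \<open>pure_smult\<close> would
  pull them out of the tensor instead, and is switched off where this rule is used for
  rewriting.\<close>

lemma pure_unit_right:
  "left_module H X \<Longrightarrow> x \<in> carrier X \<Longrightarrow> pure X (unit_mod H) (k \<odot>\<^bsub>X\<^esub> x) (Scal 1) = pure X (unit_mod H) x (Scal k)"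
  using pure_smult(2)[of X "unit_mod H" x "Scal 1" k] by simp

lemma pure_unit_left:
  "left_module H X \<Longrightarrow> x \<in> carrier X \<Longrightarrow> pure (unit_mod H) X (Scal 1) (k \<odot>\<^bsub>X\<^esub> x) = pure (unit_mod H) X (Scal k) x"
  using pure_smult(1)[of "unit_mod H" X "Scal 1" x k] by simp

lemma smult_H_closed [simp]: "h \<in> carrier H \<Longrightarrow> c \<odot> h \<in> carrier H"
  using vs_H by (simp add: module.smult_closed)

lemma add_map_act_elem: "left_module H X \<Longrightarrow> x \<in> carrier X \<Longrightarrow> add_map H X (\<lambda>h. act X h x)"
  by (simp add: add_map_def)

lemma lsum_act_elem:
  assumes "left_module H X" "x \<in> carrier X" "\<And>p. p \<in> set l \<Longrightarrow> g p \<in> carrier H"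
  shows "act X (lsum H (map g l)) x = lsum X (map (\<lambda>p. act X (g p) x) l)"
  by (rule add_map_lsum[OF _ _ add_map_act_elem]) (use assms vs_H in simp_all)

text \<open>The counit of the second leg is a scalar in the unit factor; moved to the vector, the
  sum is collected inside \<open>H\<close>. For a coproduct the collected element is h itself by the
  counit axiom, which is the equivariance of the unit constraint.\<close>

lemma lsum_counit_right:
  assumes X: "left_module H X" and x: "x \<in> carrier X" and t: "t \<in> carrier (tens2 H)"
  shows "lsum (X ** (unit_mod H)) (map (\<lambda>p. pure X (unit_mod H) (act X (fst p) x) (Scal (counit H (snd p)))) t) =
    pure X (unit_mod H) (act X (lsum H [counit H b \<odot> a. (a, b) \<leftarrow> t]) x) (Scal 1)"
  using X x tens2_mem[OF t]
  by (simp add: split_def lsum_act_elem pure_lsum pure_unit_right[where k="counit H h" for h, symmetric] del: pure_smult cong: map_cong)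

lemma lsum_counit_left:
  assumes X: "left_module H X" and x: "x \<in> carrier X" and t: "t \<in> carrier (tens2 H)"
  shows "lsum ((unit_mod H) ** X) (map (\<lambda>p. pure (unit_mod H) X (Scal (counit H (fst p))) (act X (snd p) x)) t) =
    pure (unit_mod H) X (Scal 1) (act X (lsum H [counit H a \<odot> b. (a, b) \<leftarrow> t]) x)"
  using X x tens2_mem[OF t]
  by (simp add: split_def lsum_act_elem pure_lsum pure_unit_left[where k="counit H h" for h, symmetric] del: pure_smult cong: map_cong)

lemma lunit_mor: "left_module H X \<Longrightarrow> lunit_arrow X \<in> mor X (X ** (unit_mod H))"
  unfolding lunit_arrow_def
  by (rule mor_restrictI) (simp_all add: act_pure lsum_counit_right counit_right)

lemma runit_mor: "left_module H X \<Longrightarrow> runit_arrow X \<in> mor X ((unit_mod H) ** X)"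
  unfolding runit_arrow_def
  by (rule mor_restrictI) (simp_all add: act_pure lsum_counit_left counit_left)

lemma lunit_map: "x \<in> carrier X \<Longrightarrow> map_of_arrow (lunit_arrow X) x = pure X (unit_mod H) x (Scal 1)"
  and runit_map: "x \<in> carrier X \<Longrightarrow> map_of_arrow (runit_arrow X) x = pure (unit_mod H) X (Scal 1) x"
  by (simp_all add: lunit_arrow_def runit_arrow_def)

lemma smult_simps:
  assumes "left_module H X" "x \<in> carrier X"
  shows "(a + b) \<odot>\<^bsub>X\<^esub> x = a \<odot>\<^bsub>X\<^esub> x \<oplus>\<^bsub>X\<^esub> b \<odot>\<^bsub>X\<^esub> x"
    and "(a * b) \<odot>\<^bsub>X\<^esub> x = a \<odot>\<^bsub>X\<^esub> (b \<odot>\<^bsub>X\<^esub> x)" and "1 \<odot>\<^bsub>X\<^esub> x = x"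
proof -
  interpret module complex_field X using assms by simp
  show "(a + b) \<odot>\<^bsub>X\<^esub> x = a \<odot>\<^bsub>X\<^esub> x \<oplus>\<^bsub>X\<^esub> b \<odot>\<^bsub>X\<^esub> x"
    "(a * b) \<odot>\<^bsub>X\<^esub> x = a \<odot>\<^bsub>X\<^esub> (b \<odot>\<^bsub>X\<^esub> x)" "1 \<odot>\<^bsub>X\<^esub> x = x"
    using assms(2) smult_l_distr[of a b x] smult_assoc1[of a b x] smult_one[of x] by simp_all
qed

lemma lunit_iso:
  assumes X: "left_module H X"
  shows "iso_arrow (HMod H) X (X ** (unit_mod H)) (lunit_arrow X)"
proof (rule mor_isoI[OF X _ lunit_mor[OF X]])
  let ?T = "X ** (unit_mod H)"
  \<comment> \<open>The inverse of the unit constraint multiplies the vector by the scalar in the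
    unit factor.\<close>
  let ?F = "\<lambda>x z. scal_of z \<odot>\<^bsub>X\<^esub> x"
  let ?g = "lift X ?F"
  have id: "add_map M M (\<lambda>x. x)" for M :: "('h, 'a) umod"
    by (simp add: add_map_def)
  show "left_module H ?T" using X by simp
  have F: "balanced X (unit_mod H) X ?F"
    using X by (intro balancedI) (auto simp: smult_simps(1) smult_simps(2)[symmetric] mult.commute)
  have g: "add_map ?T X ?g"
    using X by (intro two_modules.add_map_lift_mod[OF _ _ F]) simp_all
  have pure: "?g (pure X (unit_mod H) x (Scal k)) = k \<odot>\<^bsub>X\<^esub> x" if "x \<in> carrier X" for x k
    using X that by (subst two_modules.lift_pure[OF _ _ F]) simp_all
  show "?g t \<in> carrier X" if "t \<in> carrier ?T" for t
    using g that by (simp add: add_map_def)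
  show "?g (map_of_arrow (lunit_arrow X) x) = x" if "x \<in> carrier X" for x
    using X that by (simp add: lunit_map pure smult_simps)
  show "map_of_arrow (lunit_arrow X) (?g t) = t" if t: "t \<in> carrier ?T" for t
    by (rule tens_ext2[OF X left_module_unit _ add_map_comp[OF g mor_add_map[OF lunit_mor[OF X]]] id _ t])
      (use X in \<open>auto simp: pure lunit_map pure_unit_right simp del: pure_smult\<close>)
qed

lemma runit_iso:
  assumes X: "left_module H X"
  shows "iso_arrow (HMod H) X ((unit_mod H) ** X) (runit_arrow X)"
proof (rule mor_isoI[OF X _ runit_mor[OF X]])
  let ?T = "(unit_mod H) ** X"
  let ?F = "\<lambda>z x. scal_of z \<odot>\<^bsub>X\<^esub> x"
  let ?g = "lift X ?F"
  have id: "add_map M M (\<lambda>x. x)" for M :: "('h, 'a) umod"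
    by (simp add: add_map_def)
  show "left_module H ?T" using X by simp
  have F: "balanced (unit_mod H) X X ?F"
    using X by (intro balancedI) (auto simp: smult_simps(1) smult_simps(2)[symmetric] mult.commute)
  have g: "add_map ?T X ?g"
    using X by (intro two_modules.add_map_lift_mod[OF _ _ F]) simp_all
  have pure: "?g (pure (unit_mod H) X (Scal k) x) = k \<odot>\<^bsub>X\<^esub> x" if "x \<in> carrier X" for x k
    using X that by (subst two_modules.lift_pure[OF _ _ F]) simp_all
  show "?g t \<in> carrier X" if "t \<in> carrier ?T" for t
    using g that by (simp add: add_map_def)
  show "?g (map_of_arrow (runit_arrow X) x) = x" if "x \<in> carrier X" for x
    using X that by (simp add: runit_map pure smult_simps)
  show "map_of_arrow (runit_arrow X) (?g t) = t" if t: "t \<in> carrier ?T" for t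
    by (rule tens_ext2[OF left_module_unit X _ add_map_comp[OF g mor_add_map[OF runit_mor[OF X]]] id _ t])
      (use X in \<open>auto simp: pure runit_map pure_unit_left simp del: pure_smult\<close>)
qed

lemma lunit_natural:
  assumes X: "left_module H X" and Y: "left_module H Y" and f: "f \<in> mor X Y"
  shows "comp_arrow (lunit_arrow Y) f = comp_arrow (tens_arrow H f (id_arrow (unit_mod H))) (lunit_arrow X)"
proof (rule mor_eqI)
  show "comp_arrow (lunit_arrow Y) f \<in> mor X (Y ** (unit_mod H))"
    "comp_arrow (tens_arrow H f (id_arrow (unit_mod H))) (lunit_arrow X) \<in> mor X (Y ** (unit_mod H))"
    using assms by (auto intro!: comp_mor tens_arrow_mor lunit_mor id_mor)
qed (use assms mor_map(1)[OF f] in \<open>simp add: comp_map_src mor_src[OF f] lunit_map tens_arrow_pure[of X "unit_mod H" Y "unit_mod H"]\<close>)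

lemma runit_natural:
  assumes X: "left_module H X" and Y: "left_module H Y" and f: "f \<in> mor X Y"
  shows "comp_arrow (runit_arrow Y) f = comp_arrow (tens_arrow H (id_arrow (unit_mod H)) f) (runit_arrow X)"
proof (rule mor_eqI)
  show "comp_arrow (runit_arrow Y) f \<in> mor X ((unit_mod H) ** Y)"
    "comp_arrow (tens_arrow H (id_arrow (unit_mod H)) f) (runit_arrow X) \<in> mor X ((unit_mod H) ** Y)"
    using assms by (auto intro!: comp_mor tens_arrow_mor runit_mor id_mor)
qed (use assms mor_map(1)[OF f] in \<open>simp add: comp_map_src mor_src[OF f] runit_map tens_arrow_pure[of "unit_mod H" X "unit_mod H" Y]\<close>)

section \<open>The pentagon and the triangle\<close>

lemma quadrilinear_act:
  assumes "left_module H W" "left_module H X" "left_module H Y" "left_module H Z"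
    and "w \<in> carrier W" "x \<in> carrier X" "y \<in> carrier Y" "z \<in> carrier Z"
  shows "quadrilinear H H H H (W ** (X ** (Y ** Z)))
    (\<lambda>a b c d. pure W (X ** (Y ** Z)) (act W a w)
      (pure X (Y ** Z) (act X b x) (pure Y Z (act Y c y) (act Z d z))))"
  unfolding quadrilinear_def trilinear_def by (intro conjI ballI balancedI; use assms in simp)

lemma pentagon_arrows:
  assumes W: "left_module H W" and X: "left_module H X" and Y: "left_module H Y" and Z: "left_module H Z"
  shows "comp_arrow (assoc_arrow H W X (Y ** Z)) (assoc_arrow H (W ** X) Y Z) =
    comp_arrow (comp_arrow (tens_arrow H (id_arrow W) (assoc_arrow H X Y Z)) (assoc_arrow H W (X ** Y) Z))
      (tens_arrow H (assoc_arrow H W X Y) (id_arrow Z))"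
    (is "?L = ?R")
proof (rule mor_ext4[OF assms])
  let ?T = "((W ** X) ** Y) ** Z"
  let ?U = "W ** (X ** (Y ** Z))"
  show U: "left_module H ?U" using assms by simp
  have 1: "assoc_arrow H W X (Y ** Z) \<in> mor ((W ** X) ** (Y ** Z)) ?U"
    "assoc_arrow H (W ** X) Y Z \<in> mor ?T ((W ** X) ** (Y ** Z))"
    "tens_arrow H (id_arrow W) (assoc_arrow H X Y Z) \<in> mor (W ** ((X ** Y) ** Z)) ?U"
    "assoc_arrow H W (X ** Y) Z \<in>
      mor ((W ** (X ** Y)) ** Z) (W ** ((X ** Y) ** Z))"
    "tens_arrow H (assoc_arrow H W X Y) (id_arrow Z) \<in> mor ?T ((W ** (X ** Y)) ** Z)"
    "assoc_arrow H X Y Z \<in> mor ((X ** Y) ** Z) (X ** (Y ** Z))"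
    "assoc_arrow H W X Y \<in> mor ((W ** X) ** Y) (W ** (X ** Y))"
    using assms by (auto intro!: assoc_mor tens_arrow_mor id_mor)
  show "?L \<in> mor ?T ?U" "?R \<in> mor ?T ?U"
    using assms 1 by (auto intro!: comp_mor)
  fix w x y z
  assume wxyz: "w \<in> carrier W" "x \<in> carrier X" "y \<in> carrier Y" "z \<in> carrier Z"
  let ?p = "pure ((W ** X) ** Y) Z (pure (W ** X) Y (pure W X w x) y) z"
  let ?F = "\<lambda>a b c d. pure W (X ** (Y ** Z)) (act W a w)
      (pure X (Y ** Z) (act X b x) (pure Y Z (act Y c y) (act Z d z)))"
  let ?G = "\<lambda>p. ?F (fst p) (fst (snd p)) (fst (snd (snd p))) (snd (snd (snd p)))"
  \<comment> \<open>One list per arrow of the pentagon. On the left side the associator with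
    \<open>Y ** Z\<close> as last object gives \<open>?L1\<close>, and the one with
    \<open>W ** X\<close> as first object gives \<open>?L2\<close>. On the right side
    \<open>?L5\<close>, \<open>?L4\<close> and \<open>?L3\<close> belong to the three arrows in the
    order in which they are applied.\<close>
  let ?L1 = "[(a, b, c, d). (a, b, e) \<leftarrow> triples (reassoc H), (c, d) \<leftarrow> comul H e]"
  let ?L2 = "[(a, b, c, d). (e, c, d) \<leftarrow> triples (reassoc H), (a, b) \<leftarrow> comul H e]"
  let ?L3 = "[(\<one>, b, c, d). (b, c, d) \<leftarrow> triples (reassoc H)]"
  let ?L4 = "[(a, b, c, d). (a, e, d) \<leftarrow> triples (reassoc H), (b, c) \<leftarrow> comul H e]"
  let ?L5 = "[(a, b, c, \<one>). (a, b, c) \<leftarrow> triples (reassoc H)]"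
  have wf: "wf4 ?L1" "wf4 ?L2" "wf4 ?L4"
    unfolding split_def by (rule set_concat2_subset; simp add: mem_Times_iff)+
  have wf': "wf4 ?L3" "wf4 ?L5"
    using triples_wf[OF reassoc_closed] by auto
  have eq: "tsum4 H (prod4 ?L1 ?L2) = tsum4 H (prod4 (prod4 ?L3 ?L4) ?L5)"
    using reassoc_pentagon tsum4_prod[OF wf(1,2)] tsum4_prod[OF wf'(1) wf(3)]
      tsum4_prod[OF prod4_wf[OF wf'(1) wf(3)] wf'(2)] by (simp only:)
  have "map_of_arrow ?L ?p = lsum ?U (map ?G (prod4 ?L1 ?L2))"
    using assms wxyz 1
    by (subst lsum_prod4[OF _ wf(1,2)])
      (simp_all add: comp_map_src eval_simps assoc_pure assoc_lsum cong: map_cong)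
  also have "\<dots> = lsum ?U (map ?G (prod4 (prod4 ?L3 ?L4) ?L5))"
    by (rule quadrilinear_eval[OF _ quadrilinear_act[OF assms wxyz] prod4_wf[OF wf(1,2)]
        prod4_wf[OF prod4_wf[OF wf'(1) wf(3)] wf'(2)] eq]) (use assms in simp)
  \<comment> \<open>The threefold product is expanded in two stages: the last factor
    \<open>?L5\<close> first, and then, below its sum, the product of \<open>?L3\<close> and
    \<open>?L4\<close>.\<close>
  also have "\<dots> = lsum ?U (map (\<lambda>r. lsum ?U (map (\<lambda>q. ?F (fst q \<otimes> fst r) (fst (snd q) \<otimes> fst (snd r))
      (fst (snd (snd q)) \<otimes> fst (snd (snd r))) (snd (snd (snd q)) \<otimes> snd (snd (snd r)))) (prod4 ?L3 ?L4))) ?L5)"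
    using assms wxyz by (subst lsum_prod4[OF _ prod4_wf[OF wf'(1) wf(3)] wf'(2)]) simp_all
  also have "\<dots> = lsum ?U (map (\<lambda>r. lsum ?U (map (\<lambda>q. lsum ?U (map (\<lambda>p.
      ?F (fst p \<otimes> fst q \<otimes> fst r) (fst (snd p) \<otimes> fst (snd q) \<otimes> fst (snd r))
        (fst (snd (snd p)) \<otimes> fst (snd (snd q)) \<otimes> fst (snd (snd r)))
        (snd (snd (snd p)) \<otimes> snd (snd (snd q)) \<otimes> snd (snd (snd r)))) ?L3)) ?L4)) ?L5)"
  proof (rule left_module_lsum_cong[OF U])
    fix r
    assume "r \<in> set ?L5"
    then have "r \<in> carrier H \<times> carrier H \<times> carrier H \<times> carrier H"
      using wf'(2) by blast
    then show "lsum ?U (map (\<lambda>q. ?F (fst q \<otimes> fst r) (fst (snd q) \<otimes> fst (snd r))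
      (fst (snd (snd q)) \<otimes> fst (snd (snd r))) (snd (snd (snd q)) \<otimes> snd (snd (snd r)))) (prod4 ?L3 ?L4)) =
      lsum ?U (map (\<lambda>q. lsum ?U (map (\<lambda>p.
        ?F (fst p \<otimes> fst q \<otimes> fst r) (fst (snd p) \<otimes> fst (snd q) \<otimes> fst (snd r))
          (fst (snd (snd p)) \<otimes> fst (snd (snd q)) \<otimes> fst (snd (snd r)))
          (snd (snd (snd p)) \<otimes> snd (snd (snd q)) \<otimes> snd (snd (snd r)))) ?L3)) ?L4)"
      using assms wxyz by (subst lsum_prod4[OF _ wf'(1) wf(3)]) (simp_all add: mem_Times_iff)
  qed
  also have "\<dots> = map_of_arrow ?R ?p"
    using assms wxyz 1
    by (simp add: comp_map_src eval_simps assoc_pure assoc_lsum mor_lsum_trg tens_arrow_pure_trg cong: map_cong)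
  finally show "map_of_arrow ?L ?p = map_of_arrow ?R ?p" .
qed

lemma triangle_arrows:
  assumes X: "left_module H X" and Y: "left_module H Y"
  shows "comp_arrow (assoc_arrow H X (unit_mod H) Y) (tens_arrow H (lunit_arrow X) (id_arrow Y)) =
    tens_arrow H (id_arrow X) (runit_arrow Y)"
proof (rule mor_ext2[OF X Y])
  let ?U = "X ** ((unit_mod H) ** Y)"
  have 1: "tens_arrow H (lunit_arrow X) (id_arrow Y) \<in> mor (X ** Y) ((X ** (unit_mod H)) ** Y)"
    using assms by (intro tens_arrow_mor lunit_mor id_mor) simp_all
  show "comp_arrow (assoc_arrow H X (unit_mod H) Y) (tens_arrow H (lunit_arrow X) (id_arrow Y)) \<in> mor (X ** Y) ?U"
    using assms by (intro comp_mor[OF _ 1] assoc_mor) simp_all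
  show "tens_arrow H (id_arrow X) (runit_arrow Y) \<in> mor (X ** Y) ?U"
    using assms by (intro tens_arrow_mor runit_mor id_mor) simp_all
  fix x y
  assume xy: "x \<in> carrier X" "y \<in> carrier Y"
  let ?F = "\<lambda>a c. pure X ((unit_mod H) ** Y) (act X a x) (pure (unit_mod H) Y (Scal 1) (act Y c y))"
  \<comment> \<open>The middle leg of \<phi> acts on the unit object by its counit, and this scalar
    moves to the third leg. What remains is the counit applied to the middle of \<phi>, which is the
    unit of the tensor square.\<close>
  let ?l = "[(a, counit H b \<odot> c). (a, b, c) \<leftarrow> triples (reassoc H)]"
  have F: "balanced H H ?U ?F"
    by (rule balancedI) (use assms xy in simp_all)
  have U: "abelian_group ?U" using assms by simp
  have l: "set ?l \<subseteq> carrier H \<times> carrier H"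
    using triples_wf[OF reassoc_closed] by auto
  have "map_of_arrow (assoc_arrow H X (unit_mod H) Y) (pure (X ** (unit_mod H)) Y (pure X (unit_mod H) x (Scal 1)) y) =
      lsum2 ?U ?F ?l"
    using assms xy by (simp add: assoc_pure split_def comp_def pure_unit_left del: pure_smult cong: map_cong)
  also have "\<dots> = lsum2 ?U ?F (\<one>\<^bsub>tens2 H\<^esub>)"
    unfolding reassoc_counit[symmetric] by (rule lsum_tsum2[OF U F l, symmetric])
  also have "\<dots> = ?F \<one> \<one>"
    by (rule tens2_one_eval[OF U F])
  finally show "map_of_arrow (comp_arrow (assoc_arrow H X (unit_mod H) Y) (tens_arrow H (lunit_arrow X) (id_arrow Y))) (pure X Y x y) =
      map_of_arrow (tens_arrow H (id_arrow X) (runit_arrow Y)) (pure X Y x y)"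
    using assms xy
    by (simp add: comp_map_src tens_arrow_pure_trg lunit_mor runit_mor lunit_map runit_map)
qed (use assms in simp_all)

lemma monoidal_HMod: "monoidal_category (HMod H)"
proof (intro monoidal_category.intro category_HMod monoidal_category_axioms.intro)
qed (simp_all add: tens_arrow_mor tens_id tens_comp assoc_iso assoc_natural lunit_iso lunit_natural
    runit_iso runit_natural pentagon_arrows triangle_arrows)

section \<open>The counit and the conjugate-linear involution\<close>

lemma balanced_mult_arg:
  "balanced H H U F \<Longrightarrow> c \<in> carrier H \<Longrightarrow> d \<in> carrier H \<Longrightarrow> balanced H H U (\<lambda>a b. F (a \<otimes> c) (b \<otimes> d))"
  by (rule balancedI) (simp_all add: balancedD[of H H U F] alg_l_distr smult_mult_left)

text \<open>Compared with \<open>tens2_mult_eval\<close>, the left factor may be any explicit list,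
  such as a flipped and \<open>T\<close>-twisted coproduct, and the sum over the right factor, which
  acts first on modules, is outside.\<close>

lemma tens2_mult_tsum_eval:
  assumes U: "abelian_group U" and F: "balanced H H U F" and l: "set l \<subseteq> carrier H \<times> carrier H"
    and t: "t \<in> carrier (tens2 H)"
  shows "lsum2 U F (tsum H H l \<otimes>\<^bsub>tens2 H\<^esub> t) =
    lsum U (map (\<lambda>y. lsum U (map (\<lambda>x. F (fst x \<otimes> fst y) (snd x \<otimes> snd y)) l)) t)"
proof -
  interpret U: abelian_group U by fact
  interpret T: two_vector_spaces H H by (simp add: two_vector_spaces_def vs_H)
  have s: "tsum H H l \<in> carrier (tens2 H)"
    by (rule T.tsum_carrier[OF l])
  have "lsum2 U F (tsum H H l \<otimes>\<^bsub>tens2 H\<^esub> t) =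
      lsum U (map (\<lambda>x. lsum U (map (\<lambda>y. F (fst x \<otimes> fst y) (snd x \<otimes> snd y)) t)) (tsum H H l))"
    by (rule tens2_mult_eval[OF U F s t])
  also have "\<dots> = lsum U (map (\<lambda>y. lsum U (map (\<lambda>x. F (fst x \<otimes> fst y) (snd x \<otimes> snd y)) (tsum H H l))) t)"
    by (rule U.lsum_swap) (simp add: balancedD(1)[OF F] tens2_mem[OF s] tens2_mem[OF t])
  also have "\<dots> = lsum U (map (\<lambda>y. lsum U (map (\<lambda>x. F (fst x \<otimes> fst y) (snd x \<otimes> snd y)) l)) t)"
    by (rule U.lsum_cong)
      (rule lsum_tsum2[OF U balanced_mult_arg[OF F] l]; simp add: tens2_mem[OF t])
  finally show ?thesis .
qed

lemma tens2_mult_eval_rev: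
  assumes "abelian_group U" "balanced H H U F" "s \<in> carrier (tens2 H)" "t \<in> carrier (tens2 H)"
  shows "lsum2 U F (s \<otimes>\<^bsub>tens2 H\<^esub> t) =
    lsum U (map (\<lambda>y. lsum U (map (\<lambda>x. F (fst x \<otimes> fst y) (snd x \<otimes> snd y)) s)) t)"
  using tens2_mult_tsum_eval[OF assms(1,2) tens2_wf[OF assms(3)] assms(4)] by (simp add: tens2_id[OF assms(3)])

lemma gauge_closed: "gauge H \<in> carrier (tens2 H)"
  and gauge_inv_closed: "inv\<^bsub>tens2 H\<^esub> (gauge H) \<in> carrier (tens2 H)"
  using monoid.Units_closed[OF tens2_monoid gauge_unit] monoid.Units_inv_closed[OF tens2_monoid gauge_unit]
  by simp_all

lemmas gauge_mem [simp] = tens2_mem[OF gauge_closed] tens2_mem[OF gauge_inv_closed]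

lemmas gauge_inverse = monoid.Units_r_inv[OF tens2_monoid gauge_unit] monoid.Units_l_inv[OF tens2_monoid gauge_unit]

lemma flip_starT_wf:
  "t \<in> carrier (tens2 H) \<Longrightarrow> set [(starT H b, starT H a). (a, b) \<leftarrow> t] \<subseteq> carrier H \<times> carrier H"
  by (auto simp: tens2_mem[of t "(a, b)" for a b, simplified])

text \<open>The formula for the coproduct of \<open>T\<close> h multiplied by the gauge from the
  left. In this form it compares \<Upsilon> after h with h after \<Upsilon>, and no inverse
  remains.\<close>

lemma gauge_comul_starT:
  assumes h: "h \<in> carrier H"
  shows "gauge H \<otimes>\<^bsub>tens2 H\<^esub> comul H (starT H h) =
    tsum H H [(starT H b, starT H a). (a, b) \<leftarrow> comul H h] \<otimes>\<^bsub>tens2 H\<^esub> gauge H"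
proof -
  interpret M: monoid "tens2 H" by (rule tens2_monoid)
  interpret T: two_vector_spaces H H by (simp add: two_vector_spaces_def vs_H)
  let ?S = "tsum H H [(starT H b, starT H a). (a, b) \<leftarrow> comul H h]"
  have S: "?S \<in> carrier (tens2 H)"
    by (rule T.tsum_carrier[OF flip_starT_wf[OF comul_closed[OF h]]])
  have "gauge H \<otimes>\<^bsub>tens2 H\<^esub> comul H (starT H h) =
      (gauge H \<otimes>\<^bsub>tens2 H\<^esub> inv\<^bsub>tens2 H\<^esub> (gauge H)) \<otimes>\<^bsub>tens2 H\<^esub> ?S \<otimes>\<^bsub>tens2 H\<^esub> gauge H"
    unfolding comul_starT[OF h] using S gauge_closed gauge_inv_closed
    by (simp only: M.m_assoc M.m_closed)
  then show ?thesis
    using S gauge_closed by (simp only: gauge_inverse M.l_one)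
qed

lemma gam_simps [simp]:
  "gam H \<in> carrier H" "inv (gam H) \<in> carrier H" "gam H \<otimes> inv (gam H) = \<one>" "inv (gam H) \<otimes> gam H = \<one>"
  "starT H (gam H) = gam H"
  using monoid.Units_closed[OF alg_monoid gam_unit] monoid.Units_inv_closed[OF alg_monoid gam_unit]
    monoid.Units_r_inv[OF alg_monoid gam_unit] monoid.Units_l_inv[OF alg_monoid gam_unit] starT_gam
  by simp_all

text \<open>The square of \<open>T\<close> is conjugation by \<gamma>, which is injective.\<close>

lemma starT_inj:
  assumes "h \<in> carrier H" "k \<in> carrier H" "starT H h = starT H k"
  shows "h = k"
proof -
  have "gam H \<otimes> h \<otimes> inv (gam H) = gam H \<otimes> k \<otimes> inv (gam H)"
    using assms starT_starT[of h] starT_starT[of k] by simp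
  then have "inv (gam H) \<otimes> (gam H \<otimes> h \<otimes> inv (gam H)) \<otimes> gam H = inv (gam H) \<otimes> (gam H \<otimes> k \<otimes> inv (gam H)) \<otimes> gam H"
    by simp
  moreover have "inv (gam H) \<otimes> (gam H \<otimes> x \<otimes> inv (gam H)) \<otimes> gam H = x" if "x \<in> carrier H" for x
  proof -
    have "inv (gam H) \<otimes> (gam H \<otimes> x \<otimes> inv (gam H)) \<otimes> gam H =
        (inv (gam H) \<otimes> gam H) \<otimes> x \<otimes> (inv (gam H) \<otimes> gam H)"
      using that by (simp add: alg_assoc del: gam_simps(3,4))
    then show ?thesis using that by simp
  qed
  ultimately show ?thesis using assms by simp
qed

text \<open>Applying \<open>id \<otimes> \<epsilon>\<close> to the twisted comultiplicativity of \<open>T\<close> removes the gauge and gives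
  \<open>T h = \<Sum> \<epsilon>(T h\<^sub>1) T h\<^sub>2\<close>; since \<open>T\<close> is injective, \<open>h = \<Sum> \<epsilon>(T h\<^sub>1)\<^sup>* h\<^sub>2\<close>.\<close>

lemma counit_starT:
  assumes h: "h \<in> carrier H"
  shows "counit H (starT H h) = cnj (counit H h)"
proof -
  let ?F = "\<lambda>a b. counit H b \<odot> a"
  have U: "abelian_group H" and M: "abelian_monoid H"
    using vs_H by simp_all
  note smult = module.smult_l_distr[OF vs_H, simplified] module.smult_r_distr[OF vs_H, simplified]
    module.smult_assoc1[OF vs_H, simplified]
  have F: "balanced H H H ?F"
    by (intro balancedI) (simp_all add: smult(1,2) mult.commute flip: smult(3))
  have mult: "?F (a \<otimes> c) (b \<otimes> d) = ?F a b \<otimes> ?F c d"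
    if "a \<in> carrier H" "b \<in> carrier H" "c \<in> carrier H" "d \<in> carrier H" for a b c d
    using that by (simp add: smult_mult_left smult_mult_right mult.commute flip: smult(3))
  let ?E = "\<lambda>t. lsum2 H ?F t"
  have cl: "?E t \<in> carrier H" if "set t \<subseteq> carrier H \<times> carrier H" for t
    using that by (intro abelian_monoid.lsum_map_closed[OF M]) auto
  have lmult: "lsum H (map (\<lambda>p. g p \<otimes> k) l) = lsum H (map g l) \<otimes> k"
    if "k \<in> carrier H" "\<And>p. p \<in> set l \<Longrightarrow> g p \<in> carrier H" for g k and l :: "('h \<times> 'h) list"
    using that by (intro add_map_lsum[symmetric, where f="\<lambda>x. x \<otimes> k"])
      (simp_all add: U add_map_def alg_l_distr vs_H)
  have rmult: "lsum H (map (\<lambda>p. k \<otimes> g p) l) = k \<otimes> lsum H (map g l)"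
    if "k \<in> carrier H" "\<And>p. p \<in> set l \<Longrightarrow> g p \<in> carrier H" for g k and l :: "('h \<times> 'h) list"
    using that by (intro add_map_lsum[symmetric, where f="\<lambda>x. k \<otimes> x"])
      (simp_all add: U add_map_def alg_r_distr vs_H)
  \<comment> \<open>\<open>?E\<close> is the map id \<otimes> \<epsilon> to \<open>H\<close>. It is
    multiplicative and sends the gauge to the unit, which is why the gauge disappears from both
    sides.\<close>
  have E_mult: "?E (tsum H H l \<otimes>\<^bsub>tens2 H\<^esub> t) = ?E l \<otimes> ?E t"
    if l: "set l \<subseteq> carrier H \<times> carrier H" and t: "t \<in> carrier (tens2 H)" for l t
  proof -
    have lm: "fst p \<in> carrier H" "snd p \<in> carrier H" if "p \<in> set l" for p
      using l that by auto
    have "?E (tsum H H l \<otimes>\<^bsub>tens2 H\<^esub> t) = lsum H (map (\<lambda>y. lsum H (map (\<lambda>x. ?F (fst x) (snd x) \<otimes> ?F (fst y) (snd y)) l)) t)"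
      using lm tens2_mem[OF t] by (subst tens2_mult_tsum_eval[OF U F l t]) (simp flip: mult cong: map_cong)
    also have "\<dots> = ?E l \<otimes> ?E t"
      using lm tens2_mem[OF t] cl[OF l] by (simp add: lmult rmult cong: map_cong)
    finally show ?thesis .
  qed
  have G: "?E (gauge H) = \<one>"
    using gauge_counit_right by (simp add: split_def)
  let ?S = "[(starT H b, starT H a). (a, b) \<leftarrow> comul H h]"
  note S = flip_starT_wf[OF comul_closed[OF h]]
  have "?E (comul H (starT H h)) = ?E ?S"
    using E_mult[OF tens2_wf[OF gauge_closed] comul_closed[of "starT H h"]] E_mult[OF S gauge_closed]
      gauge_comul_starT[OF h] h G cl[OF S] cl[OF tens2_wf[OF comul_closed[of "starT H h"]]]
    by (simp add: tens2_id[OF gauge_closed])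
  then have "starT H h = ?E ?S"
    using counit_right[of "starT H h"] h by (simp add: split_def)
  also have "\<dots> = lsum H (map (\<lambda>p. starT H (cnj (counit H (starT H (fst p))) \<odot> snd p)) (comul H h))"
    using h by (simp add: split_def comp_def cong: map_cong)
  also have "\<dots> = starT H (lsum H (map (\<lambda>p. cnj (counit H (starT H (fst p))) \<odot> snd p) (comul H h)))"
    using h by (intro add_map_lsum[symmetric, where f="starT H"]) (simp_all add: U add_map_def vs_H)
  finally have "starT H h = starT H (lsum H (map (\<lambda>p. cnj (counit H (starT H (fst p))) \<odot> snd p) (comul H h)))" .
  from starT_inj[OF h _ this] have *: "h = lsum H (map (\<lambda>p. cnj (counit H (starT H (fst p))) \<odot> snd p) (comul H h))"
    using h by (simp add: abelian_monoid.lsum_map_closed[OF M])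
  have C: "abelian_group complex_field"
    using cring_complex_field by (simp add: cring_def ring_def)
  \<comment> \<open>Applying \<epsilon> leaves the sum of the numbers \<epsilon>(T a)* \<epsilon>(b)
    over the legs a, b of the coproduct. The factor \<epsilon>(b) is moved inside the
    conjugate-linear map that sends a to \<epsilon>(T a)*, and the counit axiom restores h
    there.\<close>
  have "counit H h = counit H (lsum H (map (\<lambda>p. cnj (counit H (starT H (fst p))) \<odot> snd p) (comul H h)))"
    using * by (rule arg_cong)
  also have "\<dots> = lsum complex_field (map (\<lambda>p. counit H (cnj (counit H (starT H (fst p))) \<odot> snd p)) (comul H h))"
    using h by (intro add_map_lsum[where f="counit H"]) (simp_all add: C add_map_def vs_H)
  also have "\<dots> = lsum complex_field (map (\<lambda>p. cnj (counit H (starT H (cnj (cnj (counit H (snd p))) \<odot> fst p)))) (comul H h))"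
    using h by (simp add: mult.commute cong: map_cong)
  also have "\<dots> = cnj (counit H (starT H (lsum H (map (\<lambda>p. counit H (snd p) \<odot> fst p) (comul H h)))))"
    using h by (subst add_map_lsum[of H complex_field "\<lambda>x. cnj (counit H (starT H x))"])
      (simp_all add: C add_map_def vs_H)
  also have "\<dots> = cnj (counit H (starT H h))"
    using counit_right[OF h] by (simp add: split_def)
  finally show ?thesis by simp
qed

section \<open>The bar structure\<close>

lemma act_gam_inv [simp]:
  assumes "left_module H X" "x \<in> carrier X"
  shows "act X (gam H) (act X (inv (gam H)) x) = x" "act X (inv (gam H)) (act X (gam H) x) = x"
  using assms by (simp_all flip: left_module.act_mult[of H X])

lemma bb_map: "x \<in> carrier X \<Longrightarrow> map_of_arrow (bb_arrow X) x = act X (gam H) x"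
  by (simp add: bb_arrow_def)

lemma bb_mor: "left_module H X \<Longrightarrow> bb_arrow X \<in> mor X (bar (bar X))"
  unfolding bb_arrow_def by (rule mor_restrictI) (simp_all add: starT_starT)

lemma bb_inverse:
  assumes X: "left_module H X"
  shows "inverse_arrows (HMod H) X (bar (bar X)) (bb_arrow X)
    (Arrow (bar (bar X)) (restrict (act X (inv (gam H))) (carrier (bar (bar X)))) X)"
  by (rule mor_inverse[OF X _ bb_mor[OF X]]) (use X in \<open>simp_all add: bb_map\<close>)

lemma bb_natural:
  assumes X: "left_module H X" and Y: "left_module H Y" and f: "f \<in> mor X Y"
  shows "comp_arrow (bb_arrow Y) f = comp_arrow (bar_arrow (bar_arrow f)) (bb_arrow X)"
proof (rule mor_eqI)
  show "comp_arrow (bb_arrow Y) f \<in> mor X (bar (bar Y))"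
    "comp_arrow (bar_arrow (bar_arrow f)) (bb_arrow X) \<in> mor X (bar (bar Y))"
    using assms by (auto intro!: comp_mor bb_mor bar_mor)
qed (use assms mor_map[OF f] in \<open>simp add: comp_map_src mor_src[OF f] bb_map\<close>)

lemma bar_comp:
  assumes X: "left_module H X" and Y: "left_module H Y" and Z: "left_module H Z"
    and f: "f \<in> mor X Y" and g: "g \<in> mor Y Z"
  shows "bar_arrow (comp_arrow g f) = comp_arrow (bar_arrow g) (bar_arrow f)"
proof (rule mor_eqI)
  show "bar_arrow (comp_arrow g f) \<in> mor (bar X) (bar Z)"
    "comp_arrow (bar_arrow g) (bar_arrow f) \<in> mor (bar X) (bar Z)"
    using assms by (auto intro!: comp_mor bar_mor)
qed (use mor_src[OF f] in \<open>simp add: comp_map_src\<close>)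

lemma bar_id: "left_module H X \<Longrightarrow> bar_arrow (id_arrow X) = id_arrow (bar X)"
  by (simp add: bar_arrow_def id_arrow_def)

text \<open>Both arrows have the same underlying vectors; one acts by \<gamma> and the other by
  T(\<gamma>), so this is the axiom that \<open>T\<close> fixes \<gamma>.\<close>

lemma bar_bb:
  assumes X: "left_module H X"
  shows "bar_arrow (bb_arrow X) = bb_arrow (bar X)"
  by (rule mor_eqI[of _ "bar X" "bar (bar (bar X))"])
    (use X bb_mor[of "bar X"] in \<open>simp_all add: bb_mor bb_map\<close>)

section \<open>The isomorphism \<star>\<close>

lemma star_map: "map_of_arrow star_arrow (Scal k) = Scal (cnj k)"
  by (simp add: star_arrow_def)

text \<open>Equivariance of complex conjugation is the rule \<open>counit_starT\<close>.\<close>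

lemma star_mor: "star_arrow \<in> mor (unit_mod H) (bar (unit_mod H))"
  unfolding star_arrow_def by (rule mor_restrictI) (auto simp: counit_starT)

definition star_inv :: "('h, 'a) marrow" where
  "star_inv = Arrow (bar (unit_mod H))
     (restrict (\<lambda>z. Scal (cnj (scal_of z))) (carrier (bar (unit_mod H) :: ('h, 'a) umod))) (unit_mod H)"

lemma star_inverse: "inverse_arrows (HMod H) (unit_mod H) (bar (unit_mod H)) star_arrow star_inv"
  unfolding star_inv_def by (rule mor_inverse[OF _ _ star_mor]) (auto simp: star_map)

lemma star_inv_mor: "star_inv \<in> mor (bar (unit_mod H)) (unit_mod H)"
  by (rule star_inverse[unfolded inverse_arrows_def HMod_simps, THEN conjunct2, THEN conjunct1])

lemma star_inv_map: "map_of_arrow star_inv (Scal k) = Scal (cnj k)"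
  by (simp add: star_inv_def)

lemma star_inv_ends [simp]: "src star_inv = bar (unit_mod H)" "trg star_inv = unit_mod H"
  by (simp_all add: star_inv_def)

text \<open>\<open>inv_arrow\<close> is a definite description; uniqueness is what lets it be
  computed, in particular as \<open>star_inv\<close>.\<close>

lemma inverse_arrows_unique:
  assumes X: "left_module H X" and Y: "left_module H Y"
    and g: "inverse_arrows (HMod H) X Y f g" and g': "inverse_arrows (HMod H) X Y f g'"
  shows "g = g'"
proof -
  interpret category "HMod H" by (rule category_HMod)
  have o: "X \<in> Ob (HMod H)" "Y \<in> Ob (HMod H)"
    using X Y by simp_all
  have "g = (g' \<cdot>\<^bsub>HMod H\<^esub> f) \<cdot>\<^bsub>HMod H\<^esub> g"
    using Idn_left[OF o(2,1), of g] g g' unfolding inverse_arrows_def by simp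
  also have "\<dots> = g' \<cdot>\<^bsub>HMod H\<^esub> (f \<cdot>\<^bsub>HMod H\<^esub> g)"
    using Comp_assoc[OF o(2,1,2,1)] g g' unfolding inverse_arrows_def by blast
  also have "\<dots> = g'"
    using Idn_right[OF o(2,1), of g'] g g' unfolding inverse_arrows_def by simp
  finally show ?thesis .
qed

lemma inv_arrow_eq:
  assumes "left_module H X" "left_module H Y" "inverse_arrows (HMod H) X Y f g"
  shows "inv_arrow (HMod H) X Y f = g"
  unfolding inv_arrow_def by (rule the_equality) (use assms inverse_arrows_unique in blast)+

section \<open>The isomorphism \<Upsilon>\<close>

lemma balanced_ups:
  assumes "left_module H X" "left_module H Y" "a \<in> carrier H" "b \<in> carrier H"
  shows "balanced X Y ((bar Y) ** (bar X))
    (\<lambda>x y. pure (bar Y) (bar X) (act Y b y) (act X a x))"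
  by (rule balancedI) (use assms in simp_all)

lemma ups_map:
  assumes X: "left_module H X" and Y: "left_module H Y" and t: "t \<in> carrier (X ** Y)"
  shows "map_of_arrow (ups_arrow X Y) t = lsum ((bar Y) ** (bar X)) (map (\<lambda>p.
    lift ((bar Y) ** (bar X))
      (\<lambda>x y. pure (bar Y) (bar X) (act Y (snd p) y) (act X (fst p) x)) t) (gauge H))"
proof -
  let ?U = "(bar Y) ** (bar X)"
  have U: "left_module H ?U" using X Y by simp
  interpret T: two_modules X Y H using X Y by simp
  interpret T': two_modules "bar Y" "bar X" H using X Y by simp
  have q: "fst q \<in> carrier X" "snd q \<in> carrier Y" if "q \<in> set (tens_of t)" for q
    using T.tens_of_wf[OF t] that by auto
  let ?f = "\<lambda>p q. (act Y (snd p) (snd q), act X (fst p) (fst q))"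
  have cl: "fst (?f p q) \<in> carrier (bar Y)" "snd (?f p q) \<in> carrier (bar X)"
    if "p \<in> set (gauge H)" "q \<in> set (tens_of t)" for p q
    using X Y q[OF that(2)] that(1) by simp_all
  let ?l = "concat (map (\<lambda>p. map (?f p) (tens_of t)) (gauge H))"
  have "map_of_arrow (ups_arrow X Y) t = usum (bar Y) (bar X) ?l"
    using t by (simp add: ups_arrow_def split_def)
  also have "\<dots> = lsum ?U (map (\<lambda>x. pure (bar Y) (bar X) (fst x) (snd x)) ?l)"
    by (rule T'.usum_lsum, rule set_concat2_subset) (simp only: mem_Times_iff cl)
  also have "\<dots> = lsum ?U (map (\<lambda>p. lsum ?U (map (\<lambda>q.
      pure (bar Y) (bar X) (fst (?f p q)) (snd (?f p q))) (tens_of t))) (gauge H))"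
    unfolding map_concat map_map comp_def
    by (rule lsum_concat2_mod[OF U])
      (rule pure_closed[OF left_module_bar[OF Y] left_module_bar[OF X] cl])
  finally show ?thesis
    by (simp add: lift_def)
qed

lemma ups_pure:
  assumes X: "left_module H X" and Y: "left_module H Y" and xy: "x \<in> carrier X" "y \<in> carrier Y"
  shows "map_of_arrow (ups_arrow X Y) (pure X Y x y) = lsum ((bar Y) ** (bar X))
    (map (\<lambda>p. pure (bar Y) (bar X) (act Y (snd p) y) (act X (fst p) x)) (gauge H))"
proof -
  have U: "left_module H ((bar Y) ** (bar X))"
    using X Y by simp
  show ?thesis
    by (subst ups_map[OF X Y], use X Y xy in simp, rule left_module_lsum_cong[OF U],
        rule two_modules.lift_pure[OF two_modules_left[OF X Y] _ balanced_ups[OF X Y]])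
      (use U xy in simp_all)
qed

lemma ups_add_map:
  assumes X: "left_module H X" and Y: "left_module H Y"
  shows "add_map (X ** Y) ((bar Y) ** (bar X)) (map_of_arrow (ups_arrow X Y))"
proof -
  let ?U = "(bar Y) ** (bar X)"
  have "add_map (X ** Y) ?U (\<lambda>t. lsum ?U (map (\<lambda>p. lift ?U
      (\<lambda>x y. pure (bar Y) (bar X) (act Y (snd p) y) (act X (fst p) x)) t) (gauge H)))"
    using X Y by (intro add_map_lsum_pointwise two_modules.add_map_lift_mod balanced_ups) simp_all
  then show ?thesis
    using X Y by (simp add: add_map_def ups_map)
qed

lemma ups_lsum:
  assumes "left_module H X" "left_module H Y"
    and "\<And>p. p \<in> set l \<Longrightarrow> g p \<in> carrier (X ** Y)"
  shows "map_of_arrow (ups_arrow X Y) (lsum (X ** Y) (map g l)) =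
    lsum ((bar Y) ** (bar X)) (map (\<lambda>p. map_of_arrow (ups_arrow X Y) (g p)) l)"
  by (rule add_map_lsum[OF _ _ ups_add_map]) (use assms in simp_all)

text \<open>Conjugate-linear in both algebra elements, since the target consists of conjugate
  modules. It is balanced nevertheless, and so can be used to evaluate identities that involve the
  gauge.\<close>

lemma balanced_ups_elem:
  assumes "left_module H X" "left_module H Y" "x \<in> carrier X" "y \<in> carrier Y"
  shows "balanced H H ((bar Y) ** (bar X))
    (\<lambda>a b. pure (bar Y) (bar X) (act Y b y) (act X a x))"
  by (rule balancedI) (use assms in simp_all)

lemma ups_mor:
  assumes X: "left_module H X" and Y: "left_module H Y"
  shows "ups_arrow X Y \<in> mor (bar (X ** Y)) ((bar Y) ** (bar X))"
proof -
  let ?T = "X ** Y" and ?U = "(bar Y) ** (bar X)"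
  let ?f = "map_of_arrow (ups_arrow X Y)"
  have T: "left_module H ?T" and U: "left_module H ?U"
    using assms by simp_all
  have vs: "abelian_group ?U" using U by simp
  note add = ups_add_map[OF assms] and pure = ups_pure[OF assms]
  have "Arrow (bar ?T) (restrict ?f (carrier (bar ?T))) ?U \<in> mor (bar ?T) ?U"
  proof (rule mor_restrictI)
    fix c t
    assume t: "t \<in> carrier (bar ?T)"
    show "?f t \<in> carrier ?U"
      using add t by (simp add: add_map_def)
    have sm: "add_map M M (\<lambda>t. c \<odot>\<^bsub>M\<^esub> t)" if "left_module H M" for M :: "('h, 'a) umod" and c
      using that by (simp add: add_map_def)
    \<comment> \<open>The scalar c of the conjugate source is the conjugate of c on
      \<open>X ** Y\<close> itself.\<close>
    have "?f (cnj c \<odot>\<^bsub>?T\<^esub> t) = c \<odot>\<^bsub>?U\<^esub> ?f t"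
    proof (rule tens_ext2[OF X Y vs add_map_comp[OF sm[OF T] add] add_map_comp[OF add sm[OF U]]])
      fix x y
      assume xy: "x \<in> carrier X" "y \<in> carrier Y"
      have "?f (cnj c \<odot>\<^bsub>?T\<^esub> pure X Y x y) = ?f (pure X Y (cnj c \<odot>\<^bsub>X\<^esub> x) y)"
        using assms xy by simp
      also have "\<dots> = c \<odot>\<^bsub>?U\<^esub> ?f (pure X Y x y)"
        using assms xy by (subst (1 2) pure) (simp_all add: eval_simps cong: map_cong)
      finally show "?f (cnj c \<odot>\<^bsub>?T\<^esub> pure X Y x y) = c \<odot>\<^bsub>?U\<^esub> ?f (pure X Y x y)" .
    qed (use t in simp)
    then show "?f (c \<odot>\<^bsub>bar ?T\<^esub> t) = c \<odot>\<^bsub>?U\<^esub> ?f t" by simp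
  next
    fix h t
    assume h: "h \<in> carrier H" and t: "t \<in> carrier (bar ?T)"
    have ac: "add_map M M (act M k)" if "left_module H M" "k \<in> carrier H" for M :: "('h, 'a) umod" and k
      using that by (simp add: add_map_def)
    have "?f (act ?T (starT H h) t) = act ?U h (?f t)"
    proof (rule tens_ext2[OF X Y vs add_map_comp[OF ac[OF T] add] add_map_comp[OF add ac[OF U]]])
      fix x y
      assume xy: "x \<in> carrier X" "y \<in> carrier Y"
      let ?F = "\<lambda>a b. pure (bar Y) (bar X) (act Y b y) (act X a x)"
      note F = balanced_ups_elem[OF assms xy]
      have "?f (act ?T (starT H h) (pure X Y x y)) =
          lsum2 ?U ?F (gauge H \<otimes>\<^bsub>tens2 H\<^esub> comul H (starT H h))"
        using assms xy h
        by (subst tens2_mult_eval_rev[OF vs F gauge_closed comul_closed])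
          (simp_all add: eval_simps ups_lsum pure cong: map_cong)
      \<comment> \<open>On the target, h acts by \<open>T\<close> of its first leg on
        \<open>Y\<close> and by \<open>T\<close> of its second leg on \<open>X\<close>. Since the
        arguments of \<open>?F\<close> belong to \<open>X\<close> and \<open>Y\<close> in this
        order, the transposition in the formula for the coproduct of \<open>T\<close> h
        appears.\<close>
      also have "\<dots> = act ?U h (?f (pure X Y x y))"
        unfolding gauge_comul_starT[OF h] using assms xy h
        by (subst tens2_mult_tsum_eval[OF vs F flip_starT_wf[OF comul_closed[OF h]] gauge_closed])
          (simp add: eval_simps pure cong: map_cong)
      finally show "?f (act ?T (starT H h) (pure X Y x y)) = act ?U h (?f (pure X Y x y))" .
    qed (use h t in simp_all)
    then show "?f (act (bar ?T) h t) = act ?U h (?f t)" by simp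
  qed (use add T in \<open>simp_all add: add_map_def\<close>)
  moreover have "restrict ?f (carrier (bar ?T)) = ?f"
    by (simp add: ups_arrow_def)
  ultimately show ?thesis
    by (simp add: mor_iff)
qed

definition ups_inv where
  "ups_inv X Y t = lsum (X ** Y) (map (\<lambda>p.
    lift (X ** Y) (\<lambda>y x. pure X Y (act X (fst p) x) (act Y (snd p) y)) t) (inv\<^bsub>tens2 H\<^esub> (gauge H)))"

lemma balanced_ups_inv:
  assumes "left_module H X" "left_module H Y" "a \<in> carrier H" "b \<in> carrier H"
  shows "balanced (bar Y) (bar X) (X ** Y) (\<lambda>y x. pure X Y (act X a x) (act Y b y))"
  by (rule balancedI) (use assms in simp_all)

lemma ups_inv_pure:
  assumes X: "left_module H X" and Y: "left_module H Y" and xy: "x \<in> carrier X" "y \<in> carrier Y"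
  shows "ups_inv X Y (pure (bar Y) (bar X) y x) = lsum (X ** Y)
    (map (\<lambda>p. pure X Y (act X (fst p) x) (act Y (snd p) y)) (inv\<^bsub>tens2 H\<^esub> (gauge H)))"
  unfolding ups_inv_def
  by (rule left_module_lsum_cong[OF left_module_tens[OF X Y]],
      rule two_modules.lift_pure[OF _ _ balanced_ups_inv[OF X Y]])
    (use X Y xy in simp_all)

lemma ups_inv_add_map:
  assumes X: "left_module H X" and Y: "left_module H Y"
  shows "add_map ((bar Y) ** (bar X)) (X ** Y) (ups_inv X Y)"
  unfolding ups_inv_def
  using X Y by (intro add_map_lsum_pointwise two_modules.add_map_lift_mod balanced_ups_inv) simp_all

lemma ups_iso:
  assumes X: "left_module H X" and Y: "left_module H Y"
  shows "iso_arrow (HMod H) (bar (X ** Y)) ((bar Y) ** (bar X)) (ups_arrow X Y)"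
proof (rule mor_isoI[OF _ _ ups_mor[OF assms], where g="ups_inv X Y"])
  let ?T = "X ** Y" and ?U = "(bar Y) ** (bar X)"
  let ?f = "map_of_arrow (ups_arrow X Y)" and ?g = "ups_inv X Y"
  show "left_module H (bar ?T)" "left_module H ?U"
    using assms by simp_all
  have T: "abelian_group ?T" and U: "abelian_group ?U"
    using assms by simp_all
  have id: "add_map M M (\<lambda>x. x)" for M :: "('h, 'a) umod"
    by (simp add: add_map_def)
  note f = ups_add_map[OF assms] and g = ups_inv_add_map[OF assms]
  have lsum: "?g (lsum ?U (map k l)) = lsum ?T (map (\<lambda>x. ?g (k x)) l)"
    if "\<And>x. x \<in> set l \<Longrightarrow> k x \<in> carrier ?U" for k and l :: "('h \<times> 'h) list"
    by (rule add_map_lsum[OF _ _ g]) (use assms that in simp_all)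
  show "?g y \<in> carrier (bar ?T)" if "y \<in> carrier ?U" for y
    using g that by (simp add: add_map_def)
  show "?g (?f t) = t" if t: "t \<in> carrier (bar ?T)" for t
  proof (rule tens_ext2[OF X Y T add_map_comp[OF f g] id])
    fix x y
    assume xy: "x \<in> carrier X" "y \<in> carrier Y"
    let ?F = "\<lambda>a b. pure X Y (act X a x) (act Y b y)"
    note F = balanced_act_elem[OF assms xy]
    have "?g (?f (pure X Y x y)) =
        lsum2 ?T ?F (inv\<^bsub>tens2 H\<^esub> (gauge H) \<otimes>\<^bsub>tens2 H\<^esub> gauge H)"
      using assms xy
      by (subst tens2_mult_eval_rev[OF T F gauge_inv_closed gauge_closed])
        (simp add: lsum ups_pure ups_inv_pure cong: map_cong)
    also have "\<dots> = pure X Y x y"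
      unfolding gauge_inverse using assms xy by (subst tens2_one_eval[OF T F]) simp
    finally show "?g (?f (pure X Y x y)) = pure X Y x y" .
  qed (use t in simp)
  show "?f (?g t) = t" if t: "t \<in> carrier ?U" for t
  proof (rule tens_ext2[OF left_module_bar[OF Y] left_module_bar[OF X] U add_map_comp[OF g f] id _ t])
    fix y x
    assume "y \<in> carrier (bar Y)" "x \<in> carrier (bar X)"
    then have xy: "x \<in> carrier X" "y \<in> carrier Y" by simp_all
    let ?F = "\<lambda>a b. pure (bar Y) (bar X) (act Y b y) (act X a x)"
    note F = balanced_ups_elem[OF assms xy]
    have "?f (?g (pure (bar Y) (bar X) y x)) =
        lsum2 ?U ?F (gauge H \<otimes>\<^bsub>tens2 H\<^esub> inv\<^bsub>tens2 H\<^esub> (gauge H))"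
      using assms xy
      by (subst tens2_mult_eval_rev[OF U F gauge_closed gauge_inv_closed])
        (simp add: ups_lsum ups_pure ups_inv_pure cong: map_cong)
    also have "\<dots> = pure (bar Y) (bar X) y x"
      unfolding gauge_inverse using assms xy by (subst tens2_one_eval[OF U F]) simp
    finally show "?f (?g (pure (bar Y) (bar X) y x)) = pure (bar Y) (bar X) y x" .
  qed
qed

section \<open>Naturality of \<Upsilon> and its compatibility with the units and the
  associator\<close>

lemma ups_natural:
  assumes "left_module H X" "left_module H X'" "left_module H Y" "left_module H Y'"
    and f: "f \<in> mor X X'" and g: "g \<in> mor Y Y'"
  shows "comp_arrow (ups_arrow X' Y') (bar_arrow (tens_arrow H f g)) =
    comp_arrow (tens_arrow H (bar_arrow g) (bar_arrow f)) (ups_arrow X Y)"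
proof (rule mor_ext2)
  have 1: "tens_arrow H f g \<in> mor (X ** Y) (X' ** Y')"
    "tens_arrow H (bar_arrow g) (bar_arrow f) \<in>
      mor ((bar Y) ** (bar X)) ((bar Y') ** (bar X'))"
    using assms by (auto intro!: tens_arrow_mor bar_mor)
  show "comp_arrow (ups_arrow X' Y') (bar_arrow (tens_arrow H f g)) \<in>
      mor (bar (X ** Y)) ((bar Y') ** (bar X'))"
    "comp_arrow (tens_arrow H (bar_arrow g) (bar_arrow f)) (ups_arrow X Y) \<in>
      mor (bar (X ** Y)) ((bar Y') ** (bar X'))"
    using assms 1 by (auto intro!: comp_mor bar_mor ups_mor)
  fix x y
  assume "x \<in> carrier X" "y \<in> carrier Y"
  moreover note mor_map[OF f] mor_map[OF g]
  moreover note src = mor_src[OF f] mor_src[OF g] mor_trg[OF f] mor_trg[OF g]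
  moreover have "bar_arrow f \<in> mor (bar X) (bar X')" "bar_arrow g \<in> mor (bar Y) (bar Y')"
    using assms by simp_all
  ultimately show "map_of_arrow (comp_arrow (ups_arrow X' Y') (bar_arrow (tens_arrow H f g))) (pure X Y x y) =
      map_of_arrow (comp_arrow (tens_arrow H (bar_arrow g) (bar_arrow f)) (ups_arrow X Y)) (pure X Y x y)"
    using assms 1
    by (simp add: comp_map_src src tens_arrow_pure_trg ups_pure mor_lsum_trg cong: map_cong)
qed (use assms in simp_all)

text \<open>The second leg of the gauge acts on the unit object by its counit.
  \<open>star_inv\<close> conjugates this scalar, and moving it to the conjugate module conjugates
  it back, so that the normalisation of the gauge in its second leg applies.\<close>

lemma ups_unit_right:
  assumes X: "left_module H X"
  shows "comp_arrow (comp_arrow (tens_arrow H star_inv (id_arrow (bar X))) (ups_arrow X (unit_mod H)))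
      (bar_arrow (lunit_arrow X)) = runit_arrow (bar X)"
proof (rule mor_eqI)
  let ?U = "(unit_mod H) ** (bar X)"
  have t: "tens_arrow H star_inv (id_arrow (bar X)) \<in> mor ((bar (unit_mod H)) ** (bar X)) ?U"
    using X by (intro tens_arrow_mor star_inv_mor id_mor) simp_all
  have l: "bar_arrow (lunit_arrow X) \<in> mor (bar X) (bar (X ** (unit_mod H)))"
    using X by (intro bar_mor lunit_mor)
  show "comp_arrow (comp_arrow (tens_arrow H star_inv (id_arrow (bar X))) (ups_arrow X (unit_mod H)))
      (bar_arrow (lunit_arrow X)) \<in> mor (bar X) ?U"
    using X by (intro comp_mor[OF _ l] comp_mor[OF _ ups_mor t]) simp_all
  show "runit_arrow (bar X) \<in> mor (bar X) ?U"
    using X by (intro runit_mor) simp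
  fix x
  assume "x \<in> carrier (bar X)"
  then have x: "x \<in> carrier X" by simp
  have eps: "pure (unit_mod H) (bar X) (Scal (cnj (counit H h))) y =
      pure (unit_mod H) (bar X) (Scal 1) (counit H h \<odot>\<^bsub>X\<^esub> y)" if "y \<in> carrier X" for h y
    using pure_unit_left[of "bar X" y "cnj (counit H h)"] X that by simp
  have "map_of_arrow (comp_arrow (comp_arrow (tens_arrow H star_inv (id_arrow (bar X))) (ups_arrow X (unit_mod H)))
      (bar_arrow (lunit_arrow X))) x = lsum ?U (map (\<lambda>p. pure (unit_mod H) (bar X) (Scal 1)
        (counit H (snd p) \<odot>\<^bsub>X\<^esub> act X (fst p) x)) (gauge H))"
    using X x t
    by (simp add: comp_map_src lunit_map ups_pure mor_lsum_trg tens_arrow_pure_trg star_inv_mor star_inv_map eps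
        del: pure_smult pure_bar_smult cong: map_cong)
  also have "\<dots> = pure (unit_mod H) (bar X) (Scal 1)
      (act X (lsum H (map (\<lambda>p. counit H (snd p) \<odot> fst p) (gauge H))) x)"
    using X x by (simp add: lsum_act_elem pure_bar_lsum del: pure_smult pure_bar_smult cong: map_cong)
  also have "\<dots> = map_of_arrow (runit_arrow (bar X)) x"
    using X x gauge_counit_right by (simp add: split_def runit_map)
  finally show "map_of_arrow (comp_arrow (comp_arrow (tens_arrow H star_inv (id_arrow (bar X)))
      (ups_arrow X (unit_mod H))) (bar_arrow (lunit_arrow X))) x = map_of_arrow (runit_arrow (bar X)) x" .
qed

text \<open>The mirror image, with the normalisation of the gauge in its first leg.\<close>

lemma ups_unit_left:
  assumes X: "left_module H X"
  shows "comp_arrow (comp_arrow (tens_arrow H (id_arrow (bar X)) star_inv) (ups_arrow (unit_mod H) X))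
      (bar_arrow (runit_arrow X)) = lunit_arrow (bar X)"
proof (rule mor_eqI)
  let ?U = "(bar X) ** (unit_mod H)"
  have t: "tens_arrow H (id_arrow (bar X)) star_inv \<in> mor ((bar X) ** (bar (unit_mod H))) ?U"
    using X by (intro tens_arrow_mor star_inv_mor id_mor) simp_all
  have l: "bar_arrow (runit_arrow X) \<in> mor (bar X) (bar ((unit_mod H) ** X))"
    using X by (intro bar_mor runit_mor)
  show "comp_arrow (comp_arrow (tens_arrow H (id_arrow (bar X)) star_inv) (ups_arrow (unit_mod H) X))
      (bar_arrow (runit_arrow X)) \<in> mor (bar X) ?U"
    using X by (intro comp_mor[OF _ l] comp_mor[OF _ ups_mor t]) simp_all
  show "lunit_arrow (bar X) \<in> mor (bar X) ?U"
    using X by (intro lunit_mor) simp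
  fix x
  assume "x \<in> carrier (bar X)"
  then have x: "x \<in> carrier X" by simp
  have eps: "pure (bar X) (unit_mod H) y (Scal (cnj (counit H h))) =
      pure (bar X) (unit_mod H) (counit H h \<odot>\<^bsub>X\<^esub> y) (Scal 1)" if "y \<in> carrier X" for h y
    using pure_unit_right[of "bar X" y "cnj (counit H h)"] X that by simp
  have "map_of_arrow (comp_arrow (comp_arrow (tens_arrow H (id_arrow (bar X)) star_inv) (ups_arrow (unit_mod H) X))
      (bar_arrow (runit_arrow X))) x = lsum ?U (map (\<lambda>p. pure (bar X) (unit_mod H)
        (counit H (fst p) \<odot>\<^bsub>X\<^esub> act X (snd p) x) (Scal 1)) (gauge H))"
    using X x t
    by (simp add: comp_map_src runit_map ups_pure mor_lsum_trg tens_arrow_pure_trg star_inv_mor star_inv_map eps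
        del: pure_smult pure_bar_smult cong: map_cong)
  also have "\<dots> = pure (bar X) (unit_mod H)
      (act X (lsum H (map (\<lambda>p. counit H (fst p) \<odot> snd p) (gauge H))) x) (Scal 1)"
    using X x by (simp add: lsum_act_elem pure_bar_lsum del: pure_smult pure_bar_smult cong: map_cong)
  also have "\<dots> = map_of_arrow (lunit_arrow (bar X)) x"
    using X x gauge_counit_left by (simp add: split_def lunit_map)
  finally show "map_of_arrow (comp_arrow (comp_arrow (tens_arrow H (id_arrow (bar X)) star_inv)
      (ups_arrow (unit_mod H) X)) (bar_arrow (runit_arrow X))) x = map_of_arrow (lunit_arrow (bar X)) x" .
qed

lemma trilinear_ups:
  assumes "left_module H X" "left_module H Y" "left_module H Z"
    and "x \<in> carrier X" "y \<in> carrier Y" "z \<in> carrier Z"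
  shows "trilinear H H H ((bar Z) ** ((bar Y) ** (bar X)))
    (\<lambda>a b c. pure (bar Z) ((bar Y) ** (bar X)) (act Z c z)
      (pure (bar Y) (bar X) (act Y b y) (act X a x)))"
  unfolding trilinear_def by (intro conjI ballI balancedI; use assms in simp)

lemma ups_assoc:
  assumes X: "left_module H X" and Y: "left_module H Y" and Z: "left_module H Z"
  shows "comp_arrow (comp_arrow (comp_arrow (assoc_arrow H (bar Z) (bar Y) (bar X))
      (tens_arrow H (ups_arrow Y Z) (id_arrow (bar X)))) (ups_arrow X (Y ** Z)))
      (bar_arrow (assoc_arrow H X Y Z)) =
    comp_arrow (tens_arrow H (id_arrow (bar Z)) (ups_arrow X Y)) (ups_arrow (X ** Y) Z)"
    (is "?L = ?R")
proof (rule mor_ext3[OF assms])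
  let ?T = "bar ((X ** Y) ** Z)"
  let ?U = "(bar Z) ** ((bar Y) ** (bar X))"
  show U: "left_module H ?U" using assms by simp
  then have vs: "abelian_group ?U" by simp
  have 1: "bar_arrow (assoc_arrow H X Y Z) \<in> mor ?T (bar (X ** (Y ** Z)))"
    "ups_arrow X (Y ** Z) \<in>
      mor (bar (X ** (Y ** Z))) ((bar (Y ** Z)) ** (bar X))"
    "tens_arrow H (ups_arrow Y Z) (id_arrow (bar X)) \<in>
      mor ((bar (Y ** Z)) ** (bar X)) (((bar Z) ** (bar Y)) ** (bar X))"
    "assoc_arrow H (bar Z) (bar Y) (bar X) \<in>
      mor (((bar Z) ** (bar Y)) ** (bar X)) ?U"
    "tens_arrow H (id_arrow (bar Z)) (ups_arrow X Y) \<in>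
      mor ((bar Z) ** (bar (X ** Y))) ?U"
    "ups_arrow (X ** Y) Z \<in> mor ?T ((bar Z) ** (bar (X ** Y)))"
    "ups_arrow Y Z \<in> mor (bar (Y ** Z)) ((bar Z) ** (bar Y))"
    "ups_arrow X Y \<in> mor (bar (X ** Y)) ((bar Y) ** (bar X))"
    using assms by (auto intro!: assoc_mor tens_arrow_mor ups_mor bar_mor id_mor)
  show "?L \<in> mor ?T ?U" "?R \<in> mor ?T ?U"
    using assms 1 by (auto intro!: comp_mor)
  fix x y z
  assume xyz: "x \<in> carrier X" "y \<in> carrier Y" "z \<in> carrier Z"
  let ?p = "pure (X ** Y) Z (pure X Y x y) z"
  let ?F = "\<lambda>a b c. pure (bar Z) ((bar Y) ** (bar X)) (act Z c z)
      (pure (bar Y) (bar X) (act Y b y) (act X a x))"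
  let ?G = "\<lambda>p. ?F (fst p) (fst (snd p)) (snd (snd p))"
  let ?P = "triples (reassoc H)"
  \<comment> \<open>One list per arrow. On the left side \<open>?P\<close>, \<open>?C\<close>,
    \<open>?B\<close>, \<open>?A\<close> belong to the four arrows in the order in which they are
    applied; on the right side \<open>?E\<close> is applied before \<open>?D\<close>. The reversal
    of \<phi> in \<open>?A\<close> occurs because the conjugates are tensored in the opposite
    order.\<close>
  let ?A = "[(starT H c, starT H b, starT H a). (a, b, c) \<leftarrow> triples (reassoc H)]"
  let ?B = "[(\<one>, a, b). (a, b) \<leftarrow> gauge H]"
  let ?C = "[(a, b, c). (a, d) \<leftarrow> gauge H, (b, c) \<leftarrow> comul H d]"
  let ?D = "[(a, b, \<one>). (a, b) \<leftarrow> gauge H]"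
  let ?E = "[(a, b, c). (d, c) \<leftarrow> gauge H, (a, b) \<leftarrow> comul H d]"
  have A: "wf3 ?A"
    using triples_wf[OF reassoc_closed] by auto
  have B: "wf3 ?B" and D: "wf3 ?D"
    using tens2_wf[OF gauge_closed] by auto
  have C: "wf3 ?C" and E: "wf3 ?E"
    unfolding split_def by (rule set_concat2_subset; simp add: mem_Times_iff)+
  note P = triples_wf[OF reassoc_closed]
  interpret M: monoid "tens3 H" by (rule tens3_monoid)
  \<comment> \<open>The cocycle condition is multiplied by \<phi> from the right, which removes the
    inverse.\<close>
  have "tsum3 H (prod3 (prod3 (prod3 ?A ?B) ?C) ?P) =
      tsum3 H ?A \<otimes>\<^bsub>tens3 H\<^esub> tsum3 H ?B \<otimes>\<^bsub>tens3 H\<^esub> tsum3 H ?C \<otimes>\<^bsub>tens3 H\<^esub> reassoc H"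
    using tsum3_prod[OF A B] tsum3_prod[OF prod3_wf[OF A B] C]
      tsum3_prod[OF prod3_wf[OF prod3_wf[OF A B] C] P] by (simp only: tsum3_triples[OF reassoc_closed])
  also have "\<dots> = tsum3 H ?D \<otimes>\<^bsub>tens3 H\<^esub> tsum3 H ?E"
    unfolding gauge_reassoc using reassoc_closed reassoc_inv_closed reassoc_unit tsum3_closed[OF D] tsum3_closed[OF E]
    by (simp only: M.m_assoc M.m_closed M.Units_l_inv M.r_one)
  finally have eq: "tsum3 H (prod3 (prod3 (prod3 ?A ?B) ?C) ?P) = tsum3 H (prod3 ?D ?E)"
    by (simp only: tsum3_prod[OF D E])
  have "map_of_arrow ?R ?p = lsum ?U (map ?G (prod3 ?D ?E))"
    using assms xyz 1
    by (subst lsum_prod3[OF vs D E])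
      (simp_all add: comp_map_src eval_simps ups_pure mor_lsum_trg tens_arrow_pure_trg cong: map_cong)
  also have "\<dots> = lsum ?U (map ?G (prod3 (prod3 (prod3 ?A ?B) ?C) ?P))"
    by (rule trilinear_eval[OF vs trilinear_ups[OF assms xyz] prod3_wf[OF D E]
        prod3_wf[OF prod3_wf[OF prod3_wf[OF A B] C] P] eq[symmetric]])
  \<comment> \<open>The fourfold product is expanded from its right end, one factor at a time, each
    time below the sums already opened.\<close>
  also have "\<dots> = lsum ?U (map (\<lambda>s. lsum ?U (map (\<lambda>r. lsum ?U (map (\<lambda>q. lsum ?U (map (\<lambda>p.
      ?F (fst p \<otimes> fst q \<otimes> fst r \<otimes> fst s) (fst (snd p) \<otimes> fst (snd q) \<otimes> fst (snd r) \<otimes> fst (snd s))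
        (snd (snd p) \<otimes> snd (snd q) \<otimes> snd (snd r) \<otimes> snd (snd s))) ?A)) ?B)) ?C)) ?P)"
  proof -
    have mem: "fst s \<in> carrier H" "fst (snd s) \<in> carrier H" "snd (snd s) \<in> carrier H"
      if "wf3 l" "s \<in> set l" for l s
      using that by auto
    have "lsum ?U (map (\<lambda>q. ?F (fst q \<otimes> a) (fst (snd q) \<otimes> b) (snd (snd q) \<otimes> c)) (prod3 (prod3 ?A ?B) ?C)) =
        lsum ?U (map (\<lambda>r. lsum ?U (map (\<lambda>q. ?F (fst q \<otimes> fst r \<otimes> a) (fst (snd q) \<otimes> fst (snd r) \<otimes> b)
          (snd (snd q) \<otimes> snd (snd r) \<otimes> c)) (prod3 ?A ?B))) ?C)"
      if "a \<in> carrier H" "b \<in> carrier H" "c \<in> carrier H" for a b c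
      using that assms xyz by (subst lsum_prod3[OF vs prod3_wf[OF A B] C]) simp_all
    moreover have "lsum ?U (map (\<lambda>q. ?F (fst q \<otimes> a' \<otimes> a) (fst (snd q) \<otimes> b' \<otimes> b) (snd (snd q) \<otimes> c' \<otimes> c)) (prod3 ?A ?B)) =
        lsum ?U (map (\<lambda>q. lsum ?U (map (\<lambda>p. ?F (fst p \<otimes> fst q \<otimes> a' \<otimes> a) (fst (snd p) \<otimes> fst (snd q) \<otimes> b' \<otimes> b)
          (snd (snd p) \<otimes> snd (snd q) \<otimes> c' \<otimes> c)) ?A)) ?B)"
      if "a \<in> carrier H" "b \<in> carrier H" "c \<in> carrier H" "a' \<in> carrier H" "b' \<in> carrier H" "c' \<in> carrier H"
      for a b c a' b' c'
      using that assms xyz by (subst lsum_prod3[OF vs A B]) simp_all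
    moreover have "lsum ?U (map ?G (prod3 (prod3 (prod3 ?A ?B) ?C) ?P)) =
        lsum ?U (map (\<lambda>s. lsum ?U (map (\<lambda>q. ?F (fst q \<otimes> fst s) (fst (snd q) \<otimes> fst (snd s))
          (snd (snd q) \<otimes> snd (snd s))) (prod3 (prod3 ?A ?B) ?C))) ?P)"
      using assms xyz by (subst lsum_prod3[OF vs prod3_wf[OF prod3_wf[OF A B] C] P]) simp_all
    ultimately show ?thesis
      by (simp only: mem[OF P] mem[OF C] cong: map_cong)
  qed
  also have "\<dots> = map_of_arrow ?L ?p"
    using assms xyz 1
    by (simp add: comp_map_src eval_simps assoc_pure ups_pure mor_lsum_trg mor_lsum_trg_bar
        tens_arrow_pure_trg cong: map_cong)
  finally show "map_of_arrow ?L ?p = map_of_arrow ?R ?p" ..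
qed simp

text \<open>Two complex conjugations compose to the identity, while bb at the unit object multiplies
  by \<epsilon>(\<gamma>). This is where the premise enters.\<close>

lemma star_star:
  assumes "counit H (gam H) = 1"
  shows "comp_arrow (bar_arrow star_arrow) star_arrow = (bb_arrow (unit_mod H) :: ('h, 'a) marrow)"
proof (rule mor_eqI)
  show "comp_arrow (bar_arrow star_arrow) star_arrow \<in> mor (unit_mod H) (bar (bar (unit_mod H)))"
    by (intro comp_mor[OF _ star_mor] bar_mor star_mor) simp_all
  show "bb_arrow (unit_mod H) \<in> mor (unit_mod H) (bar (bar (unit_mod H)))"
    by (rule bb_mor) simp
qed (use assms in \<open>auto simp: comp_map_src star_map bb_map\<close>)

lemma inv_star: "inv_arrow (HMod H) (unit_mod H) (bar (unit_mod H)) star_arrow = star_inv"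
  by (rule inv_arrow_eq[OF left_module_unit left_module_bar[OF left_module_unit] star_inverse])

lemma bar_HMod:
  assumes "counit H (gam H) = 1"
  shows "bar_category (HMod H)"
proof (intro bar_category.intro monoidal_HMod bar_category_axioms.intro)
  show "iso_arrow (HMod H) (Unit (HMod H)) (BarO (HMod H) (Unit (HMod H))) (Star (HMod H))"
    using star_inverse unfolding iso_arrow_def HMod_simps by blast
qed (use bb_inverse in
    \<open>auto simp: inv_star bar_id bar_comp bb_natural ups_iso ups_natural ups_unit_right ups_unit_left ups_assoc
      star_star[OF assms] bar_bb iso_arrow_def[of _ _ _ "bb_arrow _"]\<close>)

section \<open>The coboundary\<close>

lemma tens_inverse:
  assumes "left_module H X" "left_module H X'" "left_module H Y" "left_module H Y'"
    and f: "inverse_arrows (HMod H) X X' f f'" and g: "inverse_arrows (HMod H) Y Y' g g'"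
  shows "inverse_arrows (HMod H) (X ** Y) (X' ** Y') (tens_arrow H f g) (tens_arrow H f' g')"
proof -
  have m: "f \<in> mor X X'" "f' \<in> mor X' X" "g \<in> mor Y Y'" "g' \<in> mor Y' Y"
    and eq: "comp_arrow f' f = id_arrow X" "comp_arrow f f' = id_arrow X'"
      "comp_arrow g' g = id_arrow Y" "comp_arrow g g' = id_arrow Y'"
    using f g by (auto simp: inverse_arrows_def)
  show ?thesis
    using assms(1-4) m eq tens_comp[OF assms(1,2,1,3,4,3) m] tens_comp[OF assms(2,1,2,4,3,4) m(2,1,4,3)]
    by (simp add: inverse_arrows_def tens_arrow_mor tens_id)
qed

lemma bar_iso:
  assumes "left_module H X" "left_module H Y" "iso_arrow (HMod H) X Y f"
  shows "iso_arrow (HMod H) (bar X) (bar Y) (bar_arrow f)"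
proof -
  obtain g where m: "f \<in> mor X Y" "g \<in> mor Y X"
    and eq: "comp_arrow g f = id_arrow X" "comp_arrow f g = id_arrow Y"
    using assms(3) by (auto simp: iso_arrow_def inverse_arrows_def)
  then have "inverse_arrows (HMod H) (bar X) (bar Y) (bar_arrow f) (bar_arrow g)"
    using assms(1,2) bar_comp[OF assms(1,2,1) m] bar_comp[OF assms(2,1,2) m(2,1)]
    by (simp add: inverse_arrows_def bar_id)
  then show ?thesis
    by (auto simp: iso_arrow_def)
qed

definition bb_inv where
  "bb_inv X = Arrow (bar (bar X))
    (restrict (act X (inv (gam H))) (carrier (bar (bar X)))) X"

lemma bb_inv_inverse:
  "left_module H X \<Longrightarrow> inverse_arrows (HMod H) X (bar (bar X)) (bb_arrow X) (bb_inv X)"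
  unfolding bb_inv_def by (rule bb_inverse)

lemma bb_inv_mor: "left_module H X \<Longrightarrow> bb_inv X \<in> mor (bar (bar X)) X"
  using bb_inv_inverse[of X] by (auto simp: inverse_arrows_def)

lemma bb_inv_map: "x \<in> carrier X \<Longrightarrow> map_of_arrow (bb_inv X) x = act X (inv (gam H)) x"
  by (simp add: bb_inv_def)

lemma bb_inv_ends [simp]: "src (bb_inv X) = bar (bar X)" "trg (bb_inv X) = X"
  by (simp_all add: bb_inv_def)

text \<open>The right-hand side of the equation that defines the coboundary.\<close>

definition ups_ups where
  "ups_ups X Y = comp_arrow (comp_arrow (ups_arrow (bar Y) (bar X)) (bar_arrow (ups_arrow X Y)))
    (bb_arrow (X ** Y))"

text \<open>The solution of the defining equation, obtained by inverting the tensor product of the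
  two arrows bb.\<close>

definition cobound where
  "cobound X Y = comp_arrow (tens_arrow H (bb_inv X) (bb_inv Y)) (ups_ups X Y)"

section \<open>The coboundary of a fixed pair of modules\<close>

context
  fixes X Y :: "('h, 'a) umod"
  assumes X: "left_module H X" and Y: "left_module H Y"
begin

abbreviation "XY \<equiv> X ** Y"
abbreviation "XY'' \<equiv> (bar (bar X)) ** (bar (bar Y))"

lemma XY_modules: "left_module H XY" "left_module H XY''"
  using X Y by simp_all

lemma ups_ups_parts:
  "bb_arrow XY \<in> mor XY (bar (bar XY))"
  "bar_arrow (ups_arrow X Y) \<in>
    mor (bar (bar XY)) (bar ((bar Y) ** (bar X)))"
  "ups_arrow (bar Y) (bar X) \<in> mor (bar ((bar Y) ** (bar X))) XY''"
  using X Y by (auto intro!: bb_mor bar_mor ups_mor)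

lemma ups_ups_mor: "ups_ups X Y \<in> mor XY XY''"
  unfolding ups_ups_def using X Y ups_ups_parts by (auto intro!: comp_mor)

lemma bb_tens_inverse:
  "inverse_arrows (HMod H) XY XY'' (tens_arrow H (bb_arrow X) (bb_arrow Y)) (tens_arrow H (bb_inv X) (bb_inv Y))"
  using X Y by (intro tens_inverse bb_inv_inverse) simp_all

lemma cobound_mor: "cobound X Y \<in> mor XY XY"
  unfolding cobound_def
  using X Y bb_tens_inverse by (intro comp_mor[OF _ ups_ups_mor]) (simp_all add: inverse_arrows_def)

text \<open>The tensor product of the arrows bb is invertible, so the defining equation has at most
  one solution. Stated for an arbitrary \<open>f\<close>, it also serves the strong case, where
  \<open>f\<close> is the identity.\<close>

lemma coboundary_eqI:
  assumes f: "f \<in> mor XY XY" and eq: "comp_arrow (tens_arrow H (bb_arrow X) (bb_arrow Y)) f = ups_ups X Y"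
  shows "coboundary (HMod H) X Y = f"
proof -
  interpret category "HMod H" by (rule category_HMod)
  have o: "XY \<in> Ob (HMod H)" "XY'' \<in> Ob (HMod H)"
    using XY_modules by simp_all
  have inv: "tens_arrow H (bb_arrow X) (bb_arrow Y) \<in> Hom (HMod H) XY XY''"
    "tens_arrow H (bb_inv X) (bb_inv Y) \<in> Hom (HMod H) XY'' XY"
    "comp_arrow (tens_arrow H (bb_inv X) (bb_inv Y)) (tens_arrow H (bb_arrow X) (bb_arrow Y)) = id_arrow XY"
    using bb_tens_inverse by (simp_all add: inverse_arrows_def)
  have uniq: "g = cobound X Y" if g: "g \<in> mor XY XY"
    and "comp_arrow (tens_arrow H (bb_arrow X) (bb_arrow Y)) g = ups_ups X Y" for g
  proof -
    have "g = comp_arrow (id_arrow XY) g"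
      using Idn_left[OF o(1,1), of g] g by simp
    also have "\<dots> = comp_arrow (tens_arrow H (bb_inv X) (bb_inv Y)) (ups_ups X Y)"
      using Comp_assoc[OF o(1,1,2,1) _ inv(1,2), of g] that inv(3) by simp
    finally show ?thesis by (simp add: cobound_def)
  qed
  show ?thesis
    unfolding coboundary_def
  proof (rule the_equality)
    show "f \<in> Hom (HMod H) (X \<boxtimes>\<^bsub>HMod H\<^esub> Y) (X \<boxtimes>\<^bsub>HMod H\<^esub> Y) \<and>
      (BB (HMod H) X \<boxdot>\<^bsub>HMod H\<^esub> BB (HMod H) Y) \<cdot>\<^bsub>HMod H\<^esub> f =
      Ups (HMod H) (BarO (HMod H) Y) (BarO (HMod H) X) \<cdot>\<^bsub>HMod H\<^esub> BarM (HMod H) (Ups (HMod H) X Y) \<cdot>\<^bsub>HMod H\<^esub>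
        BB (HMod H) (X \<boxtimes>\<^bsub>HMod H\<^esub> Y)"
      using f eq by (simp add: ups_ups_def)
    show "g = f" if "g \<in> Hom (HMod H) (X \<boxtimes>\<^bsub>HMod H\<^esub> Y) (X \<boxtimes>\<^bsub>HMod H\<^esub> Y) \<and>
      (BB (HMod H) X \<boxdot>\<^bsub>HMod H\<^esub> BB (HMod H) Y) \<cdot>\<^bsub>HMod H\<^esub> g =
      Ups (HMod H) (BarO (HMod H) Y) (BarO (HMod H) X) \<cdot>\<^bsub>HMod H\<^esub> BarM (HMod H) (Ups (HMod H) X Y) \<cdot>\<^bsub>HMod H\<^esub>
        BB (HMod H) (X \<boxtimes>\<^bsub>HMod H\<^esub> Y)" for g
      using that f eq uniq[of g] uniq[of f] by (simp add: ups_ups_def)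
  qed
qed

lemma coboundary_eq: "coboundary (HMod H) X Y = cobound X Y"
proof (rule coboundary_eqI[OF cobound_mor])
  interpret category "HMod H" by (rule category_HMod)
  have o: "XY \<in> Ob (HMod H)" "XY'' \<in> Ob (HMod H)"
    using XY_modules by simp_all
  have inv: "tens_arrow H (bb_arrow X) (bb_arrow Y) \<in> Hom (HMod H) XY XY''"
    "tens_arrow H (bb_inv X) (bb_inv Y) \<in> Hom (HMod H) XY'' XY"
    "comp_arrow (tens_arrow H (bb_arrow X) (bb_arrow Y)) (tens_arrow H (bb_inv X) (bb_inv Y)) = id_arrow XY''"
    using bb_tens_inverse by (simp_all add: inverse_arrows_def)
  show "comp_arrow (tens_arrow H (bb_arrow X) (bb_arrow Y)) (cobound X Y) = ups_ups X Y"
    using Comp_assoc[OF o(1,2,1,2) _ inv(2,1), of "ups_ups X Y"] Idn_left[OF o, of "ups_ups X Y"] ups_ups_mor inv(3)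
    by (simp add: cobound_def)
qed

text \<open>A composite of four isomorphisms: bb, the conjugate of \<Upsilon>, \<Upsilon> for the
  conjugates, and the inverse of bb on both factors.\<close>

lemma cobound_iso: "iso_arrow (HMod H) XY XY (cobound X Y)"
proof -
  interpret category "HMod H" by (rule category_HMod)
  have o: "XY \<in> Ob (HMod H)" "bar (bar XY) \<in> Ob (HMod H)"
    "bar ((bar Y) ** (bar X)) \<in> Ob (HMod H)" "XY'' \<in> Ob (HMod H)"
    using X Y by simp_all
  have 1: "iso_arrow (HMod H) XY (bar (bar XY)) (bb_arrow XY)"
    using bb_inverse[OF XY_modules(1)] by (auto simp: iso_arrow_def)
  have 2: "iso_arrow (HMod H) (bar (bar XY)) (bar ((bar Y) ** (bar X)))
      (bar_arrow (ups_arrow X Y))"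
    using X Y by (intro bar_iso ups_iso) simp_all
  have 3: "iso_arrow (HMod H) (bar ((bar Y) ** (bar X))) XY''
      (ups_arrow (bar Y) (bar X))"
    using X Y by (intro ups_iso) simp_all
  have 4: "iso_arrow (HMod H) XY'' XY (tens_arrow H (bb_inv X) (bb_inv Y))"
    using inverse_arrows_sym[OF bb_tens_inverse] by (auto simp: iso_arrow_def)
  show ?thesis
    using iso_arrow_comp[OF o(1,4,1) iso_arrow_comp[OF o(1,2,4) 1 iso_arrow_comp[OF o(2,3,4) 2 3]] 4]
    by (simp add: cobound_def ups_ups_def)
qed

context
  fixes x y
  assumes x: "x \<in> carrier X" and y: "y \<in> carrier Y"
begin

text \<open>\<gamma> acts on a tensor product, hence through its coproduct, indexed by
  \<open>p\<close>. The copy \<open>q\<close> of the gauge comes from the conjugate of \<Upsilon>.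
  The copy \<open>r\<close> comes from \<Upsilon> for the conjugate modules, so it acts through
  \<open>T\<close> and, the factors having been exchanged, with its legs exchanged.\<close>

lemma ups_ups_pure:
  "map_of_arrow (ups_ups X Y) (pure X Y x y) = lsum XY'' (map (\<lambda>p. lsum XY'' (map (\<lambda>q. lsum XY'' (map (\<lambda>r.
    pure (bar (bar X)) (bar (bar Y))
      (act X (starT H (snd r) \<otimes> fst q \<otimes> fst p) x) (act Y (starT H (fst r) \<otimes> snd q \<otimes> snd p) y))
    (gauge H))) (gauge H))) (comul H (gam H)))"
  unfolding ups_ups_def using X Y x y
  by (simp add: comp_map_src bb_map eval_simps ups_pure ups_lsum cong: map_cong)

lemma cobound_pure:
  "map_of_arrow (cobound X Y) (pure X Y x y) = lsum XY (map (\<lambda>r. lsum XY (map (\<lambda>q. lsum XY (map (\<lambda>p.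
    pure X Y (act X (inv (gam H) \<otimes> starT H (snd r) \<otimes> fst q \<otimes> fst p) x)
      (act Y (inv (gam H) \<otimes> starT H (fst r) \<otimes> snd q \<otimes> snd p) y))
    (comul H (gam H)))) (gauge H))) (gauge H))"
proof -
  interpret M: module complex_field XY using XY_modules by simp
  have bb: "tens_arrow H (bb_inv X) (bb_inv Y) \<in> mor XY'' XY"
    using bb_tens_inverse by (simp add: inverse_arrows_def)
  have "map_of_arrow (cobound X Y) (pure X Y x y) =
      map_of_arrow (tens_arrow H (bb_inv X) (bb_inv Y)) (map_of_arrow (ups_ups X Y) (pure X Y x y))"
    unfolding cobound_def using X Y x y by (simp add: comp_map_src mor_src[OF ups_ups_mor])
  also have "\<dots> = lsum XY (map (\<lambda>p. lsum XY (map (\<lambda>q. lsum XY (map (\<lambda>r.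
      pure X Y (act X (inv (gam H) \<otimes> starT H (snd r) \<otimes> fst q \<otimes> fst p) x)
        (act Y (inv (gam H) \<otimes> starT H (fst r) \<otimes> snd q \<otimes> snd p) y))
      (gauge H))) (gauge H))) (comul H (gam H)))"
    using X Y x y bb
    by (simp add: ups_ups_pure eval_simps mor_lsum_trg tens_arrow_pure_trg bb_inv_mor bb_inv_map cong: map_cong)
  \<comment> \<open>The composite opens the sums in the order in which the factors act; the closed
    formula lists them in the order in which they are written.\<close>
  also have "\<dots> = lsum XY (map (\<lambda>r. lsum XY (map (\<lambda>q. lsum XY (map (\<lambda>p.
      pure X Y (act X (inv (gam H) \<otimes> starT H (snd r) \<otimes> fst q \<otimes> fst p) x)
        (act Y (inv (gam H) \<otimes> starT H (fst r) \<otimes> snd q \<otimes> snd p) y))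
      (comul H (gam H)))) (gauge H))) (gauge H))"
    using X Y x y by (intro M.lsum_reverse3) simp
  finally show ?thesis .
qed

lemma cobound_usum:
  "map_of_arrow (cobound X Y) (pure X Y x y) = usum X Y
    [(act X (inv (gam H) \<otimes> starT H G2' \<otimes> G1 \<otimes> \<gamma>1) x, act Y (inv (gam H) \<otimes> starT H G1' \<otimes> G2 \<otimes> \<gamma>2) y).
      (G1', G2') \<leftarrow> gauge H, (G1, G2) \<leftarrow> gauge H, (\<gamma>1, \<gamma>2) \<leftarrow> comul H (gam H)]"
proof -
  interpret M: module complex_field XY using XY_modules by simp
  interpret T: two_modules X Y H using X Y by simp
  let ?f = "\<lambda>r q p. (act X (inv (gam H) \<otimes> starT H (snd r) \<otimes> fst q \<otimes> fst p) x,
      act Y (inv (gam H) \<otimes> starT H (fst r) \<otimes> snd q \<otimes> snd p) y)"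
  let ?l = "concat (map (\<lambda>r. concat (map (\<lambda>q. map (?f r q) (comul H (gam H))) (gauge H))) (gauge H))"
  have cl: "fst (?f r q p) \<in> carrier X" "snd (?f r q p) \<in> carrier Y"
    if "r \<in> set (gauge H)" "q \<in> set (gauge H)" "p \<in> set (comul H (gam H))" for r q p
    using X Y x y that by simp_all
  have "usum X Y ?l = lsum XY (map (\<lambda>v. pure X Y (fst v) (snd v)) ?l)"
    by (rule T.usum_lsum, rule set_concat3_subset) (simp only: mem_Times_iff cl)
  also have "\<dots> = map_of_arrow (cobound X Y) (pure X Y x y)"
    unfolding cobound_pure map_concat map_map comp_def
    by (subst M.lsum_concat3) (rule pure_closed[OF X Y cl], simp_all)
  finally show ?thesis
    by (simp add: split_def)
qed

end

end

text \<open>On pure tensors the coboundary is a sum of actions by algebra elements, and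
  \<open>f\<close> and \<open>g\<close> commute with each of these.\<close>

lemma cobound_natural:
  assumes X: "left_module H X" and X': "left_module H X'" and Y: "left_module H Y" and Y': "left_module H Y'"
    and f: "f \<in> mor X X'" and g: "g \<in> mor Y Y'"
  shows "comp_arrow (cobound X' Y') (tens_arrow H f g) = comp_arrow (tens_arrow H f g) (cobound X Y)"
proof (rule mor_ext2[OF X Y])
  have fg: "tens_arrow H f g \<in> mor (X ** Y) (X' ** Y')"
    by (rule tens_arrow_mor[OF X Y X' Y' f g])
  show "comp_arrow (cobound X' Y') (tens_arrow H f g) \<in> mor (X ** Y) (X' ** Y')"
    "comp_arrow (tens_arrow H f g) (cobound X Y) \<in> mor (X ** Y) (X' ** Y')"
    using assms fg by (auto intro!: comp_mor cobound_mor)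
  fix x y
  assume "x \<in> carrier X" "y \<in> carrier Y"
  then show "map_of_arrow (comp_arrow (cobound X' Y') (tens_arrow H f g)) (pure X Y x y) =
      map_of_arrow (comp_arrow (tens_arrow H f g) (cobound X Y)) (pure X Y x y)"
    using assms mor_map[OF f] mor_map[OF g] fg
    by (simp add: comp_map_src mor_src[OF f] mor_src[OF g] mor_trg[OF f] mor_trg[OF g] mor_src[OF cobound_mor]
        tens_arrow_pure[OF X Y X' Y' f g] cobound_pure eval_simps mor_lsum_trg del: left_module.act_mult cong: map_cong)
qed (use X' Y' in simp_all)

end

section \<open>The strong case\<close>

context strong_star_quasi_hopf_algebra
begin

text \<open>Under \<epsilon> \<otimes> \<epsilon> the left side of the strong axiom becomes
  \<epsilon>(\<gamma>) squared times \<epsilon> of the inverse of \<gamma>, that is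
  \<epsilon>(\<gamma>). On the right side both copies of the gauge contribute 1, the twisted one
  because \<epsilon> turns \<open>T\<close> into complex conjugation.\<close>

lemma counit_gam: "counit H (gam H) = 1"
proof -
  let ?F = "\<lambda>a b. counit H a * counit H b"
  have C: "abelian_group complex_field"
    using cring_complex_field by (simp add: cring_def ring_def)
  have F: "balanced H H complex_field ?F"
    by (rule balancedI) (simp_all add: algebra_simps)
  have lsum: "counit H (lsum H (map k l)) = (\<Sum>p\<leftarrow>l. counit H (k p))" if "\<And>p. p \<in> set l \<Longrightarrow> k p \<in> carrier H"
    for k and l :: "('a \<times> 'a) list"
    unfolding lsum_complex_field[symmetric]
    by (rule add_map_lsum) (use that C vs_H in \<open>simp_all add: add_map_def\<close>)
  have "counit H (inv (gam H)) = (\<Sum>p\<leftarrow>comul H (inv (gam H)). ?F (fst p) (snd p))"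
    using lsum[of "comul H (inv (gam H))" "\<lambda>p. counit H (fst p) \<odot> snd p"] counit_left[of "inv (gam H)"]
    by (simp add: split_def cong: map_cong)
  moreover have "(\<Sum>p\<leftarrow>gauge H. ?F (fst p) (snd p)) = 1"
    using lsum[of "gauge H" "\<lambda>p. counit H (fst p) \<odot> snd p"] gauge_counit_left
    by (simp add: split_def cong: map_cong)
  moreover have "(\<Sum>p\<leftarrow>gauge H. ?F (starT H (snd p)) (starT H (fst p))) = cnj (\<Sum>p\<leftarrow>gauge H. ?F (fst p) (snd p))"
  proof -
    have "(\<Sum>p\<leftarrow>l. ?F (starT H (snd p)) (starT H (fst p))) = cnj (\<Sum>p\<leftarrow>l. ?F (fst p) (snd p))"
      if "set l \<subseteq> carrier H \<times> carrier H" for l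
      using that by (induction l) (auto simp: counit_starT mult.commute)
    then show ?thesis
      using tens2_wf[OF gauge_closed] by simp
  qed
  moreover have "lsum2 complex_field ?F (tsum H H [(gam H, gam H)] \<otimes>\<^bsub>tens2 H\<^esub> comul H (inv (gam H))) =
    counit H (gam H) * counit H (gam H) * (\<Sum>p\<leftarrow>comul H (inv (gam H)). ?F (fst p) (snd p))"
    by (subst tens2_mult_tsum_eval[OF C F])
      (simp_all add: lsum_complex_field algebra_simps sum_list_const_mult cong: map_cong)
  moreover have "lsum2 complex_field ?F (tsum H H [(starT H b, starT H a). (a, b) \<leftarrow> gauge H] \<otimes>\<^bsub>tens2 H\<^esub> gauge H) =
    (\<Sum>q\<leftarrow>gauge H. ?F (fst q) (snd q) * (\<Sum>p\<leftarrow>gauge H. ?F (starT H (snd p)) (starT H (fst p))))"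
    by (subst tens2_mult_tsum_eval[OF C F flip_starT_wf[OF gauge_closed] gauge_closed])
      (simp add: lsum_complex_field split_def comp_def algebra_simps flip: sum_list_const_mult cong: map_cong)
  ultimately have "counit H (gam H) * counit H (gam H) * counit H (inv (gam H)) = 1"
    unfolding strong by simp
  moreover have "counit H (gam H) * counit H (inv (gam H)) = 1"
    using counit_simps(2)[of "gam H" "inv (gam H)"] by (simp del: counit_simps(2))
  ultimately show ?thesis
    by (simp add: mult.assoc)
qed

text \<open>With the identity as candidate, the defining equation says that \<Upsilon> after the
  conjugate of \<Upsilon> after bb equals bb on both factors. This is the strong axiom multiplied by
  the coproduct of \<gamma> from the right.\<close>

lemma coboundary_id:
  fixes X Y :: "('a, 'c) umod"
  assumes X: "left_module H X" and Y: "left_module H Y"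
  shows "coboundary (HMod H) X Y = id_arrow (X ** Y)"
proof (rule coboundary_eqI[OF X Y])
  let ?T = "X ** Y" and ?U = "(bar (bar X)) ** (bar (bar Y))"
  have U: "abelian_group ?U" using X Y by simp
  have bb: "tens_arrow H (bb_arrow X) (bb_arrow Y) \<in> mor ?T ?U"
    using X Y by (intro tens_arrow_mor bb_mor) simp_all
  show "id_arrow ?T \<in> mor ?T ?T" using X Y by simp
  show "comp_arrow (tens_arrow H (bb_arrow X) (bb_arrow Y)) (id_arrow ?T) = ups_ups X Y"
  proof (rule mor_ext2[OF X Y])
    show "comp_arrow (tens_arrow H (bb_arrow X) (bb_arrow Y)) (id_arrow ?T) \<in> mor ?T ?U"
      using X Y bb by (intro comp_mor[OF _ _ bb]) simp_all
    show "ups_ups X Y \<in> mor ?T ?U"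
      by (rule ups_ups_mor[OF X Y])
    fix x y
    assume xy: "x \<in> carrier X" "y \<in> carrier Y"
    let ?F = "\<lambda>a b. pure (bar (bar X)) (bar (bar Y)) (act X a x) (act Y b y)"
    have F: "balanced H H ?U ?F"
      by (rule balancedI)
        (use X Y xy pure_add[of "bar (bar X)" "bar (bar Y)"]
          pure_smult[of "bar (bar X)" "bar (bar Y)"] in simp_all)
    let ?S = "tsum H H [(starT H b, starT H a). (a, b) \<leftarrow> gauge H]"
    interpret M: monoid "tens2 H" by (rule tens2_monoid)
    interpret T: two_vector_spaces H H by (simp add: two_vector_spaces_def vs_H)
    have S: "?S \<in> carrier (tens2 H)"
      by (rule T.tsum_carrier[OF flip_starT_wf[OF gauge_closed]])
    have gg: "set [(gam H, gam H)] \<subseteq> carrier H \<times> carrier H" by simp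
    \<comment> \<open>The coproducts of \<gamma> and of its inverse cancel, which leaves \<gamma>
      \<otimes> \<gamma>.\<close>
    have "?S \<otimes>\<^bsub>tens2 H\<^esub> gauge H \<otimes>\<^bsub>tens2 H\<^esub> comul H (gam H) =
        tsum H H [(gam H, gam H)] \<otimes>\<^bsub>tens2 H\<^esub> (comul H (inv (gam H)) \<otimes>\<^bsub>tens2 H\<^esub> comul H (gam H))"
      unfolding strong[symmetric] by (rule M.m_assoc) (use T.tsum_carrier[OF gg] in simp_all)
    also have "\<dots> = tsum H H [(gam H, gam H)]"
      using T.tsum_carrier[OF gg]
      by (simp flip: ring_hom_mult[OF comul_hom] add: ring_hom_one[OF comul_hom])
    finally have eq: "?S \<otimes>\<^bsub>tens2 H\<^esub> gauge H \<otimes>\<^bsub>tens2 H\<^esub> comul H (gam H) = tsum H H [(gam H, gam H)]" .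
    have "map_of_arrow (ups_ups X Y) (pure X Y x y) =
        lsum2 ?U ?F (?S \<otimes>\<^bsub>tens2 H\<^esub> gauge H \<otimes>\<^bsub>tens2 H\<^esub> comul H (gam H))"
    proof -
      have "lsum ?U (map (\<lambda>q. ?F (fst q \<otimes> fst p) (snd q \<otimes> snd p)) (?S \<otimes>\<^bsub>tens2 H\<^esub> gauge H)) =
          lsum ?U (map (\<lambda>q. lsum ?U (map (\<lambda>r. ?F (starT H (snd r) \<otimes> fst q \<otimes> fst p) (starT H (fst r) \<otimes> snd q \<otimes> snd p))
            (gauge H))) (gauge H))" if "p \<in> set (comul H (gam H))" for p
        by (subst tens2_mult_tsum_eval[OF U balanced_mult_arg[OF F] flip_starT_wf[OF gauge_closed] gauge_closed])
          (use that in \<open>simp_all add: split_def comp_def\<close>)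
      then show ?thesis
        using X Y by (subst tens2_mult_eval_rev[OF U F M.m_closed[OF S gauge_closed] comul_closed])
          (simp_all add: ups_ups_pure[OF X Y xy] cong: map_cong)
    qed
    also have "\<dots> = ?F (gam H) (gam H)"
      unfolding eq using X Y xy by (subst lsum_tsum2[OF U F gg]) (simp add: lsum_single)
    also have "\<dots> = map_of_arrow (comp_arrow (tens_arrow H (bb_arrow X) (bb_arrow Y)) (id_arrow ?T)) (pure X Y x y)"
      using X Y xy by (simp add: comp_map_src tens_arrow_pure_trg bb_mor bb_map)
    finally show "map_of_arrow (comp_arrow (tens_arrow H (bb_arrow X) (bb_arrow Y)) (id_arrow ?T)) (pure X Y x y) =
        map_of_arrow (ups_ups X Y) (pure X Y x y)" ..
  qed (use X Y in simp_all)
qed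

lemma strong_bar_HMod: "strong_bar_category (HMod H)"
  by (intro strong_bar_category.intro strong_bar_category_axioms.intro bar_HMod[OF counit_gam])
    (simp add: coboundary_id)

end

theorem proposition3p17:
  fixes H :: "'h star_quasi_hopf"
    and C :: "(('h, 'a) umod, ('h, 'a) marrow) bar_cat"
  assumes "star_quasi_hopf_algebra H"
    and "C = HMod H"
  shows "(counit H (gam H) = 1 \<longrightarrow> bar_category C) \<and>
    (strong_star_quasi_hopf_algebra H \<longrightarrow> strong_bar_category C) \<and>
    (\<forall>X\<in>Ob C. \<forall>Y\<in>Ob C. \<forall>Z\<in>Ob C. \<forall>u\<in>carrier X. \<forall>v\<in>carrier Y. \<forall>w\<in>carrier Z.
       map_of_arrow (Assoc C X Y Z) (pure (X \<boxtimes>\<^bsub>C\<^esub> Y) Z (pure X Y u v) w) =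
       usum X (Y \<boxtimes>\<^bsub>C\<^esub> Z)
         [(act X \<phi>1 u, pure Y Z (act Y \<phi>2 v) (act Z \<phi>3 w)).
            (\<phi>1, \<phi>2, \<phi>3) \<leftarrow> triples (reassoc H)]) \<and>
    (\<forall>X\<in>Ob C. \<forall>h\<in>carrier H. \<forall>v\<in>carrier X.
       act (BarO C X) h v = act X (starT H h) v) \<and>
    (\<forall>X\<in>Ob C. \<forall>x\<in>carrier X. map_of_arrow (BB C X) x = act X (gam H) x) \<and>
    (\<forall>X\<in>Ob C. \<forall>Y\<in>Ob C. \<forall>x\<in>carrier X. \<forall>y\<in>carrier Y.
       map_of_arrow (Ups C X Y) (pure X Y x y) =
       usum (BarO C Y) (BarO C X) [(act Y G2 y, act X G1 x). (G1, G2) \<leftarrow> gauge H]) \<and>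
    (\<forall>z. map_of_arrow (Star C) (Scal z) = Scal (cnj z)) \<and>
    (\<forall>X\<in>Ob C. \<forall>Y\<in>Ob C.
       iso_arrow C (X \<boxtimes>\<^bsub>C\<^esub> Y) (X \<boxtimes>\<^bsub>C\<^esub> Y) (coboundary C X Y)) \<and>
    (\<forall>X\<in>Ob C. \<forall>X'\<in>Ob C. \<forall>Y\<in>Ob C. \<forall>Y'\<in>Ob C. \<forall>f\<in>Hom C X X'. \<forall>g\<in>Hom C Y Y'.
       coboundary C X' Y' \<cdot>\<^bsub>C\<^esub> (f \<boxdot>\<^bsub>C\<^esub> g) = (f \<boxdot>\<^bsub>C\<^esub> g) \<cdot>\<^bsub>C\<^esub> coboundary C X Y) \<and>
    (\<forall>X\<in>Ob C. \<forall>Y\<in>Ob C. \<forall>x\<in>carrier X. \<forall>y\<in>carrier Y.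
       map_of_arrow (coboundary C X Y) (pure X Y x y) =
       usum X Y
         [(act X (inv\<^bsub>H\<^esub> (gam H) \<otimes>\<^bsub>H\<^esub> starT H G2' \<otimes>\<^bsub>H\<^esub> G1 \<otimes>\<^bsub>H\<^esub> \<gamma>1) x,
           act Y (inv\<^bsub>H\<^esub> (gam H) \<otimes>\<^bsub>H\<^esub> starT H G1' \<otimes>\<^bsub>H\<^esub> G2 \<otimes>\<^bsub>H\<^esub> \<gamma>2) y).
            (G1', G2') \<leftarrow> gauge H, (G1, G2) \<leftarrow> gauge H, (\<gamma>1, \<gamma>2) \<leftarrow> comul H (gam H)])"
proof -
  interpret star_quasi_hopf_algebra H by fact
  have C: "C = HMod H" by fact
  have "strong_bar_category C" if "strong_star_quasi_hopf_algebra H"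
    unfolding C by (rule strong_star_quasi_hopf_algebra.strong_bar_HMod[OF that])
  moreover have "map_of_arrow (Assoc C X Y Z) (pure (X \<boxtimes>\<^bsub>C\<^esub> Y) Z (pure X Y u v) w) =
       usum X (Y \<boxtimes>\<^bsub>C\<^esub> Z)
         [(act X \<phi>1 u, pure Y Z (act Y \<phi>2 v) (act Z \<phi>3 w)). (\<phi>1, \<phi>2, \<phi>3) \<leftarrow> triples (reassoc H)]"
    if o: "X \<in> Ob C" "Y \<in> Ob C" "Z \<in> Ob C" and uvw: "u \<in> carrier X" "v \<in> carrier Y" "w \<in> carrier Z" for X Y Z u v w
  proof -
    have XYZ: "left_module H X" "left_module H Y" "left_module H Z"
      using o by (simp_all add: C)
    interpret T: two_modules X "tens_mod H Y Z" H using XYZ by simp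
    let ?f = "\<lambda>p. (act X (fst p) u, pure Y Z (act Y (fst (snd p)) v) (act Z (snd (snd p)) w))"
    \<comment> \<open>The associator is known as a sum in the target module. Once the entries are
      seen to lie in the carriers, \<open>usum_lsum\<close> identifies this sum with the single
      formal sum of the statement.\<close>
    have "?f p \<in> carrier X \<times> carrier (tens_mod H Y Z)" if "p \<in> set (triples (reassoc H))" for p
      using XYZ uvw that by simp
    then have "T.wfl (map ?f (triples (reassoc H)))"
      unfolding set_map by (rule image_subsetI)
    from T.usum_lsum[OF this] show ?thesis
      using XYZ uvw by (simp add: C assoc_pure split_def comp_def)
  qed
  moreover have "map_of_arrow (Ups C X Y) (pure X Y x y) =
      usum (BarO C Y) (BarO C X) [(act Y G2 y, act X G1 x). (G1, G2) \<leftarrow> gauge H]"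
    if o: "X \<in> Ob C" "Y \<in> Ob C" and xy: "x \<in> carrier X" "y \<in> carrier Y" for X Y x y
  proof -
    have XY: "left_module H X" "left_module H Y"
      using o by (simp_all add: C)
    interpret T: two_modules "bar_mod H Y" "bar_mod H X" H using XY by simp
    let ?f = "\<lambda>p. (act Y (snd p) y, act X (fst p) x)"
    have "?f p \<in> carrier (bar_mod H Y) \<times> carrier (bar_mod H X)" if "p \<in> set (gauge H)" for p
      using XY xy that by simp
    then have "T.wfl (map ?f (gauge H))"
      unfolding set_map by (rule image_subsetI)
    from T.usum_lsum[OF this] show ?thesis
      using XY xy by (simp add: C ups_pure split_def comp_def)
  qed
  ultimately show ?thesis
    by (simp add: C bar_HMod bb_map star_map coboundary_eq cobound_iso cobound_natural cobound_usum)
qed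

end
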